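(* Let $X$ be a locally finite simplicial complex of dimension $n$, all of whose links are connected and each of whose simplices is contained in an $n$-simplex, and let $\Gamma$ be a locally compact, unimodular group of automorphisms of $X$ acting properly discontinuously on $X$. Let $1\le k<n$. If for every unitary representation $\rho$ of $\Gamma$ there is an $\varepsilon>0$ such that for every $\gamma\in\Sigma(k+1,\Gamma)$ the matrix $A(\gamma,\Gamma,\rho)$ is positive definite with all eigenvalues greater than or equal to $\varepsilon$, then $L^2H^k(X,\rho)=0$ for every unitary representation $\rho$ of $\Gamma$.
   Context: Simplices. $\Sigma(j)$ is the set of ordered $j$-simplices of $X$ ($(j+1)$-tuples of distinct vertices spanning a simplex), and $\Sigma(j,\Gamma)\subseteq\Sigma(j)$ is a chosen set of representatives of $\Gamma$-orbits. For $\tau=(w_0,\dots,w_i)$ and $\sigma=(v_0,\dots,v_j)$ with $i\le j$, write $\tau\sqsubset\sigma$ if $\tau$ is obtained from $\sigma$ by deleting entries, keeping the order. $m(\sigma)$ is the number of unordered $n$-simplices containing $\sigma$. $\Gamma_\sigma$ is the stabilizer of the ordered simplex $\sigma$ and $|\Gamma_\sigma|$ its Haar measure. The action is properly discontinuous: continuous and simplicial, with compact (and open) stabilizers of simplices. Links. For $\tau\in\Sigma(j)$, the link $X_\tau$ is the finite $(n-j-1)$-dimensional complex of simplices $\eta$ disjoint from $\tau$ such that $\tau\eta$ (concatenation) is a simplex of $X$; $\Gamma_\tau$ acts on it. "All links are connected" means that $X_\tau$ is connected for every simplex $\tau$ of dimension at most $n-2$. $L^2$-cohomology. For a (continuous)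 unitary representation $\rho$ of $\Gamma$ on a complex Hilbert space $H$, $C^j(X,\rho)$ is the space of alternating maps $\phi:\Sigma(j)\to H$ with $\phi(\gamma\sigma)=\rho(\gamma)\phi(\sigma)$ for all $\gamma\in\Gamma$, $\sigma\in\Sigma(j)$; $L^j(X,\rho)$ is the subspace of those with $\|\phi\|^2=\sum_{\sigma\in\Sigma(j,\Gamma)}\frac{m(\sigma)}{(j+1)!|\Gamma_\sigma|}|\phi(\sigma)|^2<\infty$. The differential is $d\phi(\sigma)=\sum_{i=0}^{j+1}(-1)^i\phi(\sigma_i)$ for $\sigma\in\Sigma(j+1)$, $\sigma_i$ being $\sigma$ with its $i$-th vertex deleted; it is bounded $L^j(X,\rho)\to L^{j+1}(X,\rho)$. Then $L^2H^k(X,\rho)=\ker(d\mid L^k(X,\rho))/\mathrm{im}(d\mid L^{k-1}(X,\rho))$. Cosine. Let $Y$ be a connected finite simplicial complex, $\Lambda$ a compact group acting on $Y$ by automorphisms, $\rho$ a unitary representation of $\Lambda$ on $H$. For a simplex $\eta$ of $Y$ let $m(\eta)$ be the number of unordered top-dimensional simplices of $Y$ containing it. $C^0(Y,\rho)$ is the space of $\Lambda$-equivariant maps from the vertices of $Y$ to $H$, with inner product proportional to $\sum_v m(v)\langle\phi(v),\psi(v)\rangle$; $\phi^1$ is the projection of $\phi$ to the orthogonal complement of the constant maps, i.e. $\phi^1(v)=\phi(v)-\frac{\sum_w m(w)\phi(w)}{\sum_w m(w)}$. Define $$cos(Y,\Lambda,\rho)=\sup\left\{\frac{\sum_{(u,v)}m((u,v))\langle\phi^1(u),\phi^1(v)\rangle}{\sum_{(u,v)}m((u,v))|\phi(u)||\phi(v)|}:\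 0\ne\phi\in C^0(Y,\rho)\right\},$$ sums being over all ordered $1$-simplices $(u,v)$ of $Y$, and the supremum over $\phi$ with nonzero denominator (it is set to be $0$ if there are none). The matrix. For $\gamma\in\Sigma(k+1)$, $A(\gamma,\Gamma,\rho)$ is the matrix indexed by $\{\sigma\in\Sigma(k):\sigma\sqsubset\gamma\}$ with diagonal entries $1$ and with $(\alpha,\beta)$ entry, for $\alpha\ne\beta$, equal to $-cos(X_{\alpha\cap\beta},\Gamma_{\alpha\cap\beta},\rho)$, where $\alpha\cap\beta$ is the $(k-1)$-simplex contained in both $\alpha$ and $\beta$ and $\rho$ is restricted to $\Gamma_{\alpha\cap\beta}$. *)

theory Defs
  imports
    "HOL-Analysis.Analysis"
    "HOL-Combinatorics.Permutations"
    "HOL-Library.Sublist"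
begin

section \<open>Complex Hilbert spaces\<close>

text \<open>
  The library has no class of complex inner product spaces. The complex inner product is linear in
  its first argument, and its real part is the library's real inner product, which therefore
  supplies positivity, the norm and the topology.
\<close>

class complex_hilbert = real_inner + complete_space +
  fixes scaleC :: "complex \<Rightarrow> 'a \<Rightarrow> 'a"  (infixr "*\<^sub>C" 75)
    and cinner :: "'a \<Rightarrow> 'a \<Rightarrow> complex"
  assumes scaleC_add_right: "a *\<^sub>C (x + y) = a *\<^sub>C x + a *\<^sub>C y"
    and scaleC_add_left: "(a + b) *\<^sub>C x = a *\<^sub>C x + b *\<^sub>C x"
    and scaleC_scaleC: "a *\<^sub>C (b *\<^sub>C x) = (a * b) *\<^sub>C x"
    and scaleC_of_real: "complex_of_real r *\<^sub>C x = r *\<^sub>R x"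
    and cinner_commute: "cinner x y = cnj (cinner y x)"
    and cinner_add_left: "cinner (x + y) z = cinner x z + cinner y z"
    and cinner_scaleC_left: "cinner (a *\<^sub>C x) y = a * cinner x y"
    and Re_cinner: "Re (cinner x y) = inner x y"

text \<open>
  A closed complex subspace is itself a Hilbert space. Representations live on such subspaces of a
  fixed ambient Hilbert space, so that one can quantify over representations on Hilbert spaces of
  different dimensions inside a formula.
\<close>

definition closed_csubspace :: "'h::complex_hilbert set \<Rightarrow> bool" where
  "closed_csubspace H \<longleftrightarrow>
     closed H \<and> 0 \<in> H \<and> (\<forall>x\<in>H. \<forall>y\<in>H. x + y \<in> H) \<and> (\<forall>a. \<forall>x\<in>H. a *\<^sub>C x \<in> H)"

section \<open>Groups, Haar measure, unitary representations\<close>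

text \<open>
  Topological groups are types of class \<open>topological_group_add\<close>; as always for \<open>group_add\<close>, the
  operation is written additively but is not assumed to be commutative.
\<close>

definition left_haar_measure :: "'g::{topological_group_add, t2_space} measure \<Rightarrow> bool" where
  "left_haar_measure \<mu> \<longleftrightarrow>
     sets \<mu> = sets borel \<and>
     emeasure \<mu> (space \<mu>) \<noteq> 0 \<and>
     (\<forall>K. compact K \<longrightarrow> emeasure \<mu> K < \<infinity>) \<and>
     (\<forall>A\<in>sets borel. emeasure \<mu> A = (INF U\<in>{U. open U \<and> A \<subseteq> U}. emeasure \<mu> U)) \<and>
     (\<forall>U. open U \<longrightarrow> emeasure \<mu> U = (SUP K\<in>{K. compact K \<and> K \<subseteq> U}. emeasure \<mu> K)) \<and>
     (\<forall>g. \<forall>A\<in>sets borel. emeasure \<mu> ((\<lambda>h. g + h) ` A) = emeasure \<mu> A)"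

definition unimodular :: "'g::{topological_group_add, t2_space} itself \<Rightarrow> bool" where
  "unimodular _ \<longleftrightarrow>
     (\<forall>\<mu> :: 'g measure. left_haar_measure \<mu> \<longrightarrow>
        (\<forall>g. \<forall>A\<in>sets borel. emeasure \<mu> ((\<lambda>h. h + g) ` A) = emeasure \<mu> A))"

definition unitary_rep ::
    "'h::complex_hilbert set \<Rightarrow> ('g::topological_group_add \<Rightarrow> 'h \<Rightarrow> 'h) \<Rightarrow> bool" where
  "unitary_rep H \<rho> \<longleftrightarrow>
     closed_csubspace H \<and>
     (\<forall>g. \<forall>x\<in>H. \<rho> g x \<in> H) \<and>
     (\<forall>g. \<forall>x\<in>H. \<forall>y\<in>H. \<rho> g (x + y) = \<rho> g x + \<rho> g y) \<and>
     (\<forall>g a. \<forall>x\<in>H. \<rho> g (a *\<^sub>C x) = a *\<^sub>C \<rho> g x) \<and>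
     (\<forall>g. \<forall>x\<in>H. \<forall>y\<in>H. cinner (\<rho> g x) (\<rho> g y) = cinner x y) \<and>
     (\<forall>x\<in>H. \<rho> 0 x = x) \<and>
     (\<forall>g h. \<forall>x\<in>H. \<rho> (g + h) x = \<rho> g (\<rho> h x)) \<and>
     (\<forall>x\<in>H. continuous_on UNIV (\<lambda>g. \<rho> g x))"

section \<open>Simplicial complexes\<close>

text \<open>A complex is the set of its (nonempty, unordered) simplices; a simplex of dimension \<open>d\<close> has
  \<open>d + 1\<close> elements.\<close>

definition abstract_complex :: "'v set set \<Rightarrow> bool" where
  "abstract_complex X \<longleftrightarrow>
     (\<forall>s\<in>X. finite s \<and> s \<noteq> {} \<and> (\<forall>t. t \<subseteq> s \<and> t \<noteq> {} \<longrightarrow> t \<in> X))"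

definition vertices :: "'v set set \<Rightarrow> 'v set" where
  "vertices X = \<Union>X"

definition locally_finite :: "'v set set \<Rightarrow> bool" where
  "locally_finite X \<longleftrightarrow> (\<forall>v\<in>vertices X. finite {s\<in>X. v \<in> s})"

definition has_dimension :: "'v set set \<Rightarrow> nat \<Rightarrow> bool" where
  "has_dimension X n \<longleftrightarrow> (\<exists>s\<in>X. card s = Suc n) \<and> (\<forall>s\<in>X. card s \<le> Suc n)"

definition top_simplices :: "'v set set \<Rightarrow> 'v set set" where
  "top_simplices X = {s\<in>X. \<forall>t\<in>X. card t \<le> card s}"

definition mult :: "'v set set \<Rightarrow> 'v set \<Rightarrow> nat" where
  "mult X s = card {t \<in> top_simplices X. s \<subseteq> t}"

definition link :: "'v set set \<Rightarrow> 'v set \<Rightarrow> 'v set set" where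
  "link X s = {t\<in>X. t \<inter> s = {} \<and> s \<union> t \<in> X}"

definition connected_complex :: "'v set set \<Rightarrow> bool" where
  "connected_complex X \<longleftrightarrow>
     (\<forall>u\<in>vertices X. \<forall>v\<in>vertices X. (u, v) \<in> {(a, b). {a, b} \<in> X}\<^sup>*)"

text \<open>Dimension at most \<open>n - 2\<close> means at most \<open>n - 1\<close> vertices.\<close>

definition links_connected :: "'v set set \<Rightarrow> nat \<Rightarrow> bool" where
  "links_connected X n \<longleftrightarrow> (\<forall>s\<in>X. card s < n \<longrightarrow> connected_complex (link X s))"

text \<open>Ordered simplices; the relation \<open>\<sqsubset>\<close> between them is \<^const>\<open>subseq\<close>.\<close>

definition ordered_simplices :: "'v set set \<Rightarrow> nat \<Rightarrow> 'v list set" where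
  "ordered_simplices X j = {\<sigma>. length \<sigma> = Suc j \<and> distinct \<sigma> \<and> set \<sigma> \<in> X}"

definition delete_nth :: "nat \<Rightarrow> 'v list \<Rightarrow> 'v list" where
  "delete_nth i \<sigma> = take i \<sigma> @ drop (Suc i) \<sigma>"

definition meet :: "'v list \<Rightarrow> 'v list \<Rightarrow> 'v list" where
  "meet \<alpha> \<beta> = filter (\<lambda>v. v \<in> set \<beta>) \<alpha>"

section \<open>Actions\<close>

definition simplicial_action :: "'v set set \<Rightarrow> ('g::group_add \<Rightarrow> 'v \<Rightarrow> 'v) \<Rightarrow> bool" where
  "simplicial_action X act \<longleftrightarrow>
     (\<forall>v\<in>vertices X. act 0 v = v) \<and>
     (\<forall>g h. \<forall>v\<in>vertices X. act (g + h) v = act g (act h v)) \<and>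
     (\<forall>g. \<forall>s\<in>X. act g ` s \<in> X)"

definition stab :: "('g \<Rightarrow> 'v \<Rightarrow> 'v) \<Rightarrow> 'v list \<Rightarrow> 'g set" where
  "stab act \<sigma> = {g. map (act g) \<sigma> = \<sigma>}"

text \<open>A simplicial action on a locally finite complex is continuous iff it is continuous on the
  discrete set of vertices.\<close>

definition properly_discontinuous ::
    "'v set set \<Rightarrow> ('g::topological_group_add \<Rightarrow> 'v \<Rightarrow> 'v) \<Rightarrow> bool" where
  "properly_discontinuous X act \<longleftrightarrow>
     simplicial_action X act \<and>
     continuous_map (prod_topology euclidean (discrete_topology (vertices X)))
       (discrete_topology (vertices X)) (\<lambda>(g, v). act g v) \<and>
     (\<forall>j. \<forall>\<sigma>\<in>ordered_simplices X j. compact (stab act \<sigma>) \<and> open (stab act \<sigma>))"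

definition orbit_representatives ::
    "'v set set \<Rightarrow> ('g \<Rightarrow> 'v \<Rightarrow> 'v) \<Rightarrow> (nat \<Rightarrow> 'v list set) \<Rightarrow> bool" where
  "orbit_representatives X act R \<longleftrightarrow>
     (\<forall>j. R j \<subseteq> ordered_simplices X j \<and>
          (\<forall>\<sigma>\<in>ordered_simplices X j. \<exists>!r. r \<in> R j \<and> (\<exists>g. \<sigma> = map (act g) r)))"

section \<open>\<open>L\<^sup>2\<close>-cohomology\<close>

text \<open>A cochain is represented by a function on all lists that vanishes outside the ordered
  \<open>j\<close>-simplices, so that equality of cochains is equality of functions.\<close>

definition cochains ::
    "'v set set \<Rightarrow> ('g \<Rightarrow> 'v \<Rightarrow> 'v) \<Rightarrow> 'h::complex_hilbert set \<Rightarrow> ('g \<Rightarrow> 'h \<Rightarrow> 'h) \<Rightarrow> nat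
      \<Rightarrow> ('v list \<Rightarrow> 'h) set" where
  "cochains X act H \<rho> j =
     {\<phi>. (\<forall>\<sigma>. \<sigma> \<notin> ordered_simplices X j \<longrightarrow> \<phi> \<sigma> = 0) \<and>
         (\<forall>\<sigma>\<in>ordered_simplices X j. \<phi> \<sigma> \<in> H) \<and>
         (\<forall>\<sigma>\<in>ordered_simplices X j. \<forall>p. p permutes {..<Suc j} \<longrightarrow>
            \<phi> (permute_list p \<sigma>) = of_int (sign p) *\<^sub>R \<phi> \<sigma>) \<and>
         (\<forall>g. \<forall>\<sigma>\<in>ordered_simplices X j. \<phi> (map (act g) \<sigma>) = \<rho> g (\<phi> \<sigma>))}"

definition L2_cochains ::
    "'v set set \<Rightarrow> ('g::topological_group_add \<Rightarrow> 'v \<Rightarrow> 'v) \<Rightarrow> 'g measure \<Rightarrow> (nat \<Rightarrow> 'v list set)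
      \<Rightarrow> 'h::complex_hilbert set \<Rightarrow> ('g \<Rightarrow> 'h \<Rightarrow> 'h) \<Rightarrow> nat \<Rightarrow> ('v list \<Rightarrow> 'h) set" where
  "L2_cochains X act \<mu> R H \<rho> j =
     {\<phi> \<in> cochains X act H \<rho> j.
        (\<lambda>\<sigma>. real (mult X (set \<sigma>)) / (fact (Suc j) * measure \<mu> (stab act \<sigma>)) * (norm (\<phi> \<sigma>))\<^sup>2)
          summable_on R j}"

definition coboundary ::
    "'v set set \<Rightarrow> nat \<Rightarrow> ('v list \<Rightarrow> 'h::complex_hilbert) \<Rightarrow> 'v list \<Rightarrow> 'h" where
  "coboundary X j \<phi> =
     (\<lambda>\<sigma>. if \<sigma> \<in> ordered_simplices X (Suc j)
          then \<Sum>i\<le>Suc j. (-1) ^ i *\<^sub>R \<phi> (delete_nth i \<sigma>) else 0)"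

definition L2_cocycles ::
    "'v set set \<Rightarrow> ('g::topological_group_add \<Rightarrow> 'v \<Rightarrow> 'v) \<Rightarrow> 'g measure \<Rightarrow> (nat \<Rightarrow> 'v list set)
      \<Rightarrow> 'h::complex_hilbert set \<Rightarrow> ('g \<Rightarrow> 'h \<Rightarrow> 'h) \<Rightarrow> nat \<Rightarrow> ('v list \<Rightarrow> 'h) set" where
  "L2_cocycles X act \<mu> R H \<rho> k =
     {\<phi> \<in> L2_cochains X act \<mu> R H \<rho> k. coboundary X k \<phi> = (\<lambda>_. 0)}"

definition L2_coboundaries ::
    "'v set set \<Rightarrow> ('g::topological_group_add \<Rightarrow> 'v \<Rightarrow> 'v) \<Rightarrow> 'g measure \<Rightarrow> (nat \<Rightarrow> 'v list set)
      \<Rightarrow> 'h::complex_hilbert set \<Rightarrow> ('g \<Rightarrow> 'h \<Rightarrow> 'h) \<Rightarrow> nat \<Rightarrow> ('v list \<Rightarrow> 'h) set" where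
  "L2_coboundaries X act \<mu> R H \<rho> k =
     (if k = 0 then {\<lambda>_. 0} else coboundary X (k - 1) ` L2_cochains X act \<mu> R H \<rho> (k - 1))"

text \<open>The quotient space as a set of cosets. Its zero element is the coset of 0, that is, the space
  of coboundaries.\<close>

definition L2_cohomology ::
    "'v set set \<Rightarrow> ('g::topological_group_add \<Rightarrow> 'v \<Rightarrow> 'v) \<Rightarrow> 'g measure \<Rightarrow> (nat \<Rightarrow> 'v list set)
      \<Rightarrow> 'h::complex_hilbert set \<Rightarrow> ('g \<Rightarrow> 'h \<Rightarrow> 'h) \<Rightarrow> nat \<Rightarrow> ('v list \<Rightarrow> 'h) set set" where
  "L2_cohomology X act \<mu> R H \<rho> k =
     (\<lambda>\<phi>. {\<lambda>\<sigma>. \<phi> \<sigma> + \<psi> \<sigma> | \<psi>. \<psi> \<in> L2_coboundaries X act \<mu> R H \<rho> k})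
       ` L2_cocycles X act \<mu> R H \<rho> k"

section \<open>The cosine and the matrix\<close>

definition equivariant_0cochains ::
    "'v set set \<Rightarrow> 'g set \<Rightarrow> ('g \<Rightarrow> 'v \<Rightarrow> 'v) \<Rightarrow> 'h::complex_hilbert set \<Rightarrow> ('g \<Rightarrow> 'h \<Rightarrow> 'h)
      \<Rightarrow> ('v \<Rightarrow> 'h) set" where
  "equivariant_0cochains Y \<Lambda> act H \<rho> =
     {\<phi>. \<forall>v\<in>vertices Y. \<phi> v \<in> H \<and> (\<forall>g\<in>\<Lambda>. \<phi> (act g v) = \<rho> g (\<phi> v))}"

definition edges :: "'v set set \<Rightarrow> ('v \<times> 'v) set" where
  "edges Y = {(u, v). u \<noteq> v \<and> {u, v} \<in> Y}"

definition nonconstant_part ::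
    "'v set set \<Rightarrow> ('v \<Rightarrow> 'h::complex_hilbert) \<Rightarrow> 'v \<Rightarrow> 'h" where
  "nonconstant_part Y \<phi> v =
     \<phi> v - (1 / (\<Sum>w\<in>vertices Y. real (mult Y {w}))) *\<^sub>R
             (\<Sum>w\<in>vertices Y. real (mult Y {w}) *\<^sub>R \<phi> w)"

definition cosine_numerator :: "'v set set \<Rightarrow> ('v \<Rightarrow> 'h::complex_hilbert) \<Rightarrow> complex" where
  "cosine_numerator Y \<phi> =
     (\<Sum>(u, v)\<in>edges Y. of_nat (mult Y {u, v}) *
        cinner (nonconstant_part Y \<phi> u) (nonconstant_part Y \<phi> v))"

definition cosine_denominator :: "'v set set \<Rightarrow> ('v \<Rightarrow> 'h::complex_hilbert) \<Rightarrow> real" where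
  "cosine_denominator Y \<phi> = (\<Sum>(u, v)\<in>edges Y. real (mult Y {u, v}) * norm (\<phi> u) * norm (\<phi> v))"

text \<open>The numerator is real, since it is invariant under exchanging \<open>u\<close> and \<open>v\<close>; taking its real part
  only converts the type. For finite \<open>Y\<close> the quotients are at most 1.\<close>

definition cosine ::
    "'v set set \<Rightarrow> 'g set \<Rightarrow> ('g \<Rightarrow> 'v \<Rightarrow> 'v) \<Rightarrow> 'h::complex_hilbert set \<Rightarrow> ('g \<Rightarrow> 'h \<Rightarrow> 'h)
      \<Rightarrow> real" where
  "cosine Y \<Lambda> act H \<rho> =
     (let Q = {Re (cosine_numerator Y \<phi>) / cosine_denominator Y \<phi> | \<phi>.
                 \<phi> \<in> equivariant_0cochains Y \<Lambda> act H \<rho> \<and> (\<exists>v\<in>vertices Y. \<phi> v \<noteq> 0) \<and>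
                 cosine_denominator Y \<phi> \<noteq> 0}
      in if Q = {} then 0 else Sup Q)"

text \<open>Square real matrices indexed by an arbitrary finite set \<open>I\<close>.\<close>

definition positive_definite_on :: "'i set \<Rightarrow> ('i \<Rightarrow> 'i \<Rightarrow> real) \<Rightarrow> bool" where
  "positive_definite_on I A \<longleftrightarrow>
     (\<forall>\<alpha>\<in>I. \<forall>\<beta>\<in>I. A \<alpha> \<beta> = A \<beta> \<alpha>) \<and>
     (\<forall>x. (\<exists>\<alpha>\<in>I. x \<alpha> \<noteq> 0) \<longrightarrow> 0 < (\<Sum>\<alpha>\<in>I. \<Sum>\<beta>\<in>I. x \<alpha> * A \<alpha> \<beta> * x \<beta>))"

definition eigenvalue_on :: "'i set \<Rightarrow> ('i \<Rightarrow> 'i \<Rightarrow> real) \<Rightarrow> real \<Rightarrow> bool" where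
  "eigenvalue_on I A c \<longleftrightarrow>
     (\<exists>x. (\<exists>\<alpha>\<in>I. x \<alpha> \<noteq> 0) \<and> (\<forall>\<alpha>\<in>I. (\<Sum>\<beta>\<in>I. A \<alpha> \<beta> * x \<beta>) = c * x \<alpha>))"

definition faces :: "'v set set \<Rightarrow> nat \<Rightarrow> 'v list \<Rightarrow> 'v list set" where
  "faces X k \<gamma> = {\<sigma> \<in> ordered_simplices X k. subseq \<sigma> \<gamma>}"

text \<open>The matrix \<open>A(\<gamma>, \<Gamma>, \<rho>)\<close>; it is used on the index set \<^term>\<open>faces X k \<gamma>\<close> with \<open>\<gamma>\<close> an ordered
  \<open>(k+1)\<close>-simplex. The formula for the entries does not mention \<open>\<gamma>\<close>.\<close>

definition cosine_matrix ::
    "'v set set \<Rightarrow> ('g \<Rightarrow> 'v \<Rightarrow> 'v) \<Rightarrow> 'h::complex_hilbert set \<Rightarrow> ('g \<Rightarrow> 'h \<Rightarrow> 'h)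
      \<Rightarrow> 'v list \<Rightarrow> 'v list \<Rightarrow> real" where
  "cosine_matrix X act H \<rho> \<alpha> \<beta> =
     (if \<alpha> = \<beta> then 1
      else - cosine (link X (set (meet \<alpha> \<beta>))) (stab act (meet \<alpha> \<beta>)) act H \<rho>)"

end

theory Submission
  imports Defs
begin

text \<open>
  A cocycle \<open>\<phi>\<close> of degree \<open>k\<close> satisfies an inequality \<open>c |\<phi>|\<^sup>2 \<le> |\<delta> \<phi>|\<^sup>2\<close>, where \<open>\<delta>\<close> is the adjoint of \<open>d\<close> and
  \<open>c > 0\<close> does not depend on \<open>\<phi>\<close> (\<open>spectral_gap\<close>). Since \<open>d\<close> and \<open>\<delta>\<close> are bounded, this makes \<open>d \<delta>\<close>
  invertible on the space of cocycles, so that every cocycle is the coboundary of a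
  square-integrable cochain (\<open>cocycle_is_coboundary\<close>).

  The inequality comes from a computation in links. Let \<open>\<gamma>\<close> be a \<open>(k + 1)\<close>-simplex with faces
  \<open>\<gamma>\<^sub>i\<close>. Expanding \<open>|d \<phi> \<gamma>|\<^sup>2 = 0\<close> expresses \<open>\<Sum>\<^sub>i |\<phi> \<gamma>\<^sub>i|\<^sup>2\<close> by cross terms of two faces. Two faces meet in a
  \<open>(k - 1)\<close>-simplex \<open>\<tau>\<close>; if \<open>u\<close> and \<open>v\<close> are the two remaining vertices of \<open>\<gamma>\<close>, the cross term is
  \<open>\<langle>\<phi> (\<tau> u), \<phi> (\<tau> v)\<rangle>\<close>, which belongs to the edge \<open>(u, v)\<close> of the link of \<open>\<tau>\<close>. Summed over all \<open>\<gamma>\<close>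
  containing \<open>\<tau>\<close>, these terms form the edge sum of the function \<open>v \<mapsto> \<phi> (\<tau> v)\<close> on the link. By definition of
  the cosine that sum is at most the cosine times the corresponding sum of \<open>|\<phi> (\<tau> u)| |\<phi> (\<tau> v)|\<close>, plus a
  multiple of the squared mean of the function; and its mean is, up to a constant, \<open>\<delta> \<phi> \<tau>\<close>
  (\<open>link_inequality\<close>). Regrouped by \<open>\<gamma>\<close>, the difference between \<open>\<Sum>\<^sub>i |\<phi> \<gamma>\<^sub>i|\<^sup>2\<close> and these products of norms is
  the quadratic form of the cosine matrix at the vector of the numbers \<open>|\<phi> \<gamma>\<^sub>i|\<close>, which is at least
  \<open>\<epsilon> \<Sum>\<^sub>i |\<phi> \<gamma>\<^sub>i|\<^sup>2\<close> (\<open>eigenvalues_bound_quadratic_form\<close>).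

  Passing from sums over orbits of \<open>\<gamma>\<close> to sums over orbits of \<open>\<tau>\<close> is the unfolding formula
  \<open>unfold_orbit_sum\<close>. It rests on the orbit-stabilizer theorem for Haar measure and on the invariance of
  the measure of a stabilizer under conjugation, that is, on unimodularity.
\<close>

section \<open>Deleting and moving entries of lists\<close>

definition move_last :: "nat \<Rightarrow> 'a list \<Rightarrow> 'a list" where
  "move_last i xs = delete_nth i xs @ [xs ! i]"

text \<open>
  An ordered pair of distinct positions in a list can be recorded as \<open>(i, skip i j)\<close>, where \<open>j\<close> is
  the index of the second entry after the \<open>i\<close>-th one has been deleted. Then \<open>coskip i j\<close> is the index
  of the first entry after the second one has been deleted, so that exchanging the two entries is
  the involution \<open>(i, j) \<mapsto> (skip i j, coskip i j)\<close>.
\<close>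

definition skip :: "nat \<Rightarrow> nat \<Rightarrow> nat" where
  "skip i j = (if j < i then j else Suc j)"

definition coskip :: "nat \<Rightarrow> nat \<Rightarrow> nat" where
  "coskip i j = (if j < i then i - 1 else i)"

lemma skip_involution:
  "skip (skip i j) (coskip i j) = i" "coskip (skip i j) (coskip i j) = j"
  by (auto simp: skip_def coskip_def)

lemma skip_bounds:
  assumes "i \<le> Suc k" "j \<le> k"
  shows "skip i j \<le> Suc k" "coskip i j \<le> k" "skip i j \<noteq> i"
  using assms by (auto simp: skip_def coskip_def)

text \<open>
  The exchange of the two deleted entries reverses the sign. This is what makes \<open>d\<close> square to zero,
  and what turns the signed cross terms of \<open>|d \<phi>|\<^sup>2\<close> into unsigned ones.
\<close>

lemma skip_sign: "(-1::real) ^ (skip i j + coskip i j) = - ((-1) ^ (i + j))"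
  by (cases i) (auto simp: skip_def coskip_def add.commute)

lemma sum_exchange_pairs:
  "(\<Sum>i\<le>Suc k. \<Sum>j\<le>k. h (skip i j) (coskip i j)) = (\<Sum>i\<le>Suc k. \<Sum>j\<le>k. h i j)"
  unfolding sum.cartesian_product
  by (rule sum.reindex_bij_witness[where i = "\<lambda>(i, j). (skip i j, coskip i j)"
        and j = "\<lambda>(i, j). (skip i j, coskip i j)"])
     (auto simp: skip_involution skip_bounds)

lemma sum_split_skip:
  fixes f :: "nat \<Rightarrow> 'b::comm_monoid_add"
  assumes "i \<le> Suc k"
  shows "(\<Sum>s\<le>Suc k. f s) = f i + (\<Sum>j\<le>k. f (skip i j))"
proof -
  have "(\<Sum>s\<in>{..Suc k} - {i}. f s) = (\<Sum>j\<le>k. f (skip i j))"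
    by (rule sum.reindex_bij_witness[where i = "skip i" and j = "\<lambda>s. if s < i then s else s - 1"])
       (use assms in \<open>auto simp: skip_def split: if_splits\<close>)
  then show ?thesis
    using assms by (subst sum.remove[where x = i]) auto
qed

lemma length_delete_nth [simp]: "i < length xs \<Longrightarrow> length (delete_nth i xs) = length xs - 1"
  by (simp add: delete_nth_def)

lemma nth_delete_nth:
  "i < length xs \<Longrightarrow> q < length xs - 1 \<Longrightarrow> delete_nth i xs ! q = xs ! skip i q"
  by (auto simp: delete_nth_def skip_def nth_append min_def)

lemma delete_nth_delete_nth:
  assumes "length xs = Suc (Suc k)" "i \<le> Suc k" "j \<le> k"
  shows "delete_nth (coskip i j) (delete_nth (skip i j) xs) = delete_nth j (delete_nth i xs)"
proof (rule nth_equalityI)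
  show "length (delete_nth (coskip i j) (delete_nth (skip i j) xs))
          = length (delete_nth j (delete_nth i xs))"
    using assms skip_bounds[OF assms(2,3)] by simp
next
  fix q assume q: "q < length (delete_nth (coskip i j) (delete_nth (skip i j) xs))"
  have q': "q < k" using q assms skip_bounds[OF assms(2,3)] by simp
  have "delete_nth (coskip i j) (delete_nth (skip i j) xs) ! q = xs ! skip (skip i j) (skip (coskip i j) q)"
    using q' assms skip_bounds[OF assms(2,3)] skip_bounds(1)[of "coskip i j" k q]
    by (subst nth_delete_nth, simp, simp, subst nth_delete_nth) (auto simp: skip_def)
  also have "skip (skip i j) (skip (coskip i j) q) = skip i (skip j q)"
    by (auto simp: skip_def coskip_def)
  also have "xs ! skip i (skip j q) = delete_nth j (delete_nth i xs) ! q"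
    using q' assms
    by (subst nth_delete_nth, simp, simp, subst nth_delete_nth) (auto simp: skip_def)
  finally show "delete_nth (coskip i j) (delete_nth (skip i j) xs) ! q = delete_nth j (delete_nth i xs) ! q" .
qed

lemma delete_nth_map: "delete_nth i (map f xs) = map f (delete_nth i xs)"
  by (simp add: delete_nth_def take_map drop_map)

lemma delete_nth_eq_filter:
  "distinct xs \<Longrightarrow> i < length xs \<Longrightarrow> delete_nth i xs = filter (\<lambda>v. v \<noteq> xs ! i) xs"
proof -
  assume d: "distinct xs" and i: "i < length xs"
  have eq: "xs = take i xs @ xs ! i # drop (Suc i) xs"
    using i by (rule id_take_nth_drop)
  have n: "xs ! i \<notin> set (take i xs)" "xs ! i \<notin> set (drop (Suc i) xs)"
    using d by (subst (asm) eq, auto)+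
  then have "filter (\<lambda>v. v \<noteq> xs ! i) (take i xs) = take i xs"
    "filter (\<lambda>v. v \<noteq> xs ! i) (drop (Suc i) xs) = drop (Suc i) xs"
    by (intro filter_True; blast)+
  then have "filter (\<lambda>v. v \<noteq> xs ! i) (take i xs @ xs ! i # drop (Suc i) xs) = delete_nth i xs"
    unfolding delete_nth_def by simp
  then show ?thesis by (simp flip: eq)
qed

lemma set_delete_nth:
  "distinct xs \<Longrightarrow> i < length xs \<Longrightarrow> set (delete_nth i xs) = set xs - {xs ! i}"
  by (auto simp: delete_nth_eq_filter)

lemma distinct_delete_nth: "distinct xs \<Longrightarrow> i < length xs \<Longrightarrow> distinct (delete_nth i xs)"
  by (simp add: delete_nth_eq_filter)

lemma delete_nth_append: "i < length xs \<Longrightarrow> delete_nth i (xs @ ys) = delete_nth i xs @ ys"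
  by (simp add: delete_nth_def)

lemma delete_nth_length: "delete_nth (length xs) (xs @ y # ys) = xs @ ys"
  by (simp add: delete_nth_def)

lemma delete_nth_last: "length xs = Suc j \<Longrightarrow> delete_nth j xs = butlast xs"
  by (simp add: delete_nth_def butlast_conv_take)

lemma length_move_last [simp]: "i < length xs \<Longrightarrow> length (move_last i xs) = length xs"
  by (simp add: move_last_def)

lemma move_last_map: "i < length xs \<Longrightarrow> move_last i (map f xs) = map f (move_last i xs)"
  by (simp add: move_last_def delete_nth_map)

lemma set_move_last: "i < length xs \<Longrightarrow> set (move_last i xs) = set xs"
  using arg_cong[OF id_take_nth_drop[of i xs], of set]
  by (simp add: move_last_def delete_nth_def)

lemma distinct_move_last: "distinct xs \<Longrightarrow> i < length xs \<Longrightarrow> distinct (move_last i xs)"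
  by (simp add: move_last_def distinct_delete_nth set_delete_nth)

lemma inj_move_last:
  assumes "length xs = length ys" "i < length xs" "move_last i xs = move_last i ys"
  shows "xs = ys"
proof -
  have "take i xs @ drop (Suc i) xs = take i ys @ drop (Suc i) ys" and e: "xs ! i = ys ! i"
    using assms(3) by (auto simp: move_last_def delete_nth_def)
  then have "take i xs = take i ys" "drop (Suc i) xs = drop (Suc i) ys"
    using assms by auto
  then show ?thesis
    using e assms id_take_nth_drop[of i xs] id_take_nth_drop[of i ys] by simp
qed

lemma surj_move_last:
  assumes "length ys = Suc j" "i \<le> j"
  obtains xs where "length xs = Suc j" "move_last i xs = ys"
proof -
  obtain zs a where ys: "ys = zs @ [a]" using assms by (cases ys rule: rev_cases) auto
  have len: "length zs = j" using assms ys by simp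
  then have l: "length (take i zs) = i" using assms by simp
  let ?xs = "take i zs @ a # drop i zs"
  have "delete_nth i ?xs = take i zs @ drop i zs"
    using delete_nth_length[of "take i zs" a "drop i zs"] by (simp only: l)
  moreover have "?xs ! i = a" by (simp only: nth_append l) simp
  ultimately have "move_last i ?xs = ys" by (simp add: move_last_def ys)
  moreover have "length ?xs = Suc j" using len assms by simp
  ultimately show ?thesis using that by blast
qed

lemma subseq_delete_nth: "subseq (delete_nth i xs) xs"
proof -
  have "subseq (drop 1 (drop i xs)) (drop i xs)"
    using list_emb_append2[of "(=)" _ "drop 1 (drop i xs)" "take 1 (drop i xs)"] by (metis append_take_drop_id subseq_order.order_refl)
  then have "subseq (take i xs @ drop (Suc i) xs) (take i xs @ drop i xs)"
    by (intro list_emb_append_mono) auto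
  then show ?thesis by (simp add: delete_nth_def)
qed

lemma subseq_imp_delete_nth:
  assumes "subseq ys xs" "length xs = Suc (length ys)"
  shows "\<exists>i<length xs. ys = delete_nth i xs"
  using assms
proof (induction rule: list_emb.induct)
  case (list_emb_Nil ys)
  then show ?case by (intro exI[of _ 0]) (cases ys; simp add: delete_nth_def)
next
  case (list_emb_Cons xs ys y)
  then have "xs = ys" by (metis length_Cons subseq_same_length Suc_inject)
  then show ?case by (intro exI[of _ 0]) (simp add: delete_nth_def)
next
  case (list_emb_Cons2 x y xs ys)
  then obtain i where "i < length ys" "xs = delete_nth i ys" by auto
  then show ?case using list_emb_Cons2 by (intro exI[of _ "Suc i"]) (auto simp: delete_nth_def)
qed

section \<open>Alternating functions of ordered simplices\<close>

definition alternating_on :: "'a list set \<Rightarrow> ('a list \<Rightarrow> 'b::real_vector) \<Rightarrow> bool" where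
  "alternating_on A f \<longleftrightarrow> (\<forall>xs a b ys. xs @ a # b # ys \<in> A \<longrightarrow> f (xs @ b # a # ys) = - f (xs @ a # b # ys))"

lemma ordered_simplices_cong:
  "zs \<in> ordered_simplices X j \<Longrightarrow> mset zs' = mset zs \<Longrightarrow> zs' \<in> ordered_simplices X j"
  unfolding ordered_simplices_def
  by (auto dest: mset_eq_length mset_eq_setD mset_eq_imp_distinct_iff)

lemma alternating_swap:
  assumes alt: "alternating_on (ordered_simplices X j) f"
  shows "xs @ a # ms @ b # ys \<in> ordered_simplices X j \<Longrightarrow> f (xs @ b # ms @ a # ys) = - f (xs @ a # ms @ b # ys)"
proof (induction ms arbitrary: xs)
  case Nil
  then show ?case using alt by (auto simp: alternating_on_def)
next
  case (Cons m ms)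
  have A: "xs @ a # m # ms @ b # ys \<in> ordered_simplices X j" using Cons.prems by simp
  have 1: "f (xs @ m # a # ms @ b # ys) = - f (xs @ a # m # ms @ b # ys)"
    using alt A unfolding alternating_on_def by blast
  have B: "(xs @ [m]) @ a # ms @ b # ys \<in> ordered_simplices X j"
    by (rule ordered_simplices_cong[OF A]) simp
  have 2: "f ((xs @ [m]) @ b # ms @ a # ys) = - f ((xs @ [m]) @ a # ms @ b # ys)"
    by (rule Cons.IH[OF B])
  have C: "xs @ m # b # ms @ a # ys \<in> ordered_simplices X j"
    by (rule ordered_simplices_cong[OF A]) simp
  have 3: "f (xs @ b # m # ms @ a # ys) = - f (xs @ m # b # ms @ a # ys)"
    using alt C unfolding alternating_on_def by blast
  show ?case using 1 2 3 by simp
qed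

lemma permute_list_transpose:
  "permute_list (Transposition.transpose (length xs) (Suc (length xs + length ms))) (xs @ a # ms @ b # ys)
     = xs @ b # ms @ a # ys" (is "permute_list ?t ?l = ?r")
proof (rule nth_equalityI)
  fix i assume i: "i < length (permute_list ?t ?l)"
  have "?t permutes {..<length ?l}" by (rule permutes_swap_id) auto
  then have "permute_list ?t ?l ! i = ?l ! ?t i" using i by (simp add: permute_list_nth)
  also have "\<dots> = ?r ! i"
    by (auto simp: Transposition.transpose_def nth_append nth_Cons' not_less)
  finally show "permute_list ?t ?l ! i = ?r ! i" .
qed simp

lemma decompose_at_two_positions:
  assumes "a < b" "b < length zs"
  obtains xs ms ys u v where "zs = xs @ u # ms @ v # ys" "length xs = a" "Suc (length xs + length ms) = b"
proof -
  have 1: "zs = take b zs @ zs ! b # drop (Suc b) zs" using assms by (simp add: id_take_nth_drop)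
  have 2: "take b zs = take a (take b zs) @ take b zs ! a # drop (Suc a) (take b zs)"
    using assms by (intro id_take_nth_drop) simp
  have "zs = take a (take b zs) @ take b zs ! a # drop (Suc a) (take b zs) @ zs ! b # drop (Suc b) zs"
    by (subst 1, subst 2) simp
  then show ?thesis by (rule that) (use assms in auto)
qed

text \<open>
  Permutations are generated by transpositions of positions, and a transposition of two arbitrary
  positions is an odd number of exchanges of neighbours (\<open>alternating_swap\<close>). Hence it suffices to
  test the exchange of neighbours, which is the convenient form for \<open>d\<close>.
\<close>

lemma alternating_iff_sign:
  "alternating_on (ordered_simplices X j) f \<longleftrightarrow>
     (\<forall>zs\<in>ordered_simplices X j. \<forall>p. p permutes {..<Suc j} \<longrightarrow>
        f (permute_list p zs) = of_int (sign p) *\<^sub>R f zs)" (is "?A \<longleftrightarrow> ?B")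
proof
  assume B: ?B
  show ?A unfolding alternating_on_def
  proof (intro allI impI)
    fix xs a b ys assume zs: "xs @ a # b # ys \<in> ordered_simplices X j"
    let ?t = "Transposition.transpose (length xs) (Suc (length xs))"
    have "?t permutes {..<Suc j}"
      using zs by (intro permutes_swap_id) (auto simp: ordered_simplices_def)
    with B zs have "f (permute_list ?t (xs @ a # b # ys)) = of_int (sign ?t) *\<^sub>R f (xs @ a # b # ys)"
      by blast
    then show "f (xs @ b # a # ys) = - f (xs @ a # b # ys)"
      using permute_list_transpose[of xs "[]" a b ys] by (simp add: sign_swap_id)
  qed
next
  assume A: ?A
  show ?B
  proof (intro ballI allI impI)
    fix zs p assume zs: "zs \<in> ordered_simplices X j" and p: "p permutes {..<Suc j}"
    have len: "length zs = Suc j" using zs by (simp add: ordered_simplices_def)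
    have swap: "f (permute_list (Transposition.transpose a b) zs') = - f zs'"
      if "a < b" "b \<le> j" and zs': "zs' \<in> ordered_simplices X j" for a b zs'
    proof -
      have "b < length zs'" using that by (simp add: ordered_simplices_def)
      then obtain xs ms ys u v where
        d: "zs' = xs @ u # ms @ v # ys" "length xs = a" "Suc (length xs + length ms) = b"
        by (rule decompose_at_two_positions[OF \<open>a < b\<close>])
      have "permute_list (Transposition.transpose a b) zs' = xs @ v # ms @ u # ys"
        using permute_list_transpose[of xs ms u v ys] d(2,3) unfolding d(1) by simp
      then show ?thesis using alternating_swap[OF A] zs' d(1) by simp
    qed
    have swap': "f (permute_list (Transposition.transpose a b) zs') = - f zs'"
      if "a \<noteq> b" "a \<le> j" "b \<le> j" and zs': "zs' \<in> ordered_simplices X j" for a b zs'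
      using swap[of a b zs'] swap[of b a zs'] that by (cases "a < b") (auto simp: transpose_commute)
    show "f (permute_list p zs) = of_int (sign p) *\<^sub>R f zs"
      using finite_lessThan[of "Suc j"] p
    proof (induction rule: permutes_rev_induct)
      case id
      then show ?case by simp
    next
      case (swap a b p)
      have t: "Transposition.transpose a b permutes {..<length zs}"
        using swap len by (intro permutes_swap_id) auto
      have "permute_list (p \<circ> Transposition.transpose a b) zs
              = permute_list (Transposition.transpose a b) (permute_list p zs)"
        by (rule permute_list_compose[OF t])
      moreover have "permute_list p zs \<in> ordered_simplices X j"
        using swap len by (intro ordered_simplices_cong[OF zs] mset_permute_list) simp
      ultimately have "f (permute_list (p \<circ> Transposition.transpose a b) zs) = - f (permute_list p zs)"
        using swap'[of a b "permute_list p zs"] swap by simp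
      also have "\<dots> = of_int (sign (p \<circ> Transposition.transpose a b)) *\<^sub>R f zs"
        using swap
        by (subst sign_compose)
           (auto simp: sign_swap_id permutation_swap_id intro: permutes_imp_permutation)
      finally show ?case .
    qed
  qed
qed

text \<open>
  Bringing the \<open>i\<close>-th of the entries \<open>0, \<dots>, j\<close> to the end takes \<open>j - i\<close> exchanges of neighbours.
\<close>

lemma alternating_move_last:
  assumes alt: "alternating_on (ordered_simplices X j) f"
    and zs: "zs \<in> ordered_simplices X j" and i: "i \<le> j"
  shows "f (move_last i zs) = (-1) ^ (j - i) *\<^sub>R f zs"
proof -
  have move: "f (xs @ ys @ [a]) = (-1) ^ length ys *\<^sub>R f (xs @ a # ys)"
    if "xs @ a # ys \<in> ordered_simplices X j" for xs ys a
    using that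
  proof (induction ys arbitrary: xs)
    case (Cons y ys)
    have "f (xs @ y # a # ys) = - f (xs @ a # y # ys)"
      using alt Cons.prems unfolding alternating_on_def by blast
    moreover have "(xs @ [y]) @ a # ys \<in> ordered_simplices X j"
      by (rule ordered_simplices_cong[OF Cons.prems]) simp
    ultimately show ?case using Cons.IH[of "xs @ [y]"] by simp
  qed simp
  have "zs = take i zs @ zs ! i # drop (Suc i) zs"
    using zs i by (intro id_take_nth_drop) (simp add: ordered_simplices_def)
  then show ?thesis
    using move[of "take i zs" "zs ! i" "drop (Suc i) zs"] zs i
    by (simp add: move_last_def delete_nth_def ordered_simplices_def)
qed

section \<open>Quadratic forms with bounded eigenvalues\<close>

text \<open>
  Vectors indexed by a subset \<open>I\<close> of a type are functions on the whole type that vanish off \<open>I\<close>; the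
  compactness of the cube is then an instance of Tychonoff's theorem.
\<close>

lemma compact_cube:
  "compact (PiE UNIV (\<lambda>i. if i \<in> I then {-1..1} else {0}) :: ('i \<Rightarrow> real) set)"
proof -
  have "compactin (product_topology (\<lambda>_. euclidean) UNIV) (PiE UNIV (\<lambda>i::'i. if i \<in> I then {-1..1} else {0::real}))"
    by (subst compactin_PiE) auto
  then show ?thesis by (simp add: euclidean_product_topology)
qed

lemma quadratic_perturbation_zero:
  fixes L Q :: real
  assumes "\<And>t. 0 \<le> 2 * t * L + t\<^sup>2 * Q"
  shows "L = 0"
proof -
  define P where "P = \<bar>Q\<bar> + 1"
  have P: "P > 0" "Q \<le> P" unfolding P_def by auto
  have "0 \<le> 2 * (- L / P) * L + (- L / P)\<^sup>2 * Q" by (rule assms)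
  also have "\<dots> \<le> 2 * (- L / P) * L + (- L / P)\<^sup>2 * P"
    using P by (intro add_left_mono mult_left_mono) auto
  also have "\<dots> = - (L\<^sup>2 / P)" using P by (simp add: power2_eq_square field_simps)
  finally have "L\<^sup>2 / P \<le> 0" by simp
  then show ?thesis using P by (simp add: divide_le_0_iff)
qed

text \<open>
  The minimum \<open>c\<close> of the quadratic form on the unit sphere is attained, by compactness, and a minimizer
  is an eigenvector for \<open>c\<close>, because the first variation of \<open>q - c |\<cdot>|\<^sup>2\<close> vanishes there. So the form is
  at least its least eigenvalue times the square of the norm.
\<close>

lemma eigenvalues_bound_quadratic_form:
  fixes A :: "'i \<Rightarrow> 'i \<Rightarrow> real"
  assumes fin: "finite I"
    and sym: "\<And>i j. i \<in> I \<Longrightarrow> j \<in> I \<Longrightarrow> A i j = A j i"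
    and ev: "\<And>c. eigenvalue_on I A c \<Longrightarrow> \<epsilon> \<le> c"
  shows "\<epsilon> * (\<Sum>i\<in>I. (x i)\<^sup>2) \<le> (\<Sum>i\<in>I. \<Sum>j\<in>I. x i * A i j * x j)"
proof (cases "\<exists>i\<in>I. x i \<noteq> 0")
  case False
  then show ?thesis by simp
next
  case True
  define q where "q y = (\<Sum>i\<in>I. \<Sum>j\<in>I. y i * A i j * y j)" for y :: "'i \<Rightarrow> real"
  define s where "s y = (\<Sum>i\<in>I. (y i)\<^sup>2)" for y :: "'i \<Rightarrow> real"
  define K where "K = PiE UNIV (\<lambda>i. if i \<in> I then {-1..1} else {0}) \<inter> {y. s y = 1}"
  have cont: "continuous_on UNIV q" "continuous_on UNIV s"
    unfolding q_def s_def by (intro continuous_intros continuous_on_product_coordinates)+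
  have "compact K" unfolding K_def
    by (intro compact_Int_closed compact_cube closed_Collect_eq cont continuous_on_const)
  have s_nonneg: "s y \<ge> 0" for y unfolding s_def by (intro sum_nonneg) auto
  have s_zero: "s y = 0 \<Longrightarrow> i \<in> I \<Longrightarrow> y i = 0" for y i
    unfolding s_def using fin by (simp add: sum_nonneg_eq_0_iff)
  define nz where "nz y = (\<lambda>i. if i \<in> I then y i / sqrt (s y) else 0)" for y
  have nz: "nz y \<in> K" "q (nz y) = q y / s y" if "s y > 0" for y
  proof -
    have s1: "s (nz y) = 1"
    proof -
      have "s (nz y) = (\<Sum>i\<in>I. (y i)\<^sup>2 / s y)"
        unfolding s_def[of "nz y"] using that by (intro sum.cong) (auto simp: nz_def power_divide)
      also have "\<dots> = (\<Sum>i\<in>I. (y i)\<^sup>2) / s y" by (rule sum_divide_distrib[symmetric])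
      also have "\<dots> = s y / s y" by (simp only: s_def[of y])
      finally show ?thesis using that by simp
    qed
    have "(nz y i)\<^sup>2 \<le> s (nz y)" if "i \<in> I" for i
      unfolding s_def using fin that by (intro member_le_sum) auto
    then have "\<bar>nz y i\<bar> \<le> 1" if "i \<in> I" for i
      using that s1 by (simp add: abs_square_le_1)
    then have "nz y i \<in> {-1..1}" if "i \<in> I" for i
      using that by (metis abs_le_iff atLeastAtMost_iff minus_le_iff)
    then have "nz y \<in> PiE UNIV (\<lambda>i. if i \<in> I then {-1..1} else {0})"
      by (auto simp: PiE_UNIV_domain Pi_iff simp del: atLeastAtMost_iff) (simp add: nz_def)
    with s1 show "nz y \<in> K" by (simp add: K_def)
    have "q (nz y) = (\<Sum>i\<in>I. \<Sum>j\<in>I. y i * A i j * y j / s y)"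
      unfolding q_def using that
      by (intro sum.cong refl) (auto simp: nz_def field_simps simp flip: power2_eq_square)
    also have "\<dots> = q y / s y" by (simp add: q_def sum_divide_distrib)
    finally show "q (nz y) = q y / s y" .
  qed
  have "s x > 0" using True s_zero[of x] s_nonneg[of x] by (metis less_eq_real_def)
  then have "K \<noteq> {}" using nz(1) by blast
  then obtain x0 where x0: "x0 \<in> K" "\<And>y. y \<in> K \<Longrightarrow> q x0 \<le> q y"
    using continuous_attains_inf[OF \<open>compact K\<close>, of q] cont(1) continuous_on_subset by blast
  define c where "c = q x0"
  have s0: "s x0 = 1" using x0(1) by (simp add: K_def)
  have min: "c * s y \<le> q y" for y
  proof (cases "s y > 0")
    case True
    then show ?thesis using x0(2)[OF nz(1)[OF True]] nz(2)[OF True] by (simp add: c_def field_simps)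
  next
    case False
    then have "s y = 0" using s_nonneg[of y] by simp
    then show ?thesis using s_zero[of y] by (simp add: q_def)
  qed
  \<comment> \<open>The residual of the eigenvalue equation; the variation of the minimizer in this direction shows
      that it vanishes.\<close>
  define r where "r i = (\<Sum>j\<in>I. A i j * x0 j) - c * x0 i" for i
  have "0 \<le> 2 * t * s r + t\<^sup>2 * (q r - c * s r)" for t
  proof -
    have "q (\<lambda>i. x0 i + t * r i)
        = q x0 + t * (\<Sum>i\<in>I. \<Sum>j\<in>I. r i * A i j * x0 j)
               + t * (\<Sum>i\<in>I. \<Sum>j\<in>I. x0 i * A i j * r j) + t\<^sup>2 * q r"
      unfolding q_def by (simp add: sum.distrib sum_distrib_left algebra_simps power2_eq_square)
    also have "(\<Sum>i\<in>I. \<Sum>j\<in>I. x0 i * A i j * r j) = (\<Sum>j\<in>I. \<Sum>i\<in>I. r j * A j i * x0 i)"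
      by (subst sum.swap) (intro sum.cong refl, use sym in \<open>auto simp: mult_ac\<close>)
    finally have 1: "q (\<lambda>i. x0 i + t * r i)
        = q x0 + 2 * t * (\<Sum>i\<in>I. \<Sum>j\<in>I. r i * A i j * x0 j) + t\<^sup>2 * q r" by simp
    have 2: "s (\<lambda>i. x0 i + t * r i) = s x0 + 2 * t * (\<Sum>i\<in>I. r i * x0 i) + t\<^sup>2 * s r"
      unfolding s_def by (simp add: power2_sum sum.distrib sum_distrib_left power_mult_distrib mult_ac)
    have "(\<Sum>i\<in>I. \<Sum>j\<in>I. r i * A i j * x0 j) - c * (\<Sum>i\<in>I. r i * x0 i)
        = (\<Sum>i\<in>I. r i * ((\<Sum>j\<in>I. A i j * x0 j) - c * x0 i))"
      by (simp add: sum_distrib_left sum_subtractf right_diff_distrib mult_ac)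
    also have "\<dots> = s r" unfolding r_def[symmetric] s_def by (simp add: power2_eq_square)
    finally have 3: "(\<Sum>i\<in>I. \<Sum>j\<in>I. r i * A i j * x0 j) = s r + c * (\<Sum>i\<in>I. r i * x0 i)" by simp
    show ?thesis
      using min[of "\<lambda>i. x0 i + t * r i"] unfolding 1 2 3 s0 c_def[symmetric] by (simp add: algebra_simps)
  qed
  then have "s r = 0" by (rule quadratic_perturbation_zero)
  then have "\<forall>i\<in>I. (\<Sum>j\<in>I. A i j * x0 j) = c * x0 i"
    using s_zero[of r] by (simp add: r_def)
  moreover have "\<exists>i\<in>I. x0 i \<noteq> 0"
  proof (rule ccontr)
    assume "\<not> ?thesis"
    then have "s x0 = 0" by (simp add: s_def)
    with s0 show False by simp
  qed
  ultimately have "\<epsilon> \<le> c" by (intro ev) (auto simp: eigenvalue_on_def)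
  then have "\<epsilon> * s x \<le> c * s x" using s_nonneg by (rule mult_right_mono)
  also have "\<dots> \<le> q x" by (rule min)
  finally show ?thesis by (simp add: q_def s_def)
qed

section \<open>Haar measure\<close>

lemma open_translate:
  fixes S :: "'g::topological_group_add set"
  assumes "open S"
  shows "open ((\<lambda>h. g + h) ` S)" "open ((\<lambda>h. h + g) ` S)"
proof -
  have "(\<lambda>h. g + h) ` S = (\<lambda>h. - g + h) -` S"
  proof (intro set_eqI iffI)
    fix x assume "x \<in> (\<lambda>h. - g + h) -` S"
    moreover have "x = g + (- g + x)" by (simp add: add.assoc[symmetric])
    ultimately show "x \<in> (\<lambda>h. g + h) ` S" by blast
  qed (auto simp: add.assoc[symmetric])
  then show "open ((\<lambda>h. g + h) ` S)"
    using assms by (simp only:) (intro open_vimage continuous_intros)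
  have "(\<lambda>h. h + g) ` S = (\<lambda>h. h + - g) -` S"
  proof (intro set_eqI iffI)
    fix x assume "x \<in> (\<lambda>h. h + - g) -` S"
    moreover have "x = (x + - g) + g" by (simp add: add.assoc)
    ultimately show "x \<in> (\<lambda>h. h + g) ` S" by blast
  qed (auto simp: add.assoc)
  then show "open ((\<lambda>h. h + g) ` S)"
    using assms by (simp only:) (intro open_vimage continuous_intros)
qed

lemma left_haar_measureD:
  assumes "left_haar_measure \<mu>"
  shows haar_sets: "sets \<mu> = sets borel"
    and haar_nonzero: "emeasure \<mu> (space \<mu>) \<noteq> 0"
    and haar_compact: "compact K \<Longrightarrow> emeasure \<mu> K < \<infinity>"
    and haar_inner_regular: "open U \<Longrightarrow> emeasure \<mu> U = (SUP K\<in>{K. compact K \<and> K \<subseteq> U}. emeasure \<mu> K)"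
    and haar_translate: "A \<in> sets borel \<Longrightarrow> emeasure \<mu> ((\<lambda>h. g + h) ` A) = emeasure \<mu> A"
proof -
  note c = assms[unfolded left_haar_measure_def]
  note c2 = c[THEN conjunct2] and c3 = c[THEN conjunct2, THEN conjunct2]
  note c5 = c3[THEN conjunct2, THEN conjunct2]
  show "sets \<mu> = sets borel" by (rule c[THEN conjunct1])
  show "emeasure \<mu> (space \<mu>) \<noteq> 0" by (rule c2[THEN conjunct1])
  show "compact K \<Longrightarrow> emeasure \<mu> K < \<infinity>" by (rule c3[THEN conjunct1, rule_format])
  show "open U \<Longrightarrow> emeasure \<mu> U = (SUP K\<in>{K. compact K \<and> K \<subseteq> U}. emeasure \<mu> K)"
    by (rule c5[THEN conjunct1, rule_format])
  show "A \<in> sets borel \<Longrightarrow> emeasure \<mu> ((\<lambda>h. g + h) ` A) = emeasure \<mu> A"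
    by (rule c5[THEN conjunct2, rule_format])
qed

text \<open>
  If \<open>U\<close> were null, so would be every compact set, being covered by finitely many translates of \<open>U\<close>,
  and then the whole group by inner regularity.
\<close>

lemma haar_measure_open_pos:
  fixes \<mu> :: "'g::{topological_group_add, t2_space} measure"
  assumes haar: "left_haar_measure \<mu>" and U: "open U" "0 \<in> U"
  shows "emeasure \<mu> U \<noteq> 0"
proof
  assume null: "emeasure \<mu> U = 0"
  note sets = haar_sets[OF haar]
  have space: "space \<mu> = UNIV" using sets_eq_imp_space_eq[OF sets] by simp
  have trans: "emeasure \<mu> ((\<lambda>h. g + h) ` U) = 0" for g
    using haar_translate[OF haar, of U g] U null by simp
  have "emeasure \<mu> K = 0" if "compact K" for K
  proof -
    have "K \<subseteq> (\<Union>g\<in>K. (\<lambda>h. g + h) ` U)"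
    proof
      fix g assume "g \<in> K"
      moreover have "g + 0 \<in> (\<lambda>h. g + h) ` U" using U(2) by blast
      ultimately show "g \<in> (\<Union>g\<in>K. (\<lambda>h. g + h) ` U)" by auto
    qed
    with \<open>compact K\<close> obtain C where C: "C \<subseteq> K" "finite C" "K \<subseteq> (\<Union>g\<in>C. (\<lambda>h. g + h) ` U)"
      by (rule compactE_image[OF _ open_translate(1)[OF U(1)]])
    have "emeasure \<mu> K \<le> emeasure \<mu> (\<Union>g\<in>C. (\<lambda>h. g + h) ` U)"
      using C(3) open_translate(1)[OF U(1)] sets by (intro emeasure_mono) (auto intro!: borel_open)
    also have "\<dots> \<le> (\<Sum>g\<in>C. emeasure \<mu> ((\<lambda>h. g + h) ` U))"
      using C(2) open_translate(1)[OF U(1)] sets by (intro emeasure_subadditive_finite) auto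
    finally show ?thesis by (simp add: trans)
  qed
  then have "(SUP K\<in>{K. compact K \<and> K \<subseteq> UNIV}. emeasure \<mu> K) = 0"
    by (intro antisym SUP_least) auto
  then have "emeasure \<mu> UNIV = 0"
    using haar_inner_regular[OF haar, of UNIV] by simp
  then show False using haar_nonzero[OF haar] space by simp
qed

lemma haar_measure_conjugate:
  fixes \<mu> :: "'g::{topological_group_add, t2_space} measure"
  assumes haar: "left_haar_measure \<mu>" and um: "unimodular TYPE('g)" and U: "open U"
  shows "measure \<mu> ((\<lambda>h. g + h + - g) ` U) = measure \<mu> U"
proof -
  have e: "(\<lambda>h. g + h + - g) ` U = (\<lambda>h. h + - g) ` (\<lambda>h. g + h) ` U"
    unfolding image_image by (rule refl)
  have "emeasure \<mu> ((\<lambda>h. h + - g) ` (\<lambda>h. g + h) ` U) = emeasure \<mu> ((\<lambda>h. g + h) ` U)"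
    by (rule um[unfolded unimodular_def, rule_format, OF haar borel_open[OF open_translate(1)[OF U]]])
  also have "\<dots> = emeasure \<mu> U"
    by (rule haar_translate[OF haar borel_open[OF U]])
  finally show ?thesis unfolding e by (simp only: measure_def)
qed

section \<open>Group actions and the unfolding formula\<close>

lemma top_simplices_eq:
  assumes "has_dimension X n"
  shows "top_simplices X = {s \<in> X. card s = Suc n}"
proof -
  obtain s where s: "s \<in> X" "card s = Suc n" and le: "\<forall>s\<in>X. card s \<le> Suc n"
    using assms by (auto simp: has_dimension_def)
  then show ?thesis unfolding top_simplices_def by (metis (no_types, lifting) le_antisym)
qed

locale complex_action =
  fixes X :: "'v set set"
    and act :: "'g::{topological_group_add, t2_space} \<Rightarrow> 'v \<Rightarrow> 'v"
    and \<mu> :: "'g measure"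
    and R :: "nat \<Rightarrow> 'v list set"
    and n :: nat
  assumes complex: "abstract_complex X"
    and loc_fin: "locally_finite X"
    and dim: "has_dimension X n"
    and pure: "\<forall>s\<in>X. \<exists>t\<in>X. s \<subseteq> t \<and> card t = Suc n"
    and unimod: "unimodular TYPE('g)"
    and haar: "left_haar_measure \<mu>"
    and proper: "properly_discontinuous X act"
    and reps: "orbit_representatives X act R"
begin

abbreviation \<Sigma> :: "nat \<Rightarrow> 'v list set" where "\<Sigma> \<equiv> ordered_simplices X"

definition vol :: "'v list \<Rightarrow> real" where "vol \<sigma> = measure \<mu> (stab act \<sigma>)"

lemma simplex_vertices: "\<sigma> \<in> \<Sigma> j \<Longrightarrow> set \<sigma> \<subseteq> vertices X"
  by (auto simp: ordered_simplices_def vertices_def)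

lemma action: "simplicial_action X act"
  using proper by (simp add: properly_discontinuous_def)

lemma act_zero: "v \<in> vertices X \<Longrightarrow> act 0 v = v"
  and act_add: "v \<in> vertices X \<Longrightarrow> act (g + h) v = act g (act h v)"
  and act_image: "s \<in> X \<Longrightarrow> act g ` s \<in> X"
  using action by (auto simp: simplicial_action_def)

lemma act_minus: "v \<in> vertices X \<Longrightarrow> act (- g) (act g v) = v"
  using act_add[of v "- g" g] act_zero[of v] by simp

lemma inj_act: "inj_on (act g) (vertices X)"
  by (metis act_minus inj_onI)

lemma map_act_zero: "\<sigma> \<in> \<Sigma> j \<Longrightarrow> map (act 0) \<sigma> = \<sigma>"
  using simplex_vertices[of \<sigma> j] by (intro map_idI) (auto simp: act_zero)

lemma map_act_add: "\<sigma> \<in> \<Sigma> j \<Longrightarrow> map (act (g + h)) \<sigma> = map (act g) (map (act h) \<sigma>)"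
  using simplex_vertices[of \<sigma> j] by (auto simp: act_add)

lemma map_act_minus: "\<sigma> \<in> \<Sigma> j \<Longrightarrow> map (act (- g)) (map (act g) \<sigma>) = \<sigma>"
  using map_act_add[of \<sigma> j "- g" g] map_act_zero[of \<sigma> j] by simp

lemma map_act_in: "\<sigma> \<in> \<Sigma> j \<Longrightarrow> map (act g) \<sigma> \<in> \<Sigma> j"
  using inj_on_subset[OF inj_act simplex_vertices]
  by (auto simp: ordered_simplices_def distinct_map act_image)

lemma mem_stab: "g \<in> stab act \<sigma> \<longleftrightarrow> map (act g) \<sigma> = \<sigma>"
  by (simp add: stab_def)

lemma stab_zero: "\<sigma> \<in> \<Sigma> j \<Longrightarrow> 0 \<in> stab act \<sigma>"
  and stab_add: "\<sigma> \<in> \<Sigma> j \<Longrightarrow> g \<in> stab act \<sigma> \<Longrightarrow> h \<in> stab act \<sigma> \<Longrightarrow> g + h \<in> stab act \<sigma>"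
  using map_act_zero map_act_add unfolding mem_stab by metis+

lemma stab_map_act:
  assumes \<sigma>: "\<sigma> \<in> \<Sigma> j"
  shows "stab act (map (act g) \<sigma>) = (\<lambda>h. g + h + - g) ` stab act \<sigma>"
proof -
  have "h \<in> stab act (map (act g) \<sigma>) \<longleftrightarrow> - g + h + g \<in> stab act \<sigma>" for h
  proof -
    let ?\<tau> = "map (act h) (map (act g) \<sigma>)"
    have g: "map (act g) \<sigma> \<in> \<Sigma> j" and \<tau>: "?\<tau> \<in> \<Sigma> j"
      using \<sigma> map_act_in by blast+
    have conj: "map (act (- g + h + g)) \<sigma> = map (act (- g)) ?\<tau>"
      by (simp only: map_act_add[OF \<sigma>] map_act_add[OF g])
    show ?thesis unfolding mem_stab conj
    proof
      assume "?\<tau> = map (act g) \<sigma>"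
      then show "map (act (- g)) ?\<tau> = \<sigma>" using map_act_minus[OF \<sigma>, of g] by (simp only:)
    next
      assume "map (act (- g)) ?\<tau> = \<sigma>"
      then show "?\<tau> = map (act g) \<sigma>"
        using map_act_minus[OF \<tau>, of "- g"] by (simp only: add.inverse_inverse)
    qed
  qed
  moreover have "h \<in> (\<lambda>h. g + h + - g) ` S \<longleftrightarrow> - g + h + g \<in> S" for h and S :: "'g set"
  proof
    have "h = g + (- g + h + g) + - g"
      by (simp only: add.assoc[symmetric] right_minus add_0_left) (simp only: add.assoc right_minus add_0_right)
    then show "- g + h + g \<in> S \<Longrightarrow> h \<in> (\<lambda>h. g + h + - g) ` S" by blast
  next
    have "- g + (g + h + - g) + g = h" for h
      by (simp only: add.assoc[symmetric] left_minus add_0_left) (simp only: add.assoc left_minus add_0_right)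
    then show "h \<in> (\<lambda>h. g + h + - g) ` S \<Longrightarrow> - g + h + g \<in> S" by force
  qed
  ultimately show ?thesis by blast
qed

lemma open_stab: "\<sigma> \<in> \<Sigma> j \<Longrightarrow> open (stab act \<sigma>)"
  and compact_stab: "\<sigma> \<in> \<Sigma> j \<Longrightarrow> compact (stab act \<sigma>)"
  using proper unfolding properly_discontinuous_def by blast+

lemma emeasure_stab: "\<sigma> \<in> \<Sigma> j \<Longrightarrow> emeasure \<mu> (stab act \<sigma>) = ennreal (vol \<sigma>)"
  using haar_compact[OF haar compact_stab, of \<sigma> j]
  by (simp add: vol_def emeasure_eq_ennreal_measure less_top[symmetric])

lemma vol_pos: "\<sigma> \<in> \<Sigma> j \<Longrightarrow> 0 < vol \<sigma>"
  using haar_measure_open_pos[OF haar open_stab stab_zero, of \<sigma> j j] emeasure_stab[of \<sigma> j]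
  by (metis ennreal_0 less_eq_real_def measure_nonneg vol_def)

lemma vol_map_act: "\<sigma> \<in> \<Sigma> j \<Longrightarrow> vol (map (act g) \<sigma>) = vol \<sigma>"
  using haar_measure_conjugate[OF haar unimod open_stab] by (simp only: vol_def stab_map_act)

text \<open>
  Orbit-stabilizer theorem for Haar measure: the elements of the stabilizer of \<open>b\<close> that carry \<open>a\<close> to a
  given point form a left coset of the stabilizer of \<open>a\<close>, and all these cosets have the same measure.
\<close>

lemma card_stab_orbit:
  assumes a: "a \<in> \<Sigma> i" and b: "b \<in> \<Sigma> j" and sub: "stab act a \<subseteq> stab act b"
    and fin: "finite ((\<lambda>g. map (act g) a) ` stab act b)"
  shows "vol b = card ((\<lambda>g. map (act g) a) ` stab act b) * vol a"
proof -
  let ?O = "(\<lambda>g. map (act g) a) ` stab act b"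
  define c where "c x = (SOME g. g \<in> stab act b \<and> map (act g) a = x)" for x
  have c: "c x \<in> stab act b" "map (act (c x)) a = x" if "x \<in> ?O" for x
    using that someI_ex[of "\<lambda>g. g \<in> stab act b \<and> map (act g) a = x"] unfolding c_def by blast+
  let ?C = "\<lambda>x. (\<lambda>h. c x + h) ` stab act a"
  have coset: "h \<in> ?C x \<longleftrightarrow> map (act h) a = x" if x: "x \<in> ?O" for h x
  proof
    assume "h \<in> ?C x"
    then show "map (act h) a = x"
      using c(2)[OF x] map_act_add[OF a] by (auto simp: mem_stab simp del: map_map map_eq_conv)
  next
    assume h: "map (act h) a = x"
    have "map (act (- c x + h)) a = map (act (- c x)) (map (act (c x)) a)"
      using h c(2)[OF x] by (simp only: map_act_add[OF a])
    then have "- c x + h \<in> stab act a"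
      unfolding mem_stab by (simp only: map_act_minus[OF a])
    then have "c x + (- c x + h) \<in> ?C x" by blast
    then show "h \<in> ?C x" by (simp add: add.assoc[symmetric])
  qed
  have un: "stab act b = (\<Union>x\<in>?O. ?C x)"
  proof
    show "stab act b \<subseteq> (\<Union>x\<in>?O. ?C x)" using coset by blast
    show "(\<Union>x\<in>?O. ?C x) \<subseteq> stab act b"
      using c(1) sub stab_add[OF b] by blast
  qed
  have disj: "disjoint_family_on ?C ?O"
  proof (unfold disjoint_family_on_def, intro ballI impI equals0I)
    fix x y h assume x: "x \<in> ?O" and y: "y \<in> ?O" and "x \<noteq> y" and h: "h \<in> ?C x \<inter> ?C y"
    have "map (act h) a = x" by (rule coset[OF x, THEN iffD1, OF IntD1[OF h]])
    moreover have "map (act h) a = y" by (rule coset[OF y, THEN iffD1, OF IntD2[OF h]])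
    ultimately show False using \<open>x \<noteq> y\<close> by (simp only:)
  qed
  have meas: "?C x \<in> sets \<mu>" for x
    using open_translate(1)[OF open_stab[OF a]] haar_sets[OF haar] by simp
  have "ennreal (vol b) = emeasure \<mu> (\<Union>x\<in>?O. ?C x)"
    using emeasure_stab[OF b] un by simp
  also have "\<dots> = (\<Sum>x\<in>?O. emeasure \<mu> (?C x))"
    using meas by (intro sum_emeasure[symmetric] disj fin) auto
  also have "\<dots> = (\<Sum>x\<in>?O. ennreal (vol a))"
    using haar_translate[OF haar] open_stab[OF a] emeasure_stab[OF a] by simp
  also have "\<dots> = ennreal (card ?O * vol a)"
    using vol_pos[OF a] by (simp add: ennreal_mult ennreal_of_nat_eq_real_of_nat)
  finally show ?thesis
    using vol_pos[OF a] vol_pos[OF b] by (subst (asm) ennreal_inj) auto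
qed

lemma R_sub: "R j \<subseteq> \<Sigma> j"
  and R_ex: "\<sigma> \<in> \<Sigma> j \<Longrightarrow> \<exists>r\<in>R j. \<exists>g. \<sigma> = map (act g) r"
  and R_unique: "r \<in> R j \<Longrightarrow> r' \<in> R j \<Longrightarrow> map (act g) r = map (act g') r' \<Longrightarrow> r = r'"
proof -
  have *: "\<forall>\<sigma>\<in>\<Sigma> j. \<exists>!r. r \<in> R j \<and> (\<exists>g. \<sigma> = map (act g) r)" and "R j \<subseteq> \<Sigma> j" for j
    using reps by (auto simp: orbit_representatives_def)
  then show "R j \<subseteq> \<Sigma> j" by blast
  show "\<sigma> \<in> \<Sigma> j \<Longrightarrow> \<exists>r\<in>R j. \<exists>g. \<sigma> = map (act g) r" using * by blast
  show "r \<in> R j \<Longrightarrow> r' \<in> R j \<Longrightarrow> map (act g) r = map (act g') r' \<Longrightarrow> r = r'"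
    using * \<open>R j \<subseteq> \<Sigma> j\<close> map_act_in by (metis subsetD)
qed

definition invariant :: "nat \<Rightarrow> ('v list \<Rightarrow> real) \<Rightarrow> bool" where
  "invariant j f \<longleftrightarrow> (\<forall>g. \<forall>\<sigma>\<in>\<Sigma> j. f (map (act g) \<sigma>) = f \<sigma>)"

text \<open>
  The maps along which sums over orbits can be pushed forward; finite fibres make the fibre sums
  meaningful.
\<close>

definition equivariant_map :: "nat \<Rightarrow> nat \<Rightarrow> ('v list \<Rightarrow> 'v list) \<Rightarrow> bool" where
  "equivariant_map i j \<pi> \<longleftrightarrow> (\<forall>\<sigma>\<in>\<Sigma> i. \<pi> \<sigma> \<in> \<Sigma> j \<and> (\<forall>g. \<pi> (map (act g) \<sigma>) = map (act g) (\<pi> \<sigma>))) \<and>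
     (\<forall>\<tau>\<in>\<Sigma> j. finite {\<sigma>\<in>\<Sigma> i. \<pi> \<sigma> = \<tau>})"

definition reps_over :: "nat \<Rightarrow> ('v list \<Rightarrow> 'v list) \<Rightarrow> 'v list \<Rightarrow> 'v list set" where
  "reps_over i \<pi> b = {a \<in> R i. \<exists>g. \<pi> a = map (act g) b}"

text \<open>
  The orbits in \<open>\<Sigma> i\<close> lying over the orbit of \<open>b\<close> correspond to the orbits of the stabilizer of \<open>b\<close> on the
  fibre over \<open>b\<close>. By \<open>card_stab_orbit\<close> the orbit corresponding to \<open>a\<close> has \<open>vol b / vol a\<close> elements;
  that \<open>vol\<close> is constant on orbits is where unimodularity enters.
\<close>

lemma sum_over_fiber:
  assumes \<pi>: "equivariant_map i j \<pi>" and f: "invariant i f" and b: "b \<in> R j"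
  shows "finite (reps_over i \<pi> b)"
    and "(\<Sum>a\<in>reps_over i \<pi> b. f a / vol a) = (\<Sum>a\<in>{a \<in> \<Sigma> i. \<pi> a = b}. f a) / vol b"
proof -
  have b': "b \<in> \<Sigma> j" using b R_sub by blast
  let ?F = "{a \<in> \<Sigma> i. \<pi> a = b}" and ?R = "reps_over i \<pi> b"
  have finF: "finite ?F" using \<pi> b' by (simp add: equivariant_map_def)
  have \<pi>_act: "\<pi> (map (act g) a) = map (act g) (\<pi> a)" if "a \<in> \<Sigma> i" for a g
    using \<pi> that by (simp add: equivariant_map_def)
  have R\<Sigma>: "a \<in> \<Sigma> i" if "a \<in> ?R" for a using that R_sub by (auto simp: reps_over_def)
  \<comment> \<open>\<open>c a\<close> is the point of the orbit of \<open>a\<close> that is moved into the fibre over \<open>b\<close>.\<close>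
  define t where "t a = (SOME g. \<pi> (map (act g) a) = b)" for a
  define c where "c a = map (act (t a)) a" for a
  have ex: "\<exists>g. \<pi> (map (act g) a) = b" if a: "a \<in> ?R" for a
  proof -
    obtain g where g: "\<pi> a = map (act g) b" using a by (auto simp: reps_over_def)
    have "\<pi> (map (act (- g)) a) = b" using \<pi>_act[OF R\<Sigma>[OF a]] g map_act_minus[OF b'] by simp
    then show ?thesis by blast
  qed
  have cF: "c a \<in> ?F" if "a \<in> ?R" for a
    using someI_ex[OF ex[OF that]] map_act_in[OF R\<Sigma>[OF that]] by (simp add: c_def t_def)
  have inj: "inj_on c ?R"
    unfolding c_def by (rule inj_onI) (auto simp: reps_over_def dest: R_unique)
  show fin: "finite ?R" using inj_on_finite[OF inj _ finF] cF by blast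
  let ?O = "\<lambda>x. (\<lambda>g. map (act g) x) ` stab act b"
  have OF: "?O (c a) \<subseteq> ?F" if "a \<in> ?R" for a
    using cF[OF that] \<pi>_act map_act_in by (auto simp: mem_stab)
  have F: "?F = (\<Union>a\<in>?R. ?O (c a))"
  proof
    show "(\<Union>a\<in>?R. ?O (c a)) \<subseteq> ?F" using OF by blast
    show "?F \<subseteq> (\<Union>a\<in>?R. ?O (c a))"
    proof
      fix x assume x: "x \<in> ?F"
      then obtain r g where r: "r \<in> R i" "x = map (act g) r" using R_ex by blast
      have r\<Sigma>: "r \<in> \<Sigma> i" using r R_sub by blast
      have "\<pi> r = map (act (- g)) b"
        using x r \<pi>_act[OF r\<Sigma>, of g] map_act_minus[of "\<pi> r" j g] \<pi> r\<Sigma>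
        by (auto simp: equivariant_map_def)
      then have rR: "r \<in> ?R" using r by (auto simp: reps_over_def)
      have xc: "x = map (act (g + - t r)) (c r)"
        unfolding c_def map_act_add[OF map_act_in[OF r\<Sigma>]] map_act_minus[OF r\<Sigma>] by (rule r(2))
      have "\<pi> x = map (act (g + - t r)) (\<pi> (c r))"
        unfolding xc using cF[OF rR] \<pi>_act by blast
      then have "g + - t r \<in> stab act b"
        using x cF[OF rR] by (simp add: mem_stab)
      then show "x \<in> (\<Union>a\<in>?R. ?O (c a))" using rR xc by blast
    qed
  qed
  have disj: "?O (c a) \<inter> ?O (c a') = {}" if "a \<in> ?R" "a' \<in> ?R" "a \<noteq> a'" for a a'
  proof (rule ccontr)
    assume "?O (c a) \<inter> ?O (c a') \<noteq> {}"
    then obtain g g' where "map (act g) (c a) = map (act g') (c a')" by auto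
    then have "map (act (g + t a)) a = map (act (g' + t a')) a'"
      using map_act_add[OF R\<Sigma>] that by (simp only: c_def)
    then show False using that R_unique by (auto simp: reps_over_def)
  qed
  have orb: "(\<Sum>x\<in>?O (c a). f x) = f a / vol a * vol b" if a: "a \<in> ?R" for a
  proof -
    have ca: "c a \<in> \<Sigma> i" "\<pi> (c a) = b" using cF[OF a] by auto
    have "f x = f a" if "x \<in> ?O (c a)" for x
      using f that ca(1) R\<Sigma>[OF a] by (auto simp: invariant_def c_def simp del: map_map)
    then have "(\<Sum>x\<in>?O (c a). f x) = card (?O (c a)) * f a" by simp
    moreover have "vol b = card (?O (c a)) * vol (c a)"
    proof (rule card_stab_orbit[OF ca(1) b'])
      show "stab act (c a) \<subseteq> stab act b"
        using \<pi>_act[OF ca(1)] ca(2) by (auto simp: mem_stab) metis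
      show "finite (?O (c a))" using OF[OF a] finF finite_subset by blast
    qed
    moreover have "vol (c a) = vol a" unfolding c_def by (rule vol_map_act[OF R\<Sigma>[OF a]])
    ultimately show ?thesis using vol_pos[OF R\<Sigma>[OF a]] by simp
  qed
  have "(\<Sum>x\<in>?F. f x) = (\<Sum>a\<in>?R. \<Sum>x\<in>?O (c a). f x)"
    unfolding F
  proof (rule sum.UNION_disjoint[OF fin])
    show "\<forall>a\<in>?R. finite (?O (c a))" using OF finF finite_subset by blast
    show "\<forall>a\<in>?R. \<forall>a'\<in>?R. a \<noteq> a' \<longrightarrow> ?O (c a) \<inter> ?O (c a') = {}" using disj by blast
  qed
  also have "\<dots> = (\<Sum>a\<in>?R. f a / vol a * vol b)" by (intro sum.cong refl orb)
  also have "\<dots> = (\<Sum>a\<in>?R. f a / vol a) * vol b" by (simp add: sum_distrib_right)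
  finally show "(\<Sum>a\<in>?R. f a / vol a) = (\<Sum>x\<in>?F. f x) / vol b"
    using vol_pos[OF b'] by simp
qed

text \<open>
  The sum over orbits weighted by the inverse measure of the stabilizers; for an invariant function it
  does not depend on the choice of the representatives.
\<close>

definition orbit_sum :: "nat \<Rightarrow> ('v list \<Rightarrow> real) \<Rightarrow> real" where
  "orbit_sum j f = (\<Sum>\<^sub>\<infinity>\<sigma>\<in>R j. f \<sigma> / vol \<sigma>)"

definition orbit_summable :: "nat \<Rightarrow> ('v list \<Rightarrow> real) \<Rightarrow> bool" where
  "orbit_summable j f \<longleftrightarrow> (\<lambda>\<sigma>. f \<sigma> / vol \<sigma>) summable_on R j"

lemma bij_reps_over:
  assumes \<pi>: "equivariant_map i j \<pi>"
  shows "bij_betw snd (Sigma (R j) (reps_over i \<pi>)) (R i)"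
  unfolding bij_betw_def
proof
  show "inj_on snd (Sigma (R j) (reps_over i \<pi>))"
  proof (rule inj_onI)
    fix p q assume pq: "p \<in> Sigma (R j) (reps_over i \<pi>)" "q \<in> Sigma (R j) (reps_over i \<pi>)" "snd p = snd q"
    have "snd p \<in> reps_over i \<pi> (fst p)" "snd q \<in> reps_over i \<pi> (fst q)"
      using pq by auto
    then obtain g g' where "\<pi> (snd p) = map (act g) (fst p)" "\<pi> (snd q) = map (act g') (fst q)"
      unfolding reps_over_def by blast
    then have "fst p = fst q" using pq R_unique[of "fst p" j "fst q" g g'] by auto
    then show "p = q" using pq by (simp add: prod_eq_iff)
  qed
  show "snd ` Sigma (R j) (reps_over i \<pi>) = R i"
  proof
    show "R i \<subseteq> snd ` Sigma (R j) (reps_over i \<pi>)"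
    proof
      fix a assume a: "a \<in> R i"
      then have "\<pi> a \<in> \<Sigma> j" using \<pi> R_sub by (auto simp: equivariant_map_def)
      then obtain b where "b \<in> R j" "a \<in> reps_over i \<pi> b"
        using R_ex a by (fastforce simp: reps_over_def)
      then show "a \<in> snd ` Sigma (R j) (reps_over i \<pi>)" by force
    qed
  qed (auto simp: reps_over_def)
qed

text \<open>
  The unfolding formula. With the weights \<open>1 / vol\<close> a sum over orbits can be carried out along the fibres
  of an equivariant map, each fibre being summed over completely and not up to symmetry.
\<close>

lemma unfold_orbit_sum:
  assumes \<pi>: "equivariant_map i j \<pi>" and f: "invariant i f" and sf: "orbit_summable i f"
  shows "orbit_summable j (\<lambda>b. \<Sum>a\<in>{a \<in> \<Sigma> i. \<pi> a = b}. f a)"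
    and "orbit_sum j (\<lambda>b. \<Sum>a\<in>{a \<in> \<Sigma> i. \<pi> a = b}. f a) = orbit_sum i f"
proof -
  let ?h = "\<lambda>a. f a / vol a"
  have inner: "infsum ?h (reps_over i \<pi> b) = (\<Sum>a\<in>{a \<in> \<Sigma> i. \<pi> a = b}. f a) / vol b"
    if "b \<in> R j" for b
    using sum_over_fiber[OF \<pi> f that] by simp
  have S: "(\<lambda>(b, a). ?h a) summable_on Sigma (R j) (reps_over i \<pi>)"
    using sf summable_on_reindex_bij_betw[OF bij_reps_over[OF \<pi>], of ?h]
    by (simp add: orbit_summable_def case_prod_unfold)
  show "orbit_summable j (\<lambda>b. \<Sum>a\<in>{a \<in> \<Sigma> i. \<pi> a = b}. f a)"
    unfolding orbit_summable_def
    using summable_on_Sigma_banach[OF S] by (simp add: inner cong: summable_on_cong)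
  have "orbit_sum j (\<lambda>b. \<Sum>a\<in>{a \<in> \<Sigma> i. \<pi> a = b}. f a) = (\<Sum>\<^sub>\<infinity>b\<in>R j. infsum ?h (reps_over i \<pi> b))"
    unfolding orbit_sum_def by (intro infsum_cong) (simp add: inner)
  also have "\<dots> = infsum (\<lambda>(b, a). ?h a) (Sigma (R j) (reps_over i \<pi>))"
    by (rule infsum_Sigma'_banach[OF S])
  also have "\<dots> = orbit_sum i f"
    using infsum_reindex_bij_betw[OF bij_reps_over[OF \<pi>], of ?h]
    by (simp add: orbit_sum_def case_prod_unfold)
  finally show "orbit_sum j (\<lambda>b. \<Sum>a\<in>{a \<in> \<Sigma> i. \<pi> a = b}. f a) = orbit_sum i f" .
qed

text \<open>
  For nonnegative functions summability can also be pulled back, by Tonelli's theorem.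
\<close>

lemma orbit_summable_fold:
  assumes \<pi>: "equivariant_map i j \<pi>" and f: "invariant i f"
    and nn: "\<And>a. a \<in> \<Sigma> i \<Longrightarrow> 0 \<le> f a"
    and s: "orbit_summable j (\<lambda>b. \<Sum>a\<in>{a \<in> \<Sigma> i. \<pi> a = b}. f a)"
  shows "orbit_summable i f"
proof -
  let ?h = "\<lambda>a. f a / vol a"
  have "(\<lambda>(b, a). ?h a) summable_on Sigma (R j) (reps_over i \<pi>)"
  proof (rule summable_on_SigmaI)
    fix b assume b: "b \<in> R j"
    show "((\<lambda>a. (\<lambda>(b, a). ?h a) (b, a)) has_sum (\<Sum>a\<in>{a \<in> \<Sigma> i. \<pi> a = b}. f a) / vol b) (reps_over i \<pi> b)"
      using sum_over_fiber[OF \<pi> f b] by (simp add: has_sum_finiteI)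
  next
    show "(\<lambda>b. (\<Sum>a\<in>{a \<in> \<Sigma> i. \<pi> a = b}. f a) / vol b) summable_on R j"
      using s by (simp add: orbit_summable_def)
  next
    fix b a assume "a \<in> reps_over i \<pi> b"
    then have "a \<in> \<Sigma> i" using R_sub by (auto simp: reps_over_def)
    then show "0 \<le> (\<lambda>(b, a). ?h a) (b, a)" using nn vol_pos by (simp add: less_imp_le)
  qed
  then show ?thesis
    using summable_on_reindex_bij_betw[OF bij_reps_over[OF \<pi>], of ?h]
    by (simp add: orbit_summable_def case_prod_unfold)
qed

section \<open>Multiplicities\<close>

definition m :: "'v list \<Rightarrow> real" where "m \<sigma> = real (mult X (set \<sigma>))"

definition ext :: "'v list \<Rightarrow> 'v set" where
  "ext \<sigma> = {v. \<sigma> @ [v] \<in> \<Sigma> (length \<sigma>)}"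

lemma length_simplex: "\<sigma> \<in> \<Sigma> j \<Longrightarrow> length \<sigma> = Suc j"
  by (simp add: ordered_simplices_def)

lemma mem_ext: "\<sigma> \<in> \<Sigma> j \<Longrightarrow> v \<in> ext \<sigma> \<longleftrightarrow> \<sigma> @ [v] \<in> \<Sigma> (Suc j)"
  by (simp add: ext_def length_simplex)

lemma face_in: "s \<in> X \<Longrightarrow> t \<subseteq> s \<Longrightarrow> t \<noteq> {} \<Longrightarrow> t \<in> X"
  using complex unfolding abstract_complex_def by blast

lemma finite_simplex: "s \<in> X \<Longrightarrow> finite s"
  using complex unfolding abstract_complex_def by blast

lemma delete_nth_in: "\<sigma> \<in> \<Sigma> (Suc j) \<Longrightarrow> i \<le> Suc j \<Longrightarrow> delete_nth i \<sigma> \<in> \<Sigma> j"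
proof -
  assume \<sigma>: "\<sigma> \<in> \<Sigma> (Suc j)" and i: "i \<le> Suc j"
  have len: "length (delete_nth i \<sigma>) = Suc j" using \<sigma> i by (simp add: length_simplex)
  have "set (delete_nth i \<sigma>) \<subseteq> set \<sigma>"
    by (auto simp: delete_nth_def dest: in_set_takeD in_set_dropD)
  moreover have "set (delete_nth i \<sigma>) \<noteq> {}" using len by auto
  ultimately show ?thesis
    using \<sigma> i len by (auto simp: ordered_simplices_def distinct_delete_nth intro: face_in)
qed

lemma move_last_in: "\<sigma> \<in> \<Sigma> j \<Longrightarrow> i \<le> j \<Longrightarrow> move_last i \<sigma> \<in> \<Sigma> j"
  by (auto simp: ordered_simplices_def distinct_move_last set_move_last)

lemma finite_cofaces:
  assumes "\<sigma> \<in> \<Sigma> j"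
  shows "finite {t \<in> X. set \<sigma> \<subseteq> t}"
proof -
  obtain v where v: "v \<in> set \<sigma>" using assms by (cases \<sigma>) (auto simp: ordered_simplices_def)
  then have "finite {t \<in> X. v \<in> t}"
    using loc_fin simplex_vertices[OF assms] by (auto simp: locally_finite_def)
  then show ?thesis by (rule finite_subset[rotated]) (use v in auto)
qed

lemma finite_ext:
  assumes "\<sigma> \<in> \<Sigma> j"
  shows "finite (ext \<sigma>)"
proof (rule finite_subset)
  show "ext \<sigma> \<subseteq> \<Union>{t \<in> X. set \<sigma> \<subseteq> t}"
    by (auto simp: ext_def ordered_simplices_def)
  show "finite (\<Union>{t \<in> X. set \<sigma> \<subseteq> t})"
    using finite_cofaces[OF assms] finite_simplex by auto
qed

lemma top_eq: "top_simplices X = {s \<in> X. card s = Suc n}"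
  by (rule top_simplices_eq[OF dim])

lemma mult_act:
  assumes "s \<subseteq> vertices X"
  shows "mult X (act g ` s) = mult X s"
proof -
  have sub: "t \<subseteq> vertices X" if "t \<in> X" for t using that by (auto simp: vertices_def)
  have inv: "act h ` act (- h) ` t = t" "act (- h) ` act h ` t = t" if "t \<subseteq> vertices X" for t h
    using that act_minus[of _ h] act_minus[of _ "- h"] by (force simp: image_image)+
  have card: "card (act h ` t) = card t" if "t \<in> X" for t h
    using inj_on_subset[OF inj_act sub[OF that]] by (rule card_image)
  have image: "act h ` t \<in> {t \<in> top_simplices X. act h ` s' \<subseteq> t}"
    if "t \<in> {t \<in> top_simplices X. s' \<subseteq> t}" for t h s'
    using that act_image[of t h] card[of t h] by (auto simp: top_eq image_mono)
  have "bij_betw ((`) (act g)) {t \<in> top_simplices X. s \<subseteq> t} {t \<in> top_simplices X. act g ` s \<subseteq> t}"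
  proof (rule bij_betwI[where g = "(`) (act (- g))"])
    show "(`) (act g) \<in> {t \<in> top_simplices X. s \<subseteq> t} \<rightarrow> {t \<in> top_simplices X. act g ` s \<subseteq> t}"
      by (rule Pi_I) (rule image)
    show "(`) (act (- g)) \<in> {t \<in> top_simplices X. act g ` s \<subseteq> t} \<rightarrow> {t \<in> top_simplices X. s \<subseteq> t}"
      using image[of _ "act g ` s" "- g"] unfolding inv(2)[OF assms] by (rule Pi_I)
  qed (use inv sub in \<open>auto simp: top_eq\<close>)
  then show ?thesis unfolding mult_def by (rule bij_betw_same_card[symmetric])
qed

lemma m_map_act: "\<sigma> \<in> \<Sigma> j \<Longrightarrow> m (map (act g) \<sigma>) = m \<sigma>"
  using mult_act[OF simplex_vertices] by (simp add: m_def)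

lemma m_cong: "set \<sigma> = set \<tau> \<Longrightarrow> m \<sigma> = m \<tau>"
  by (simp add: m_def)

lemma m_nonneg: "0 \<le> m \<sigma>" by (simp add: m_def)

lemma finite_top_cofaces: "\<sigma> \<in> \<Sigma> j \<Longrightarrow> finite {t \<in> top_simplices X. set \<sigma> \<subseteq> t}"
  by (rule finite_subset[OF _ finite_cofaces]) (auto simp: top_eq)

lemma m_pos: "\<sigma> \<in> \<Sigma> j \<Longrightarrow> 0 < m \<sigma>"
proof -
  assume \<sigma>: "\<sigma> \<in> \<Sigma> j"
  then have "set \<sigma> \<in> X" by (simp add: ordered_simplices_def)
  with pure obtain t where "t \<in> X" "set \<sigma> \<subseteq> t" "card t = Suc n" by blast
  then have "{t \<in> top_simplices X. set \<sigma> \<subseteq> t} \<noteq> {}" by (auto simp: top_eq)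
  then show ?thesis using finite_top_cofaces[OF \<sigma>] by (simp add: m_def mult_def card_gt_0_iff)
qed

text \<open>
  Count the pairs of a vertex \<open>v\<close> and an \<open>n\<close>-simplex containing \<open>\<sigma>\<close> and \<open>v\<close>: each of the \<open>m \<sigma>\<close> simplices
  of dimension \<open>n\<close> that contain \<open>\<sigma>\<close> has \<open>n - j\<close> further vertices.
\<close>

lemma sum_m_ext:
  assumes \<sigma>: "\<sigma> \<in> \<Sigma> j" and "j \<le> n"
  shows "(\<Sum>v\<in>ext \<sigma>. m (\<sigma> @ [v])) = real (n - j) * m \<sigma>"
proof -
  let ?T = "{t \<in> top_simplices X. set \<sigma> \<subseteq> t}"
  have fT: "finite ?T" by (rule finite_top_cofaces[OF \<sigma>])
  have "m (\<sigma> @ [v]) = (\<Sum>t\<in>?T. if v \<in> t then 1 else 0)" for v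
  proof -
    have "{t \<in> top_simplices X. set (\<sigma> @ [v]) \<subseteq> t} = {t \<in> ?T. v \<in> t}" by auto
    then show ?thesis using fT by (simp add: m_def mult_def sum.If_cases Int_def)
  qed
  then have "(\<Sum>v\<in>ext \<sigma>. m (\<sigma> @ [v])) = (\<Sum>v\<in>ext \<sigma>. \<Sum>t\<in>?T. if v \<in> t then 1 else 0)" by simp
  also have "\<dots> = (\<Sum>t\<in>?T. \<Sum>v\<in>ext \<sigma>. if v \<in> t then 1 else 0)" by (rule sum.swap)
  also have "\<dots> = (\<Sum>t\<in>?T. real (n - j))"
  proof (intro sum.cong refl)
    fix t assume t: "t \<in> ?T"
    then have tX: "t \<in> X" "card t = Suc n" "set \<sigma> \<subseteq> t" by (auto simp: top_eq)
    have "ext \<sigma> \<inter> t = t - set \<sigma>"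
    proof (intro set_eqI iffI)
      fix v assume "v \<in> t - set \<sigma>"
      moreover from this have "insert v (set \<sigma>) \<in> X" using tX by (intro face_in[OF tX(1)]) auto
      ultimately show "v \<in> ext \<sigma> \<inter> t" using \<sigma> by (auto simp: ext_def ordered_simplices_def)
    qed (auto simp: ext_def ordered_simplices_def)
    moreover have "card (t - set \<sigma>) = n - j"
      using tX \<sigma> by (subst card_Diff_subset) (auto simp: ordered_simplices_def distinct_card)
    ultimately show "(\<Sum>v\<in>ext \<sigma>. if v \<in> t then 1 else 0) = real (n - j)"
      using finite_ext[OF \<sigma>] by (simp add: sum.If_cases)
  qed
  also have "\<dots> = real (n - j) * m \<sigma>" by (simp add: m_def mult_def)
  finally show ?thesis .
qed

lemma ext_act:
  assumes \<sigma>: "\<sigma> \<in> \<Sigma> j"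
  shows "bij_betw (act g) (ext \<sigma>) (ext (map (act g) \<sigma>))"
proof (rule bij_betwI[where g = "act (- g)"])
  have step: "act h v \<in> ext (map (act h) \<tau>)" if "v \<in> ext \<tau>" "\<tau> \<in> \<Sigma> j" for h v \<tau>
    using map_act_in[of "\<tau> @ [v]" "Suc j" h] that mem_ext[OF that(2)] mem_ext[OF map_act_in[OF that(2)]] by simp
  have vert: "v \<in> vertices X" if "v \<in> ext \<tau>" "\<tau> \<in> \<Sigma> j" for v \<tau>
    using simplex_vertices[of "\<tau> @ [v]" "Suc j"] that by (simp add: mem_ext)
  note g\<sigma> = map_act_in[OF \<sigma>, of g]
  show "act g \<in> ext \<sigma> \<rightarrow> ext (map (act g) \<sigma>)" using step \<sigma> by blast
  show "act (- g) \<in> ext (map (act g) \<sigma>) \<rightarrow> ext \<sigma>"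
    using step[OF _ g\<sigma>, of _ "- g"] unfolding map_act_minus[OF \<sigma>] by blast
  show "act (- g) (act g v) = v" if "v \<in> ext \<sigma>" for v
    by (rule act_minus[OF vert[OF that \<sigma>]])
  show "act g (act (- g) v) = v" if "v \<in> ext (map (act g) \<sigma>)" for v
    using act_minus[OF vert[OF that g\<sigma>], of "- g"] by simp
qed

section \<open>Sums over orbits\<close>

lemma vol_nonneg [simp]: "0 \<le> vol \<sigma>" by (simp add: vol_def)

lemma R_in: "\<sigma> \<in> R j \<Longrightarrow> \<sigma> \<in> \<Sigma> j" using R_sub by blast

lemma orbit_summable_add: "orbit_summable j f \<Longrightarrow> orbit_summable j h \<Longrightarrow> orbit_summable j (\<lambda>\<sigma>. f \<sigma> + h \<sigma>)"
  and orbit_sum_add: "orbit_summable j f \<Longrightarrow> orbit_summable j h \<Longrightarrow> orbit_sum j (\<lambda>\<sigma>. f \<sigma> + h \<sigma>) = orbit_sum j f + orbit_sum j h"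
  unfolding orbit_summable_def orbit_sum_def add_divide_distrib by (auto intro: summable_on_add infsum_add)

lemma orbit_summable_cmult: "orbit_summable j f \<Longrightarrow> orbit_summable j (\<lambda>\<sigma>. c * f \<sigma>)"
  and orbit_sum_cmult: "orbit_sum j (\<lambda>\<sigma>. c * f \<sigma>) = c * orbit_sum j f"
  using summable_on_cmult_right[of "\<lambda>\<sigma>. f \<sigma> / vol \<sigma>" "R j" c]
    infsum_cmult_right'[of c "\<lambda>\<sigma>. f \<sigma> / vol \<sigma>" "R j"]
  by (simp_all add: orbit_summable_def orbit_sum_def)

lemma orbit_summable_diff: "orbit_summable j f \<Longrightarrow> orbit_summable j h \<Longrightarrow> orbit_summable j (\<lambda>\<sigma>. f \<sigma> - h \<sigma>)"
  and orbit_sum_diff: "orbit_summable j f \<Longrightarrow> orbit_summable j h \<Longrightarrow> orbit_sum j (\<lambda>\<sigma>. f \<sigma> - h \<sigma>) = orbit_sum j f - orbit_sum j h"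
  using orbit_summable_add[of j f "\<lambda>\<sigma>. (-1) * h \<sigma>"] orbit_sum_add[of j f "\<lambda>\<sigma>. (-1) * h \<sigma>"]
    orbit_summable_cmult[of j h "-1"] orbit_sum_cmult[of j "-1" h] by auto

lemma orbit_summable_sum: "finite I \<Longrightarrow> (\<And>i. i \<in> I \<Longrightarrow> orbit_summable j (f i)) \<Longrightarrow> orbit_summable j (\<lambda>\<sigma>. \<Sum>i\<in>I. f i \<sigma>)"
  and orbit_sum_sum: "finite I \<Longrightarrow> (\<And>i. i \<in> I \<Longrightarrow> orbit_summable j (f i)) \<Longrightarrow> orbit_sum j (\<lambda>\<sigma>. \<Sum>i\<in>I. f i \<sigma>) = (\<Sum>i\<in>I. orbit_sum j (f i))"
proof (induction I rule: finite_induct)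
  case empty
  { case 1 show ?case by (simp add: orbit_summable_def) next
    case 2 show ?case by (simp add: orbit_sum_def) }
next
  case (insert x F)
  { case 1 then show ?case using insert by (simp add: orbit_summable_add) next
    case 2 then show ?case using insert by (simp add: orbit_sum_add) }
qed

lemma orbit_sum_cong: "(\<And>\<sigma>. \<sigma> \<in> \<Sigma> j \<Longrightarrow> f \<sigma> = h \<sigma>) \<Longrightarrow> orbit_sum j f = orbit_sum j h"
  unfolding orbit_sum_def using R_sub by (intro infsum_cong) auto

lemma orbit_summable_cong: "(\<And>\<sigma>. \<sigma> \<in> \<Sigma> j \<Longrightarrow> f \<sigma> = h \<sigma>) \<Longrightarrow> orbit_summable j f \<longleftrightarrow> orbit_summable j h"
  unfolding orbit_summable_def using R_sub by (intro summable_on_cong) auto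

lemma orbit_sum_mono:
  "orbit_summable j f \<Longrightarrow> orbit_summable j h \<Longrightarrow> (\<And>\<sigma>. \<sigma> \<in> R j \<Longrightarrow> f \<sigma> \<le> h \<sigma>) \<Longrightarrow> orbit_sum j f \<le> orbit_sum j h"
  unfolding orbit_sum_def orbit_summable_def 
  by (intro infsum_mono divide_right_mono vol_nonneg)

lemma orbit_sum_nonneg: "(\<And>\<sigma>. \<sigma> \<in> \<Sigma> j \<Longrightarrow> 0 \<le> f \<sigma>) \<Longrightarrow> 0 \<le> orbit_sum j f"
  unfolding orbit_sum_def by (intro infsum_nonneg divide_nonneg_nonneg vol_nonneg) (simp add: R_in)

lemma orbit_summable_abs: "orbit_summable j f \<Longrightarrow> orbit_summable j (\<lambda>\<sigma>. \<bar>f \<sigma>\<bar>)"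
  using summable_on_iff_abs_summable_on_real[of "\<lambda>\<sigma>. f \<sigma> / vol \<sigma>" "R j"]
  by (simp add: orbit_summable_def)

lemma orbit_summable_comparison:
  assumes f: "orbit_summable j f" and le: "\<And>\<sigma>. \<sigma> \<in> R j \<Longrightarrow> \<bar>h \<sigma>\<bar> \<le> f \<sigma>"
  shows "orbit_summable j h"
proof -
  have "(\<lambda>\<sigma>. \<bar>h \<sigma>\<bar> / vol \<sigma>) summable_on R j"
    using f unfolding orbit_summable_def
    by (rule summable_on_comparison_test) (auto simp: le divide_right_mono)
  then show ?thesis
    using summable_on_iff_abs_summable_on_real[of "\<lambda>\<sigma>. h \<sigma> / vol \<sigma>" "R j"]
    by (simp add: orbit_summable_def)
qed

lemma orbit_sum_term_le:
  assumes "orbit_summable j f" "finite F" "F \<subseteq> R j" "\<And>\<sigma>. \<sigma> \<in> \<Sigma> j \<Longrightarrow> 0 \<le> f \<sigma>"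
  shows "(\<Sum>\<sigma>\<in>F. f \<sigma> / vol \<sigma>) \<le> orbit_sum j f"
  unfolding orbit_sum_def
  using assms by (intro finite_sum_le_infsum) (auto simp: orbit_summable_def R_in intro!: divide_nonneg_nonneg vol_nonneg)

lemma equivariant_butlast: "equivariant_map (Suc j) j butlast"
  and butlast_fiber: "\<tau> \<in> \<Sigma> j \<Longrightarrow> {\<sigma> \<in> \<Sigma> (Suc j). butlast \<sigma> = \<tau>} = (\<lambda>v. \<tau> @ [v]) ` ext \<tau>"
proof -
  show fiber: "{\<sigma> \<in> \<Sigma> (Suc j). butlast \<sigma> = \<tau>} = (\<lambda>v. \<tau> @ [v]) ` ext \<tau>" if "\<tau> \<in> \<Sigma> j" for \<tau>
  proof (intro set_eqI iffI)
    fix \<sigma> assume "\<sigma> \<in> {\<sigma> \<in> \<Sigma> (Suc j). butlast \<sigma> = \<tau>}"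
    then have "\<sigma> \<in> \<Sigma> (Suc j)" "butlast \<sigma> = \<tau>" "\<sigma> \<noteq> []" by (auto simp: ordered_simplices_def)
    then have \<sigma>: "\<sigma> \<in> \<Sigma> (Suc j)" "\<sigma> = \<tau> @ [last \<sigma>]"
      using append_butlast_last_id[of \<sigma>] by auto
    then have "last \<sigma> \<in> ext \<tau>" using mem_ext[OF that] by simp
    then show "\<sigma> \<in> (\<lambda>v. \<tau> @ [v]) ` ext \<tau>" using \<sigma>(2) by blast
  qed (auto simp: mem_ext[OF that])
  have "butlast \<sigma> \<in> \<Sigma> j" if "\<sigma> \<in> \<Sigma> (Suc j)" for \<sigma>
    using delete_nth_in[OF that order_refl] delete_nth_last[OF length_simplex[OF that]] by simp
  then show "equivariant_map (Suc j) j butlast"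
    using fiber finite_ext by (auto simp: equivariant_map_def map_butlast)
qed

lemma sum_butlast_fiber:
  "\<tau> \<in> \<Sigma> j \<Longrightarrow> (\<Sum>\<sigma>\<in>{\<sigma> \<in> \<Sigma> (Suc j). butlast \<sigma> = \<tau>}. f \<sigma>) = (\<Sum>v\<in>ext \<tau>. f (\<tau> @ [v]))"
  unfolding butlast_fiber by (subst sum.reindex) (auto simp: inj_on_def)

text \<open>
  The case in which the last vertex is forgotten.
\<close>

lemma unfold_last:
  assumes "invariant (Suc j) f" "orbit_summable (Suc j) f"
  shows "orbit_summable j (\<lambda>\<tau>. \<Sum>v\<in>ext \<tau>. f (\<tau> @ [v]))"
    and "orbit_sum j (\<lambda>\<tau>. \<Sum>v\<in>ext \<tau>. f (\<tau> @ [v])) = orbit_sum (Suc j) f"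
  using unfold_orbit_sum[OF equivariant_butlast assms]
  by (simp_all add: sum_butlast_fiber cong: orbit_sum_cong orbit_summable_cong)

lemma orbit_summable_fold_last:
  assumes "invariant (Suc j) f" "\<And>a. a \<in> \<Sigma> (Suc j) \<Longrightarrow> 0 \<le> f a"
    and "orbit_summable j (\<lambda>\<tau>. \<Sum>v\<in>ext \<tau>. f (\<tau> @ [v]))"
  shows "orbit_summable (Suc j) f"
  using assms(3) by (intro orbit_summable_fold[OF equivariant_butlast assms(1,2)])
     (simp_all add: sum_butlast_fiber cong: orbit_summable_cong)

lemma equivariant_move_last:
  assumes "i \<le> j"
  shows "equivariant_map j j (move_last i)"
    and "\<tau> \<in> \<Sigma> j \<Longrightarrow> \<exists>\<sigma>. {\<sigma> \<in> \<Sigma> j. move_last i \<sigma> = \<tau>} = {\<sigma>} \<and> move_last i \<sigma> = \<tau>"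
proof -
  show fiber: "\<exists>\<sigma>. {\<sigma> \<in> \<Sigma> j. move_last i \<sigma> = \<tau>} = {\<sigma>} \<and> move_last i \<sigma> = \<tau>" if \<tau>: "\<tau> \<in> \<Sigma> j" for \<tau>
  proof -
    obtain \<sigma> where \<sigma>: "length \<sigma> = Suc j" "move_last i \<sigma> = \<tau>"
      using surj_move_last[OF length_simplex[OF \<tau>] assms] by blast
    have "set \<sigma> = set \<tau>" using \<sigma> set_move_last[of i \<sigma>] assms by simp
    moreover from this have "distinct \<sigma>"
      using \<sigma>(1) \<tau> by (intro card_distinct) (auto simp: ordered_simplices_def distinct_card)
    ultimately have "\<sigma> \<in> \<Sigma> j" using \<sigma>(1) \<tau> by (simp add: ordered_simplices_def)
    moreover have "\<sigma>' = \<sigma>" if "\<sigma>' \<in> \<Sigma> j" "move_last i \<sigma>' = \<tau>" for \<sigma>'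
      using inj_move_last[of \<sigma>' \<sigma> i] that \<sigma> assms by (simp add: length_simplex)
    ultimately show ?thesis using \<sigma>(2) by blast
  qed
  have "finite {\<sigma> \<in> \<Sigma> j. move_last i \<sigma> = \<tau>}" if "\<tau> \<in> \<Sigma> j" for \<tau>
    using fiber[OF that] by (metis finite.emptyI finite.insertI)
  then show "equivariant_map j j (move_last i)"
    using assms move_last_in by (auto simp: equivariant_map_def move_last_map length_simplex)
qed

lemma invariant_move_last: "invariant j f \<Longrightarrow> i \<le> j \<Longrightarrow> invariant j (\<lambda>\<sigma>. f (move_last i \<sigma>))"
  by (auto simp: invariant_def move_last_map length_simplex move_last_in)

lemma sum_move_last_fiber:
  assumes "i \<le> j" "\<tau> \<in> \<Sigma> j"
  shows "(\<Sum>\<sigma>\<in>{\<sigma> \<in> \<Sigma> j. move_last i \<sigma> = \<tau>}. f (move_last i \<sigma>)) = f \<tau>"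
proof -
  obtain \<sigma> where "{\<sigma> \<in> \<Sigma> j. move_last i \<sigma> = \<tau>} = {\<sigma>}" "move_last i \<sigma> = \<tau>"
    using equivariant_move_last(2)[OF assms] by blast
  then show ?thesis by simp
qed

text \<open>
  Reordering vertices is an equivariant bijection, so it changes neither summability nor the sum. This
  is why it is harmless that the representatives are ordered simplices, and why the sum over all faces
  of a simplex reduces to the face obtained by deleting the last vertex.
\<close>

lemma orbit_sum_move_last:
  assumes f: "invariant j f" "orbit_summable j f" and i: "i \<le> j"
  shows "orbit_summable j (\<lambda>\<sigma>. f (move_last i \<sigma>))"
    and "orbit_sum j (\<lambda>\<sigma>. f (move_last i \<sigma>)) = orbit_sum j f"
proof -
  have fold: "orbit_summable j (\<lambda>\<tau>. \<Sum>\<sigma>\<in>{\<sigma> \<in> \<Sigma> j. move_last i \<sigma> = \<tau>}. \<bar>f (move_last i \<sigma>)\<bar>)"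
    using orbit_summable_abs[OF f(2)]
    by (rule orbit_summable_cong[THEN iffD1, rotated])
       (rule sum_move_last_fiber[OF i, where f = "\<lambda>\<sigma>. \<bar>f \<sigma>\<bar>", symmetric])
  have "invariant j (\<lambda>\<sigma>. \<bar>f (move_last i \<sigma>)\<bar>)"
    using invariant_move_last[OF f(1) i] by (simp add: invariant_def)
  then have "orbit_summable j (\<lambda>\<sigma>. \<bar>f (move_last i \<sigma>)\<bar>)"
    by (rule orbit_summable_fold[OF equivariant_move_last(1)[OF i] _ _ fold]) simp
  then show s: "orbit_summable j (\<lambda>\<sigma>. f (move_last i \<sigma>))"
    by (rule orbit_summable_comparison) simp
  have "orbit_sum j (\<lambda>\<sigma>. f (move_last i \<sigma>))
      = orbit_sum j (\<lambda>\<tau>. \<Sum>\<sigma>\<in>{\<sigma> \<in> \<Sigma> j. move_last i \<sigma> = \<tau>}. f (move_last i \<sigma>))"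
    by (rule unfold_orbit_sum(2)[OF equivariant_move_last(1)[OF i] invariant_move_last[OF f(1) i] s, symmetric])
  also have "\<dots> = orbit_sum j f"
    by (rule orbit_sum_cong) (rule sum_move_last_fiber[OF i])
  finally show "orbit_sum j (\<lambda>\<sigma>. f (move_last i \<sigma>)) = orbit_sum j f" .
qed

end

section \<open>Square-integrable cochains\<close>

lemma abs_inner_le: "\<bar>inner x y\<bar> \<le> (norm x)\<^sup>2 + (norm y)\<^sup>2" for x y :: "'a::real_inner"
proof -
  have "\<bar>inner x y\<bar> \<le> norm x * norm y" by (rule Cauchy_Schwarz_ineq2)
  also have "2 * (norm x * norm y) \<le> (norm x)\<^sup>2 + (norm y)\<^sup>2"
    using sum_squares_bound[of "norm x" "norm y"] by simp
  finally have "\<bar>inner x y\<bar> * 2 \<le> (norm x)\<^sup>2 + (norm y)\<^sup>2" by simp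
  then show ?thesis by (smt (verit) zero_le_power2)
qed

lemma norm_add_sq_le: "(norm (x + y))\<^sup>2 \<le> 2 * (norm x)\<^sup>2 + 2 * (norm y)\<^sup>2" for x y :: "'a::real_inner"
proof -
  have "(norm (x + y))\<^sup>2 \<le> (norm (x + y))\<^sup>2 + (norm (x - y))\<^sup>2" by simp
  also have "\<dots> = 2 * (norm x)\<^sup>2 + 2 * (norm y)\<^sup>2"
    by (simp add: power2_norm_eq_inner algebra_simps inner_commute)
  finally show ?thesis .
qed

text \<open>
  A weighted form of the Cauchy--Schwarz inequality.
\<close>

lemma norm_sum_sq_le:
  fixes f :: "'i \<Rightarrow> 'a::real_normed_vector"
  assumes "finite I" "\<And>i. i \<in> I \<Longrightarrow> 0 \<le> w i"
  shows "(norm (\<Sum>i\<in>I. w i *\<^sub>R f i))\<^sup>2 \<le> (\<Sum>i\<in>I. w i) * (\<Sum>i\<in>I. w i * (norm (f i))\<^sup>2)"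
proof -
  have "norm (\<Sum>i\<in>I. w i *\<^sub>R f i) \<le> (\<Sum>i\<in>I. sqrt (w i) * (sqrt (w i) * norm (f i)))"
    using assms(2) by (intro sum_norm_le) (simp flip: mult.assoc)
  then have "(norm (\<Sum>i\<in>I. w i *\<^sub>R f i))\<^sup>2 \<le> (\<Sum>i\<in>I. sqrt (w i) * (sqrt (w i) * norm (f i)))\<^sup>2"
    by (rule power_mono) simp
  also have "\<dots> \<le> (\<Sum>i\<in>I. (sqrt (w i))\<^sup>2) * (\<Sum>i\<in>I. (sqrt (w i) * norm (f i))\<^sup>2)"
    by (rule Cauchy_Schwarz_ineq_sum)
  also have "\<dots> = (\<Sum>i\<in>I. w i) * (\<Sum>i\<in>I. w i * (norm (f i))\<^sup>2)"
    using assms(2) by (intro arg_cong2[where f = "(*)"] sum.cong) (auto simp: power_mult_distrib)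
  finally show ?thesis .
qed

locale equivariant_cochains = complex_action X act \<mu> R n
  for X :: "'v set set"
    and act :: "'g::{topological_group_add, t2_space} \<Rightarrow> 'v \<Rightarrow> 'v"
    and \<mu> :: "'g measure"
    and R :: "nat \<Rightarrow> 'v list set"
    and n :: nat +
  fixes H :: "'h::complex_hilbert set"
    and \<rho> :: "'g \<Rightarrow> 'h \<Rightarrow> 'h"
  assumes rep: "unitary_rep H \<rho>"
begin

abbreviation C :: "nat \<Rightarrow> ('v list \<Rightarrow> 'h) set" where "C \<equiv> cochains X act H \<rho>"
abbreviation L :: "nat \<Rightarrow> ('v list \<Rightarrow> 'h) set" where "L \<equiv> L2_cochains X act \<mu> R H \<rho>"
abbreviation d :: "nat \<Rightarrow> ('v list \<Rightarrow> 'h) \<Rightarrow> 'v list \<Rightarrow> 'h" where "d \<equiv> coboundary X"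

lemma subspace: "closed_csubspace H"
  and rho_in: "x \<in> H \<Longrightarrow> \<rho> g x \<in> H"
  and rho_add: "x \<in> H \<Longrightarrow> y \<in> H \<Longrightarrow> \<rho> g (x + y) = \<rho> g x + \<rho> g y"
  and rho_scaleC: "x \<in> H \<Longrightarrow> \<rho> g (a *\<^sub>C x) = a *\<^sub>C \<rho> g x"
  and rho_cinner: "x \<in> H \<Longrightarrow> y \<in> H \<Longrightarrow> cinner (\<rho> g x) (\<rho> g y) = cinner x y"
  and rho_plus: "x \<in> H \<Longrightarrow> \<rho> (g + h) x = \<rho> g (\<rho> h x)"
  using rep by (simp_all add: unitary_rep_def)

lemma H_closed: "closed H"
  and H_zero: "0 \<in> H"
  and H_add: "x \<in> H \<Longrightarrow> y \<in> H \<Longrightarrow> x + y \<in> H"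
  and H_scaleR: "x \<in> H \<Longrightarrow> r *\<^sub>R x \<in> H"
  using subspace scaleC_of_real[of r x] unfolding closed_csubspace_def by metis+

lemma rho_scaleR: "x \<in> H \<Longrightarrow> \<rho> g (r *\<^sub>R x) = r *\<^sub>R \<rho> g x"
  using rho_scaleC[of x g "complex_of_real r"] by (simp add: scaleC_of_real)

lemma rho_inner: "x \<in> H \<Longrightarrow> y \<in> H \<Longrightarrow> inner (\<rho> g x) (\<rho> g y) = inner x y"
  using rho_cinner[of x y g] by (simp flip: Re_cinner)

lemma rho_norm: "x \<in> H \<Longrightarrow> norm (\<rho> g x) = norm x"
  using rho_inner[of x x g] by (simp add: norm_eq_sqrt_inner)

lemma rho_0: "\<rho> g 0 = 0"
  using rho_norm[OF H_zero, of g] by simp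

lemma H_sum: "(\<And>i. i \<in> I \<Longrightarrow> f i \<in> H) \<Longrightarrow> (\<Sum>i\<in>I. f i) \<in> H"
  by (induction I rule: infinite_finite_induct) (auto intro: H_zero H_add)

lemma rho_sum: "(\<And>i. i \<in> I \<Longrightarrow> f i \<in> H) \<Longrightarrow> \<rho> g (\<Sum>i\<in>I. f i) = (\<Sum>i\<in>I. \<rho> g (f i))"
  by (induction I rule: infinite_finite_induct) (auto simp: rho_0 rho_add H_sum)

lemma C_iff: "\<phi> \<in> C j \<longleftrightarrow> (\<forall>\<sigma>. \<sigma> \<notin> \<Sigma> j \<longrightarrow> \<phi> \<sigma> = 0) \<and> (\<forall>\<sigma>\<in>\<Sigma> j. \<phi> \<sigma> \<in> H) \<and>
    alternating_on (\<Sigma> j) \<phi> \<and> (\<forall>g. \<forall>\<sigma>\<in>\<Sigma> j. \<phi> (map (act g) \<sigma>) = \<rho> g (\<phi> \<sigma>))"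
  by (simp add: cochains_def alternating_iff_sign)

lemma C_in: "\<phi> \<in> C j \<Longrightarrow> \<phi> \<sigma> \<in> H"
  and C_supp: "\<phi> \<in> C j \<Longrightarrow> \<sigma> \<notin> \<Sigma> j \<Longrightarrow> \<phi> \<sigma> = 0"
  and C_alt: "\<phi> \<in> C j \<Longrightarrow> alternating_on (\<Sigma> j) \<phi>"
  and C_act: "\<phi> \<in> C j \<Longrightarrow> \<sigma> \<in> \<Sigma> j \<Longrightarrow> \<phi> (map (act g) \<sigma>) = \<rho> g (\<phi> \<sigma>)"
  unfolding C_iff using H_zero by metis+

lemma C_norm_act: "\<phi> \<in> C j \<Longrightarrow> \<sigma> \<in> \<Sigma> j \<Longrightarrow> norm (\<phi> (map (act g) \<sigma>)) = norm (\<phi> \<sigma>)"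
  by (simp add: C_act rho_norm C_in)

lemma C_move_last: "\<phi> \<in> C j \<Longrightarrow> \<sigma> \<in> \<Sigma> j \<Longrightarrow> i \<le> j \<Longrightarrow> \<phi> (move_last i \<sigma>) = (-1) ^ (j - i) *\<^sub>R \<phi> \<sigma>"
  by (rule alternating_move_last[OF C_alt])

lemma C_add: "\<phi> \<in> C j \<Longrightarrow> \<psi> \<in> C j \<Longrightarrow> (\<lambda>\<sigma>. \<phi> \<sigma> + \<psi> \<sigma>) \<in> C j"
  unfolding C_iff by (auto simp: alternating_on_def rho_add H_add)

lemma C_scale: "\<phi> \<in> C j \<Longrightarrow> (\<lambda>\<sigma>. r *\<^sub>R \<phi> \<sigma>) \<in> C j"
  unfolding C_iff by (auto simp: alternating_on_def rho_scaleR H_scaleR)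

abbreviation energy :: "('v list \<Rightarrow> 'h) \<Rightarrow> 'v list \<Rightarrow> real" where
  "energy \<phi> \<sigma> \<equiv> m \<sigma> * (norm (\<phi> \<sigma>))\<^sup>2"

lemma L_iff: "\<phi> \<in> L j \<longleftrightarrow> \<phi> \<in> C j \<and> orbit_summable j (\<lambda>\<sigma>. energy \<phi> \<sigma>)"
proof -
  have "(\<lambda>\<sigma>. real (mult X (set \<sigma>)) / (fact (Suc j) * measure \<mu> (stab act \<sigma>)) * (norm (\<phi> \<sigma>))\<^sup>2)
      = (\<lambda>\<sigma>. (1 / fact (Suc j)) * (energy \<phi> \<sigma> / vol \<sigma>))"
    by (simp add: fun_eq_iff m_def vol_def)
  then show ?thesis
    unfolding L2_cochains_def orbit_summable_def mem_Collect_eq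
    by (simp only: summable_on_cmult_right'[of "1 / fact (Suc j) :: real"] fact_nonzero divide_eq_0_iff one_neq_zero simp_thms)
qed

text \<open>
  The norm and the real inner product of \<open>L j\<close> up to the factor \<open>1 / (j + 1)!\<close>. Without this factor the
  adjoint of \<open>d\<close> carries the number of vertices as a coefficient (see \<open>codiff\<close>).
\<close>

definition norm_sq :: "nat \<Rightarrow> ('v list \<Rightarrow> 'h) \<Rightarrow> real" where
  "norm_sq j \<phi> = orbit_sum j (\<lambda>\<sigma>. energy \<phi> \<sigma>)"

definition ip :: "nat \<Rightarrow> ('v list \<Rightarrow> 'h) \<Rightarrow> ('v list \<Rightarrow> 'h) \<Rightarrow> real" where
  "ip j \<phi> \<psi> = orbit_sum j (\<lambda>\<sigma>. m \<sigma> * inner (\<phi> \<sigma>) (\<psi> \<sigma>))"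

lemma L_C: "\<phi> \<in> L j \<Longrightarrow> \<phi> \<in> C j"
  and L_summable: "\<phi> \<in> L j \<Longrightarrow> orbit_summable j (\<lambda>\<sigma>. energy \<phi> \<sigma>)"
  by (auto simp: L_iff)

lemma abs_weighted_inner_le:
  "\<bar>m \<sigma> * inner x y\<bar> \<le> m \<sigma> * (norm x)\<^sup>2 + m \<sigma> * (norm y)\<^sup>2" for x y :: "'a::real_inner"
  using mult_left_mono[OF abs_inner_le[of x y] m_nonneg[of \<sigma>]]
  by (simp add: abs_mult m_nonneg distrib_left)

lemma ip_summable: "\<phi> \<in> L j \<Longrightarrow> \<psi> \<in> L j \<Longrightarrow> orbit_summable j (\<lambda>\<sigma>. m \<sigma> * inner (\<phi> \<sigma>) (\<psi> \<sigma>))"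
  by (rule orbit_summable_comparison[OF orbit_summable_add[OF L_summable[of \<phi>] L_summable[of \<psi>]]])
     (simp_all add: abs_weighted_inner_le)

lemma norm_sq_ip: "norm_sq j \<phi> = ip j \<phi> \<phi>"
  by (simp add: norm_sq_def ip_def power2_norm_eq_inner)

lemma norm_sq_nonneg: "0 \<le> norm_sq j \<phi>"
  unfolding norm_sq_def by (intro orbit_sum_nonneg mult_nonneg_nonneg m_nonneg) simp

lemma L_scale: "\<phi> \<in> L j \<Longrightarrow> (\<lambda>\<sigma>. r *\<^sub>R \<phi> \<sigma>) \<in> L j"
  using orbit_summable_cmult[OF L_summable, of \<phi> j "r\<^sup>2"]
  unfolding L_iff by (simp add: C_scale power_mult_distrib mult_ac)

lemma L_add: "\<phi> \<in> L j \<Longrightarrow> \<psi> \<in> L j \<Longrightarrow> (\<lambda>\<sigma>. \<phi> \<sigma> + \<psi> \<sigma>) \<in> L j"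
proof -
  assume L: "\<phi> \<in> L j" "\<psi> \<in> L j"
  have "orbit_summable j (\<lambda>\<sigma>. 2 * (energy \<phi> \<sigma>) + 2 * (energy \<psi> \<sigma>))"
    by (intro orbit_summable_add orbit_summable_cmult L_summable L)
  then have "orbit_summable j (\<lambda>\<sigma>. m \<sigma> * (norm (\<phi> \<sigma> + \<psi> \<sigma>))\<^sup>2)"
  proof (rule orbit_summable_comparison)
    fix \<sigma>
    have "m \<sigma> * (norm (\<phi> \<sigma> + \<psi> \<sigma>))\<^sup>2 \<le> m \<sigma> * (2 * (norm (\<phi> \<sigma>))\<^sup>2 + 2 * (norm (\<psi> \<sigma>))\<^sup>2)"
      by (intro mult_left_mono norm_add_sq_le m_nonneg)
    then show "\<bar>m \<sigma> * (norm (\<phi> \<sigma> + \<psi> \<sigma>))\<^sup>2\<bar> \<le> 2 * (energy \<phi> \<sigma>) + 2 * (energy \<psi> \<sigma>)"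
      by (simp add: m_nonneg algebra_simps)
  qed
  then show ?thesis using L by (simp add: L_iff C_add)
qed

lemma norm_sq_diff_scale:
  assumes "\<phi> \<in> L j" "\<psi> \<in> L j"
  shows "norm_sq j (\<lambda>\<sigma>. \<phi> \<sigma> - t *\<^sub>R \<psi> \<sigma>) = norm_sq j \<phi> - 2 * t * ip j \<phi> \<psi> + t\<^sup>2 * norm_sq j \<psi>"
proof -
  have "m \<sigma> * (norm (\<phi> \<sigma> - t *\<^sub>R \<psi> \<sigma>))\<^sup>2
      = (energy \<phi> \<sigma> - (2 * t) * (m \<sigma> * inner (\<phi> \<sigma>) (\<psi> \<sigma>))) + t\<^sup>2 * (energy \<psi> \<sigma>)" for \<sigma>
    unfolding power2_norm_eq_inner
    by (simp add: inner_diff_left inner_diff_right inner_commute algebra_simps power2_eq_square)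
  then show ?thesis
    unfolding norm_sq_def ip_def
    by (simp add: orbit_sum_add orbit_sum_diff orbit_sum_cmult orbit_summable_diff orbit_summable_cmult L_summable ip_summable assms)
qed

section \<open>The coboundary operator\<close>

lemma d_apply: "\<sigma> \<in> \<Sigma> (Suc j) \<Longrightarrow> d j \<phi> \<sigma> = (\<Sum>i\<le>Suc j. (-1) ^ i *\<^sub>R \<phi> (delete_nth i \<sigma>))"
  by (simp add: coboundary_def)

text \<open>
  Exchanging two neighbouring vertices exchanges the two terms in which one of them is deleted and
  changes the sign of every other term.
\<close>

lemma d_alternating:
  assumes \<phi>: "\<phi> \<in> C j"
  shows "alternating_on (\<Sigma> (Suc j)) (d j \<phi>)"
  unfolding alternating_on_def
proof (intro allI impI)
  fix xs a b ys assume \<sigma>: "xs @ a # b # ys \<in> \<Sigma> (Suc j)" (is "?\<sigma> \<in> _")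
  let ?\<sigma>' = "xs @ b # a # ys" and ?p = "length xs"
  have \<sigma>': "?\<sigma>' \<in> \<Sigma> (Suc j)" by (rule ordered_simplices_cong[OF \<sigma>]) simp
  define s where "s i = (if i = ?p then Suc ?p else if i = Suc ?p then ?p else i)" for i
  have p: "Suc ?p \<le> Suc j" using length_simplex[OF \<sigma>] by simp
  have swap: "(-1) ^ i *\<^sub>R \<phi> (delete_nth i ?\<sigma>') = - ((-1) ^ s i *\<^sub>R \<phi> (delete_nth (s i) ?\<sigma>))"
    if i: "i \<le> Suc j" for i
  proof -
    have in_j: "delete_nth i ?\<sigma> \<in> \<Sigma> j" by (rule delete_nth_in[OF \<sigma> i])
    consider "i < ?p" | "i = ?p" | "i = Suc ?p" | q where "i = Suc (Suc (?p + q))"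
      by (metis less_Suc_eq less_linear less_imp_Suc_add)
    then show ?thesis
    proof cases
      case 1
      then have "delete_nth i ?\<sigma> = delete_nth i xs @ a # b # ys" "delete_nth i ?\<sigma>' = delete_nth i xs @ b # a # ys"
        by (simp_all add: delete_nth_append)
      then show ?thesis using C_alt[OF \<phi>] in_j 1 by (simp add: alternating_on_def s_def)
    next
      case 2
      then have "delete_nth i ?\<sigma>' = xs @ a # ys" "delete_nth (s i) ?\<sigma> = xs @ a # ys"
        by (simp_all add: delete_nth_def s_def)
      then show ?thesis using 2 by (simp add: s_def)
    next
      case 3
      then have "delete_nth i ?\<sigma>' = xs @ b # ys" "delete_nth (s i) ?\<sigma> = xs @ b # ys"
        by (simp_all add: delete_nth_def s_def)
      then show ?thesis using 3 by (simp add: s_def)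
    next
      case 4
      then have "delete_nth i ?\<sigma> = xs @ a # b # delete_nth q ys" "delete_nth i ?\<sigma>' = xs @ b # a # delete_nth q ys"
        by (simp_all add: delete_nth_def numeral_3_eq_3)
      then show ?thesis using C_alt[OF \<phi>] in_j 4 by (simp add: alternating_on_def s_def)
    qed
  qed
  have "d j \<phi> ?\<sigma>' = (\<Sum>i\<le>Suc j. - ((-1) ^ s i *\<^sub>R \<phi> (delete_nth (s i) ?\<sigma>)))"
    unfolding d_apply[OF \<sigma>'] by (intro sum.cong refl swap) simp
  also have "\<dots> = (\<Sum>i\<le>Suc j. - ((-1) ^ i *\<^sub>R \<phi> (delete_nth i ?\<sigma>)))"
    by (rule sum.reindex_bij_witness[where i = s and j = s]) (use p in \<open>auto simp: s_def\<close>)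
  also have "\<dots> = - d j \<phi> ?\<sigma>" unfolding d_apply[OF \<sigma>] by (rule sum_negf)
  finally show "d j \<phi> ?\<sigma>' = - d j \<phi> ?\<sigma>" .
qed

lemma d_C:
  assumes \<phi>: "\<phi> \<in> C j"
  shows "d j \<phi> \<in> C (Suc j)"
  unfolding C_iff
proof (intro conjI allI impI ballI)
  fix \<sigma> assume "\<sigma> \<notin> \<Sigma> (Suc j)" then show "d j \<phi> \<sigma> = 0" by (simp add: coboundary_def)
next
  fix \<sigma> assume "\<sigma> \<in> \<Sigma> (Suc j)" then show "d j \<phi> \<sigma> \<in> H"
    by (simp only: d_apply) (intro H_sum H_scaleR C_in[OF \<phi>])
next
  fix g \<sigma> assume \<sigma>: "\<sigma> \<in> \<Sigma> (Suc j)"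
  have "d j \<phi> (map (act g) \<sigma>) = (\<Sum>i\<le>Suc j. \<rho> g ((-1) ^ i *\<^sub>R \<phi> (delete_nth i \<sigma>)))"
    unfolding d_apply[OF map_act_in[OF \<sigma>]]
    by (intro sum.cong refl) (simp add: delete_nth_map C_act[OF \<phi>] delete_nth_in[OF \<sigma>] rho_scaleR C_in[OF \<phi>])
  also have "\<dots> = \<rho> g (d j \<phi> \<sigma>)"
    unfolding d_apply[OF \<sigma>] by (rule rho_sum[symmetric]) (intro H_scaleR C_in[OF \<phi>])
  finally show "d j \<phi> (map (act g) \<sigma>) = \<rho> g (d j \<phi> \<sigma>)" .
qed (rule d_alternating[OF \<phi>])

lemma d_d: "d (Suc j) (d j \<phi>) = (\<lambda>_. 0)"
proof
  fix \<sigma> show "d (Suc j) (d j \<phi>) \<sigma> = 0"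
  proof (cases "\<sigma> \<in> \<Sigma> (Suc (Suc j))")
    case True
    define h where "h i l = (-1::real) ^ (i + l) *\<^sub>R \<phi> (delete_nth l (delete_nth i \<sigma>))" for i l
    have dd: "d (Suc j) (d j \<phi>) \<sigma> = (\<Sum>i\<le>Suc (Suc j). \<Sum>l\<le>Suc j. h i l)"
      unfolding d_apply[OF True]
      by (intro sum.cong refl)
         (simp add: d_apply[OF delete_nth_in[OF True]] scaleR_sum_right h_def power_add del: sum.atMost_Suc)
    have "(\<Sum>i\<le>Suc (Suc j). \<Sum>l\<le>Suc j. h i l) = (\<Sum>i\<le>Suc (Suc j). \<Sum>l\<le>Suc j. h (skip i l) (coskip i l))"
      by (rule sum_exchange_pairs[symmetric])
    also have "\<dots> = (\<Sum>i\<le>Suc (Suc j). \<Sum>l\<le>Suc j. - h i l)"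
      by (intro sum.cong refl)
         (simp add: h_def skip_sign delete_nth_delete_nth[of \<sigma> "Suc j"] length_simplex[OF True])
    also have "\<dots> = - (\<Sum>i\<le>Suc (Suc j). \<Sum>l\<le>Suc j. h i l)" by (simp only: sum_negf)
    finally have "(\<Sum>i\<le>Suc (Suc j). \<Sum>l\<le>Suc j. h i l) + (\<Sum>i\<le>Suc (Suc j). \<Sum>l\<le>Suc j. h i l) = 0"
      by (simp only: eq_neg_iff_add_eq_0)
    then have "2 *\<^sub>R d (Suc j) (d j \<phi>) \<sigma> = 0"
      by (simp only: dd scaleR_2)
    then show ?thesis by simp
  qed (simp add: coboundary_def)
qed

lemma butlast_in: "\<gamma> \<in> \<Sigma> (Suc j) \<Longrightarrow> butlast \<gamma> \<in> \<Sigma> j"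
  using equivariant_butlast by (auto simp: equivariant_map_def)

lemma butlast_move_last: "butlast (move_last i \<sigma>) = delete_nth i \<sigma>"
  by (simp add: move_last_def)

text \<open>
  Unfolding along the last vertex turns the sum of \<open>|\<phi>|\<^sup>2\<close> over one face of each \<open>(j + 1)\<close>-simplex into
  \<open>n - j\<close> times the squared norm, since \<open>\<phi> \<tau>\<close> is counted with total multiplicity \<open>(n - j) m \<tau>\<close>.
\<close>

lemma butlast_energy:
  assumes \<phi>: "\<phi> \<in> L j" and j: "j \<le> n"
  shows "invariant (Suc j) (\<lambda>\<gamma>. m \<gamma> * (norm (\<phi> (butlast \<gamma>)))\<^sup>2)"
    and "orbit_summable (Suc j) (\<lambda>\<gamma>. m \<gamma> * (norm (\<phi> (butlast \<gamma>)))\<^sup>2)"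
    and "orbit_sum (Suc j) (\<lambda>\<gamma>. m \<gamma> * (norm (\<phi> (butlast \<gamma>)))\<^sup>2) = real (n - j) * norm_sq j \<phi>"
proof -
  let ?f = "\<lambda>\<gamma>. m \<gamma> * (norm (\<phi> (butlast \<gamma>)))\<^sup>2"
  show inv: "invariant (Suc j) ?f"
    by (auto simp: invariant_def m_map_act map_butlast[symmetric] C_norm_act[OF L_C[OF \<phi>]] butlast_in)
  have fib: "(\<Sum>v\<in>ext \<tau>. ?f (\<tau> @ [v])) = real (n - j) * (energy \<phi> \<tau>)" if "\<tau> \<in> \<Sigma> j" for \<tau>
    using sum_m_ext[OF that j] by (simp flip: sum_distrib_right)
  have "orbit_summable j (\<lambda>\<tau>. \<Sum>v\<in>ext \<tau>. ?f (\<tau> @ [v]))"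
    using orbit_summable_cmult[OF L_summable[OF \<phi>], of "real (n - j)"]
    by (rule orbit_summable_cong[THEN iffD1, rotated]) (rule fib[symmetric])
  then show s: "orbit_summable (Suc j) ?f"
    by (intro orbit_summable_fold_last[OF inv]) (simp_all add: m_nonneg)
  have "orbit_sum (Suc j) ?f = orbit_sum j (\<lambda>\<tau>. \<Sum>v\<in>ext \<tau>. ?f (\<tau> @ [v]))"
    by (rule unfold_last(2)[OF inv s, symmetric])
  also have "\<dots> = orbit_sum j (\<lambda>\<tau>. real (n - j) * (energy \<phi> \<tau>))"
    by (rule orbit_sum_cong) (rule fib)
  also have "\<dots> = real (n - j) * norm_sq j \<phi>" by (simp add: orbit_sum_cmult norm_sq_def)
  finally show "orbit_sum (Suc j) ?f = real (n - j) * norm_sq j \<phi>" .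
qed

lemma face_energy:
  assumes \<phi>: "\<phi> \<in> L j" and j: "j \<le> n" and i: "i \<le> Suc j"
  shows "orbit_summable (Suc j) (\<lambda>\<gamma>. m \<gamma> * (norm (\<phi> (delete_nth i \<gamma>)))\<^sup>2)"
    and "orbit_sum (Suc j) (\<lambda>\<gamma>. m \<gamma> * (norm (\<phi> (delete_nth i \<gamma>)))\<^sup>2) = real (n - j) * norm_sq j \<phi>"
proof -
  have e: "m (move_last i \<gamma>) * (norm (\<phi> (butlast (move_last i \<gamma>))))\<^sup>2 = m \<gamma> * (norm (\<phi> (delete_nth i \<gamma>)))\<^sup>2"
    if "\<gamma> \<in> \<Sigma> (Suc j)" for \<gamma>
    using i m_cong[OF set_move_last, of i \<gamma>] length_simplex[OF that] by (simp add: butlast_move_last)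
  note b = butlast_energy[OF \<phi> j]
  show "orbit_summable (Suc j) (\<lambda>\<gamma>. m \<gamma> * (norm (\<phi> (delete_nth i \<gamma>)))\<^sup>2)"
    using orbit_sum_move_last(1)[OF b(1,2) i] by (rule orbit_summable_cong[THEN iffD1, rotated]) (rule e)
  show "orbit_sum (Suc j) (\<lambda>\<gamma>. m \<gamma> * (norm (\<phi> (delete_nth i \<gamma>)))\<^sup>2) = real (n - j) * norm_sq j \<phi>"
    using orbit_sum_move_last(2)[OF b(1,2) i] orbit_sum_cong[of "Suc j", OF e] b(3) by simp
qed

lemma d_bounded:
  assumes \<phi>: "\<phi> \<in> L j" and j: "j \<le> n"
  shows "d j \<phi> \<in> L (Suc j)"
    and "norm_sq (Suc j) (d j \<phi>) \<le> (real (j + 2))\<^sup>2 * real (n - j) * norm_sq j \<phi>"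
proof -
  let ?F = "\<lambda>\<gamma>. real (j + 2) * (\<Sum>i\<le>Suc j. m \<gamma> * (norm (\<phi> (delete_nth i \<gamma>)))\<^sup>2)"
  have le: "energy (d j \<phi>) \<gamma> \<le> ?F \<gamma>" if "\<gamma> \<in> \<Sigma> (Suc j)" for \<gamma>
  proof -
    have "(norm (d j \<phi> \<gamma>))\<^sup>2 \<le> real (j + 2) * (\<Sum>i\<le>Suc j. (norm (\<phi> (delete_nth i \<gamma>)))\<^sup>2)"
      using norm_sum_sq_le[of "{..Suc j}" "\<lambda>_. 1" "\<lambda>i. (-1) ^ i *\<^sub>R \<phi> (delete_nth i \<gamma>)"]
      unfolding d_apply[OF that] by (simp del: sum.atMost_Suc)
    then have "energy (d j \<phi>) \<gamma> \<le> m \<gamma> * (real (j + 2) * (\<Sum>i\<le>Suc j. (norm (\<phi> (delete_nth i \<gamma>)))\<^sup>2))"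
      by (rule mult_left_mono) (rule m_nonneg)
    then show ?thesis by (simp add: sum_distrib_left mult_ac del: sum.atMost_Suc)
  qed
  have sF: "orbit_summable (Suc j) ?F"
    by (intro orbit_summable_cmult orbit_summable_sum face_energy(1)[OF \<phi> j]) auto
  have s: "orbit_summable (Suc j) (\<lambda>\<gamma>. energy (d j \<phi>) \<gamma>)"
    using sF by (rule orbit_summable_comparison) (use le R_in in \<open>simp add: m_nonneg\<close>)
  then show "d j \<phi> \<in> L (Suc j)" using d_C[OF L_C[OF \<phi>]] by (simp add: L_iff)
  have "norm_sq (Suc j) (d j \<phi>) \<le> orbit_sum (Suc j) ?F"
    unfolding norm_sq_def by (rule orbit_sum_mono[OF s sF]) (use le R_in in blast)
  also have "\<dots> = real (j + 2) * (\<Sum>i\<le>Suc j. real (n - j) * norm_sq j \<phi>)"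
    unfolding orbit_sum_cmult
    by (subst orbit_sum_sum) (simp_all add: face_energy[OF \<phi> j] del: sum.atMost_Suc)
  also have "\<dots> = (real (j + 2))\<^sup>2 * real (n - j) * norm_sq j \<phi>"
    by (simp add: power2_eq_square del: sum.atMost_Suc)
  finally show "norm_sq (Suc j) (d j \<phi>) \<le> (real (j + 2))\<^sup>2 * real (n - j) * norm_sq j \<phi>" .
qed

section \<open>The adjoint of the coboundary operator\<close>

definition link_sum :: "('v list \<Rightarrow> 'h) \<Rightarrow> 'v list \<Rightarrow> 'h" where
  "link_sum \<phi> \<tau> = (\<Sum>v\<in>ext \<tau>. m (\<tau> @ [v]) *\<^sub>R \<phi> (\<tau> @ [v]))"

text \<open>
  The adjoint of \<open>d\<close> for the inner products \<open>ip\<close>. Up to a constant its value at \<open>\<tau>\<close> is the mean, with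
  respect to the multiplicities, of the function \<open>v \<mapsto> \<phi> (\<tau> v)\<close> on the link of \<open>\<tau>\<close>.
\<close>

definition codiff :: "nat \<Rightarrow> ('v list \<Rightarrow> 'h) \<Rightarrow> 'v list \<Rightarrow> 'h" where
  "codiff k \<phi> \<tau> = (if \<tau> \<in> \<Sigma> k then ((-1) ^ Suc k * real (k + 2) / m \<tau>) *\<^sub>R link_sum \<phi> \<tau> else 0)"

lemma codiff_C:
  assumes \<phi>: "\<phi> \<in> C (Suc k)"
  shows "codiff k \<phi> \<in> C k"
  unfolding C_iff
proof (intro conjI allI impI ballI)
  fix \<sigma> assume "\<sigma> \<notin> \<Sigma> k" then show "codiff k \<phi> \<sigma> = 0" by (simp add: codiff_def)
next
  fix \<sigma> assume \<sigma>: "\<sigma> \<in> \<Sigma> k"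
  show "codiff k \<phi> \<sigma> \<in> H"
    by (simp only: codiff_def \<sigma> if_True link_sum_def) (intro H_scaleR H_sum C_in[OF \<phi>])
next
  show "alternating_on (\<Sigma> k) (codiff k \<phi>)"
    unfolding alternating_on_def
  proof (intro allI impI)
    fix xs a b ys assume \<sigma>: "xs @ a # b # ys \<in> \<Sigma> k" (is "?\<sigma> \<in> _")
    let ?\<sigma>' = "xs @ b # a # ys"
    have \<sigma>': "?\<sigma>' \<in> \<Sigma> k" by (rule ordered_simplices_cong[OF \<sigma>]) simp
    have ext: "ext ?\<sigma>' = ext ?\<sigma>"
      unfolding ext_def by (auto elim: ordered_simplices_cong)
    have "\<phi> (?\<sigma>' @ [v]) = - \<phi> (?\<sigma> @ [v])" if "v \<in> ext ?\<sigma>" for v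
      using C_alt[OF \<phi>] that unfolding mem_ext[OF \<sigma>] by (simp add: alternating_on_def)
    then have "link_sum \<phi> ?\<sigma>' = - link_sum \<phi> ?\<sigma>"
      unfolding link_sum_def ext sum_negf[symmetric]
      using m_cong[of "?\<sigma>' @ [v]" "?\<sigma> @ [v]" for v] by (intro sum.cong refl) (simp add: insert_commute)
    then show "codiff k \<phi> ?\<sigma>' = - codiff k \<phi> ?\<sigma>"
      using \<sigma> \<sigma>' m_cong[of ?\<sigma>' ?\<sigma>] by (simp add: codiff_def insert_commute)
  qed
next
  fix g \<sigma> assume \<sigma>: "\<sigma> \<in> \<Sigma> k"
  have "link_sum \<phi> (map (act g) \<sigma>) = (\<Sum>v\<in>ext \<sigma>. m (map (act g) \<sigma> @ [act g v]) *\<^sub>R \<phi> (map (act g) \<sigma> @ [act g v]))"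
    unfolding link_sum_def by (rule sum.reindex_bij_betw[OF ext_act[OF \<sigma>], symmetric])
  also have "\<dots> = (\<Sum>v\<in>ext \<sigma>. \<rho> g (m (\<sigma> @ [v]) *\<^sub>R \<phi> (\<sigma> @ [v])))"
  proof (intro sum.cong refl)
    fix v assume "v \<in> ext \<sigma>"
    then have v: "\<sigma> @ [v] \<in> \<Sigma> (Suc k)" using mem_ext[OF \<sigma>] by blast
    show "m (map (act g) \<sigma> @ [act g v]) *\<^sub>R \<phi> (map (act g) \<sigma> @ [act g v]) = \<rho> g (m (\<sigma> @ [v]) *\<^sub>R \<phi> (\<sigma> @ [v]))"
      using m_map_act[OF v, of g] C_act[OF \<phi> v, of g] by (simp add: rho_scaleR C_in[OF \<phi>])
  qed
  also have "\<dots> = \<rho> g (link_sum \<phi> \<sigma>)"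
    unfolding link_sum_def by (rule rho_sum[symmetric]) (intro H_scaleR C_in[OF \<phi>])
  finally show "codiff k \<phi> (map (act g) \<sigma>) = \<rho> g (codiff k \<phi> \<sigma>)"
    by (simp only: codiff_def \<sigma> map_act_in[OF \<sigma>] m_map_act[OF \<sigma>] if_True)
       (intro rho_scaleR[symmetric], simp only: link_sum_def, intro H_sum H_scaleR C_in[OF \<phi>])
qed

lemma energy_invariant: "\<phi> \<in> C j \<Longrightarrow> invariant j (\<lambda>\<sigma>. energy \<phi> \<sigma>)"
  by (simp add: invariant_def m_map_act C_norm_act)

lemma codiff_bounded:
  assumes \<phi>: "\<phi> \<in> L (Suc k)" and k: "k \<le> n"
  shows "codiff k \<phi> \<in> L k"
    and "norm_sq k (codiff k \<phi>) \<le> (real (k + 2))\<^sup>2 * real (n - k) * norm_sq (Suc k) \<phi>"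
proof -
  let ?c = "(real (k + 2))\<^sup>2 * real (n - k)"
  let ?F = "\<lambda>\<tau>. \<Sum>v\<in>ext \<tau>. m (\<tau> @ [v]) * (norm (\<phi> (\<tau> @ [v])))\<^sup>2"
  have le: "energy (codiff k \<phi>) \<tau> \<le> ?c * ?F \<tau>" if \<tau>: "\<tau> \<in> \<Sigma> k" for \<tau>
  proof -
    have "(norm (link_sum \<phi> \<tau>))\<^sup>2 \<le> (\<Sum>v\<in>ext \<tau>. m (\<tau> @ [v])) * ?F \<tau>"
      unfolding link_sum_def by (rule norm_sum_sq_le) (auto simp: m_nonneg finite_ext[OF \<tau>])
    then have *: "(norm (link_sum \<phi> \<tau>))\<^sup>2 \<le> real (n - k) * m \<tau> * ?F \<tau>"
      by (simp add: sum_m_ext[OF \<tau> k])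
    have "energy (codiff k \<phi>) \<tau> = (real (k + 2))\<^sup>2 / m \<tau> * (norm (link_sum \<phi> \<tau>))\<^sup>2"
      using m_pos[OF \<tau>] \<tau> by (simp add: codiff_def power_mult_distrib power_divide power2_eq_square)
    also have "\<dots> \<le> (real (k + 2))\<^sup>2 / m \<tau> * (real (n - k) * m \<tau> * ?F \<tau>)"
      using * m_pos[OF \<tau>] by (intro mult_left_mono) auto
    also have "\<dots> = ?c * ?F \<tau>" using m_pos[OF \<tau>] by simp
    finally show ?thesis .
  qed
  note u = unfold_last[OF energy_invariant[OF L_C[OF \<phi>]] L_summable[OF \<phi>]]
  have sF: "orbit_summable k (\<lambda>\<tau>. ?c * ?F \<tau>)" by (rule orbit_summable_cmult[OF u(1)])
  have s: "orbit_summable k (\<lambda>\<tau>. energy (codiff k \<phi>) \<tau>)"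
    using sF by (rule orbit_summable_comparison) (use le R_in in \<open>simp add: m_nonneg\<close>)
  then show "codiff k \<phi> \<in> L k" using codiff_C[OF L_C[OF \<phi>]] by (simp add: L_iff)
  have "norm_sq k (codiff k \<phi>) \<le> orbit_sum k (\<lambda>\<tau>. ?c * ?F \<tau>)"
    unfolding norm_sq_def by (rule orbit_sum_mono[OF s sF]) (use le R_in in blast)
  also have "\<dots> = ?c * norm_sq (Suc k) \<phi>" unfolding orbit_sum_cmult u(2) norm_sq_def ..
  finally show "norm_sq k (codiff k \<phi>) \<le> ?c * norm_sq (Suc k) \<phi>" .
qed

text \<open>
  After moving the \<open>i\<close>-th vertex to the end, each of the \<open>k + 2\<close> terms of \<open>\<langle>\<phi>, d \<psi>\<rangle>\<close> has the form
  \<open>\<plusminus> \<langle>\<phi> (\<tau> v), \<psi> \<tau>\<rangle>\<close> with the same sign, and unfolding along \<open>v\<close> collects the values of \<open>\<phi>\<close> around \<open>\<tau>\<close>.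
\<close>

lemma d_codiff_adjoint:
  assumes \<phi>: "\<phi> \<in> L (Suc k)" and \<psi>: "\<psi> \<in> L k" and k: "k \<le> n"
  shows "ip (Suc k) \<phi> (d k \<psi>) = ip k (codiff k \<phi>) \<psi>"
proof -
  define G where "G \<sigma> = (-1) ^ Suc k * (m \<sigma> * inner (\<phi> \<sigma>) (\<psi> (butlast \<sigma>)))" for \<sigma>
  have G: "G (move_last i \<sigma>) = m \<sigma> * ((-1) ^ i * inner (\<phi> \<sigma>) (\<psi> (delete_nth i \<sigma>)))"
    if "i \<le> Suc k" "\<sigma> \<in> \<Sigma> (Suc k)" for i \<sigma>
  proof -
    have "m (move_last i \<sigma>) = m \<sigma>"
      using that by (intro m_cong set_move_last) (simp add: length_simplex)
    moreover have "(-1::real) ^ Suc k * (-1) ^ (Suc k - i) = (-1) ^ i"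
    proof -
      have "(-1::real) ^ Suc k = (-1) ^ (Suc k - i) * (-1) ^ i"
        using that by (simp flip: power_add)
      moreover have "(-1::real) ^ (Suc k - i) * (-1) ^ (Suc k - i) = 1"
        by (simp flip: power_mult_distrib)
      ultimately show ?thesis by (simp only: mult_ac mult_1 flip: mult.assoc)
    qed
    ultimately show ?thesis
      unfolding G_def C_move_last[OF L_C[OF \<phi>] that(2,1)] butlast_move_last inner_scaleR_left
      by (metis (no_types, opaque_lifting) mult.assoc mult.left_commute)
  qed
  have inv: "invariant (Suc k) G"
    unfolding invariant_def G_def
    by (simp add: m_map_act C_act[OF L_C[OF \<phi>]] map_butlast[symmetric] C_act[OF L_C[OF \<psi>]] butlast_in
          rho_inner C_in[OF L_C[OF \<phi>]] C_in[OF L_C[OF \<psi>]])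
  have s: "orbit_summable (Suc k) G"
    using orbit_summable_add[OF L_summable[OF \<phi>] butlast_energy(2)[OF \<psi> k]]
  proof (rule orbit_summable_comparison)
    fix \<sigma> show "\<bar>G \<sigma>\<bar> \<le> energy \<phi> \<sigma> + m \<sigma> * (norm (\<psi> (butlast \<sigma>)))\<^sup>2"
      using abs_weighted_inner_le[of \<sigma> "\<phi> \<sigma>" "\<psi> (butlast \<sigma>)"] by (simp add: G_def abs_mult power_abs)
  qed
  have "ip (Suc k) \<phi> (d k \<psi>) = orbit_sum (Suc k) (\<lambda>\<sigma>. \<Sum>i\<le>Suc k. G (move_last i \<sigma>))"
    unfolding ip_def
    by (rule orbit_sum_cong) (simp add: d_apply inner_sum_right sum_distrib_left G del: sum.atMost_Suc)
  also have "\<dots> = (\<Sum>i\<le>Suc k. orbit_sum (Suc k) G)"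
    using orbit_sum_move_last[OF inv s] by (subst orbit_sum_sum) (auto simp del: sum.atMost_Suc)
  also have "\<dots> = real (k + 2) * orbit_sum k (\<lambda>\<tau>. \<Sum>v\<in>ext \<tau>. G (\<tau> @ [v]))"
    using unfold_last(2)[OF inv s] by (simp del: sum.atMost_Suc)
  also have "\<dots> = orbit_sum k (\<lambda>\<tau>. real (k + 2) * (\<Sum>v\<in>ext \<tau>. G (\<tau> @ [v])))"
    by (simp only: orbit_sum_cmult)
  also have "\<dots> = ip k (codiff k \<phi>) \<psi>"
    unfolding ip_def
  proof (rule orbit_sum_cong)
    fix \<tau> assume \<tau>: "\<tau> \<in> \<Sigma> k"
    have "(\<Sum>v\<in>ext \<tau>. G (\<tau> @ [v])) = (-1) ^ Suc k * inner (link_sum \<phi> \<tau>) (\<psi> \<tau>)"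
      by (simp add: G_def link_sum_def inner_sum_left sum_distrib_left)
    then show "real (k + 2) * (\<Sum>v\<in>ext \<tau>. G (\<tau> @ [v])) = m \<tau> * inner (codiff k \<phi> \<tau>) (\<psi> \<tau>)"
      using m_pos[OF \<tau>] \<tau> by (simp add: codiff_def)
  qed
  finally show ?thesis .
qed

end

section \<open>The cosine of a finite complex\<close>

lemma edges_sym: "(u, v) \<in> edges Y \<Longrightarrow> (v, u) \<in> edges Y"
  by (auto simp: edges_def insert_commute)

lemma edges_vertices: "(u, v) \<in> edges Y \<Longrightarrow> u \<in> vertices Y \<and> v \<in> vertices Y"
  by (auto simp: edges_def vertices_def)

lemma sum_edges:
  assumes "finite (vertices Y)"
  shows "(\<Sum>(u, v)\<in>edges Y. f u v) = (\<Sum>u\<in>vertices Y. \<Sum>v\<in>{v. (u, v) \<in> edges Y}. f u v)"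
proof -
  have "edges Y = Sigma (vertices Y) (\<lambda>u. {v. (u, v) \<in> edges Y})"
    using edges_vertices by fastforce
  moreover have "finite {v. (u, v) \<in> edges Y}" for u
    by (rule finite_subset[OF _ assms]) (use edges_vertices in fastforce)
  ultimately show ?thesis using assms by (metis (no_types) sum.Sigma)
qed

text \<open>
  Summation over neighbours multiplies the multiplicity of a vertex by the constant \<open>d\<close>. Hence constant
  functions are orthogonal to mean-zero functions for the edge form as well, and removing the mean
  from \<open>\<phi>\<close> lowers the edge sum exactly by the contribution of the mean.
\<close>

lemma cosine_numerator_eq:
  fixes \<phi> :: "'v \<Rightarrow> 'h::complex_hilbert"
  assumes fin: "finite (vertices Y)"
    and degree: "\<And>u. u \<in> vertices Y \<Longrightarrow>
      (\<Sum>v\<in>{v. (u, v) \<in> edges Y}. real (mult Y {u, v})) = d * real (mult Y {u})"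
  shows "Re (cosine_numerator Y \<phi>) =
    (\<Sum>(u, v)\<in>edges Y. real (mult Y {u, v}) * inner (\<phi> u) (\<phi> v))
    - d / (\<Sum>w\<in>vertices Y. real (mult Y {w})) * (norm (\<Sum>w\<in>vertices Y. real (mult Y {w}) *\<^sub>R \<phi> w))\<^sup>2"
proof -
  define M where "M = (\<Sum>w\<in>vertices Y. real (mult Y {w}))"
  define S where "S = (\<Sum>w\<in>vertices Y. real (mult Y {w}) *\<^sub>R \<phi> w)"
  define c where "c = (1 / M) *\<^sub>R S"
  let ?e = "\<lambda>u v. real (mult Y {u, v})"
  have one: "(\<Sum>(u, v)\<in>edges Y. ?e u v * inner (\<phi> u) c) = d * inner S c"
  proof -
    have "(\<Sum>(u, v)\<in>edges Y. ?e u v * inner (\<phi> u) c)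
        = (\<Sum>u\<in>vertices Y. (\<Sum>v\<in>{v. (u, v) \<in> edges Y}. ?e u v) * inner (\<phi> u) c)"
      by (simp add: sum_edges[OF fin] sum_distrib_right)
    also have "\<dots> = (\<Sum>u\<in>vertices Y. d * (real (mult Y {u}) * inner (\<phi> u) c))"
      by (intro sum.cong refl) (simp add: degree mult.assoc)
    also have "\<dots> = d * inner S c" by (simp add: S_def inner_sum_left sum_distrib_left)
    finally show ?thesis .
  qed
  have two: "(\<Sum>(u, v)\<in>edges Y. ?e u v * inner c (\<phi> v)) = d * inner S c"
    unfolding one[symmetric]
    by (rule sum.reindex_bij_witness[where i = prod.swap and j = prod.swap])
       (auto simp: insert_commute inner_commute edges_sym)
  have three: "(\<Sum>(u, v)\<in>edges Y. ?e u v * inner c c) = d * M * inner c c"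
    by (simp add: sum_edges[OF fin] sum_distrib_right[symmetric] degree M_def sum_distrib_left)
  have "Re (cosine_numerator Y \<phi>) = (\<Sum>(u, v)\<in>edges Y. ?e u v * inner (\<phi> u - c) (\<phi> v - c))"
    by (simp add: cosine_numerator_def nonconstant_part_def M_def S_def c_def case_prod_unfold Re_cinner)
  also have "\<dots> = (\<Sum>(u, v)\<in>edges Y. ?e u v * inner (\<phi> u) (\<phi> v))
      - (\<Sum>(u, v)\<in>edges Y. ?e u v * inner (\<phi> u) c) - (\<Sum>(u, v)\<in>edges Y. ?e u v * inner c (\<phi> v))
      + (\<Sum>(u, v)\<in>edges Y. ?e u v * inner c c)"
    by (simp add: case_prod_unfold inner_diff_left inner_diff_right algebra_simps sum.distrib sum_subtractf)
  also have "\<dots> = (\<Sum>(u, v)\<in>edges Y. ?e u v * inner (\<phi> u) (\<phi> v)) - 2 * (d * inner S c) + d * M * inner c c"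
    unfolding one two three by simp
  also have "\<dots> = (\<Sum>(u, v)\<in>edges Y. ?e u v * inner (\<phi> u) (\<phi> v)) - d / M * (norm S)\<^sup>2"
    by (cases "M = 0") (simp_all add: c_def power2_norm_eq_inner field_simps)
  finally show ?thesis by (simp only: M_def S_def)
qed

text \<open>
  The quotients defining the cosine are bounded above by 1, so each of them is at most the supremum.
  When the denominator vanishes, the same bound shows that the numerator is not positive.
\<close>

lemma cosine_bound:
  fixes \<phi> :: "'v \<Rightarrow> 'h::complex_hilbert"
  assumes fin: "finite (vertices Y)" and d: "0 \<le> d"
    and degree: "\<And>u. u \<in> vertices Y \<Longrightarrow>
      (\<Sum>v\<in>{v. (u, v) \<in> edges Y}. real (mult Y {u, v})) = d * real (mult Y {u})"
    and \<phi>: "\<phi> \<in> equivariant_0cochains Y \<Lambda> act H \<rho>"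
  shows "Re (cosine_numerator Y \<phi>) \<le> cosine Y \<Lambda> act H \<rho> * cosine_denominator Y \<phi>"
proof -
  have le: "Re (cosine_numerator Y \<psi>) \<le> cosine_denominator Y \<psi>" for \<psi> :: "'v \<Rightarrow> 'h"
  proof -
    have "Re (cosine_numerator Y \<psi>) \<le> (\<Sum>(u, v)\<in>edges Y. real (mult Y {u, v}) * inner (\<psi> u) (\<psi> v))"
      by (subst cosine_numerator_eq[OF fin degree]) (simp_all add: d sum_nonneg)
    also have "\<dots> \<le> cosine_denominator Y \<psi>"
      unfolding cosine_denominator_def
      by (intro sum_mono) (auto simp: mult.assoc intro!: mult_left_mono norm_cauchy_schwarz)
    finally show ?thesis .
  qed
  have nonneg: "0 \<le> cosine_denominator Y \<psi>" for \<psi> :: "'v \<Rightarrow> 'h"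
    unfolding cosine_denominator_def by (intro sum_nonneg) auto
  define Q where "Q = {Re (cosine_numerator Y \<phi>) / cosine_denominator Y \<phi> | \<phi>.
                 \<phi> \<in> equivariant_0cochains Y \<Lambda> act H \<rho> \<and> (\<exists>v\<in>vertices Y. \<phi> v \<noteq> 0) \<and>
                 cosine_denominator Y \<phi> \<noteq> 0}"
  have bdd: "bdd_above Q"
  proof (rule bdd_aboveI)
    fix x assume "x \<in> Q"
    then obtain \<psi> :: "'v \<Rightarrow> 'h" where x: "x = Re (cosine_numerator Y \<psi>) / cosine_denominator Y \<psi>" "cosine_denominator Y \<psi> \<noteq> 0"
      by (auto simp: Q_def)
    then have "0 < cosine_denominator Y \<psi>" using nonneg[of \<psi>] by simp
    then show "x \<le> 1" using le[of \<psi>] x by simp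
  qed
  show ?thesis
  proof (cases "cosine_denominator Y \<phi> = 0")
    case True
    then show ?thesis using le[of \<phi>] by simp
  next
    case False
    then have pos: "0 < cosine_denominator Y \<phi>" using nonneg[of \<phi>] by simp
    have "\<exists>v\<in>vertices Y. \<phi> v \<noteq> 0"
    proof (rule ccontr)
      assume z: "\<not> ?thesis"
      have "cosine_denominator Y \<phi> = 0"
        unfolding cosine_denominator_def
        by (rule sum.neutral) (use z edges_vertices in fastforce)
      with False show False by simp
    qed
    then have "Re (cosine_numerator Y \<phi>) / cosine_denominator Y \<phi> \<in> Q"
      unfolding Q_def using False \<phi> by blast
    moreover from this have "cosine Y \<Lambda> act H \<rho> = Sup Q"
      unfolding cosine_def Q_def[symmetric] Let_def by auto
    ultimately have "Re (cosine_numerator Y \<phi>) / cosine_denominator Y \<phi> \<le> cosine Y \<Lambda> act H \<rho>"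
      using cSup_upper[OF _ bdd] by simp
    then show ?thesis using pos by (simp add: pos_divide_le_eq)
  qed
qed

section \<open>Links\<close>

context complex_action
begin

abbreviation lk :: "'v list \<Rightarrow> 'v set set" where "lk \<tau> \<equiv> link X (set \<tau>)"

lemma mem_ext_set: "\<tau> \<in> \<Sigma> j \<Longrightarrow> v \<in> ext \<tau> \<longleftrightarrow> v \<notin> set \<tau> \<and> insert v (set \<tau>) \<in> X"
  by (auto simp: ext_def ordered_simplices_def)

lemma link_vertices:
  assumes \<tau>: "\<tau> \<in> \<Sigma> j"
  shows "vertices (lk \<tau>) = ext \<tau>"
proof (intro set_eqI iffI)
  fix v assume "v \<in> vertices (lk \<tau>)"
  then obtain t where t: "v \<in> t" "t \<inter> set \<tau> = {}" "set \<tau> \<union> t \<in> X"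
    by (auto simp: vertices_def link_def)
  then show "v \<in> ext \<tau>" unfolding mem_ext_set[OF \<tau>] by (auto intro: face_in[OF t(3)])
next
  fix v assume "v \<in> ext \<tau>"
  then have v: "v \<notin> set \<tau>" "insert v (set \<tau>) \<in> X" by (simp_all add: mem_ext_set[OF \<tau>])
  then have "{v} \<in> lk \<tau>" by (auto simp: link_def intro: face_in)
  then show "v \<in> vertices (lk \<tau>)" by (auto simp: vertices_def)
qed

lemma link_edges:
  assumes \<tau>: "\<tau> \<in> \<Sigma> j" and u: "u \<in> ext \<tau>"
  shows "{v. (u, v) \<in> edges (lk \<tau>)} = ext (\<tau> @ [u])"
proof -
  have \<tau>u: "\<tau> @ [u] \<in> \<Sigma> (Suc j)" using u mem_ext[OF \<tau>] by blast
  have "(u, v) \<in> edges (lk \<tau>) \<longleftrightarrow> v \<noteq> u \<and> v \<notin> set \<tau> \<and> insert v (insert u (set \<tau>)) \<in> X" for v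
    using u unfolding mem_ext_set[OF \<tau>] edges_def link_def
    by (auto simp: insert_commute intro: face_in)
  then show ?thesis unfolding set_eq_iff mem_Collect_eq mem_ext_set[OF \<tau>u] by auto
qed

lemma link_top:
  assumes \<tau>: "\<tau> \<in> \<Sigma> j" and j: "j < n"
  shows "top_simplices (lk \<tau>) = {t \<in> lk \<tau>. card t = n - j}"
proof -
  have c\<tau>: "card (set \<tau>) = Suc j" using \<tau> by (simp add: ordered_simplices_def distinct_card)
  have \<tau>X: "set \<tau> \<in> X" using \<tau> by (simp add: ordered_simplices_def)
  have "has_dimension (lk \<tau>) (n - Suc j)"
    unfolding has_dimension_def
  proof (intro conjI ballI)
    fix t assume t: "t \<in> lk \<tau>"
    then have "card (set \<tau> \<union> t) = Suc j + card t"
      using c\<tau> finite_simplex by (subst card_Un_disjoint) (auto simp: link_def)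
    moreover have "card (set \<tau> \<union> t) \<le> Suc n" using t dim by (auto simp: link_def has_dimension_def)
    ultimately show "card t \<le> Suc (n - Suc j)" using j by simp
  next
    obtain t where t: "t \<in> X" "set \<tau> \<subseteq> t" "card t = Suc n" using pure \<tau>X by blast
    have "card (t - set \<tau>) = n - j" using t c\<tau> by (subst card_Diff_subset) auto
    moreover from this have "t - set \<tau> \<in> lk \<tau>"
      using t j by (auto simp: link_def Un_absorb1 intro!: face_in[OF t(1)])
    ultimately show "\<exists>s\<in>lk \<tau>. card s = Suc (n - Suc j)"
      using j by (intro bexI[of _ "t - set \<tau>"]) (simp_all add: Suc_diff_Suc)
  qed
  from top_simplices_eq[OF this] show ?thesis using j by (simp add: Suc_diff_Suc)
qed

text \<open>
  The top-dimensional simplices of the link of \<open>\<tau>\<close> are the \<open>n\<close>-simplices containing \<open>\<tau>\<close>, with \<open>\<tau>\<close> removed.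
\<close>

lemma link_mult:
  assumes \<tau>: "\<tau> \<in> \<Sigma> j" and j: "j < n" and s: "s \<inter> set \<tau> = {}"
  shows "mult (lk \<tau>) s = mult X (set \<tau> \<union> s)"
proof -
  have c\<tau>: "card (set \<tau>) = Suc j" using \<tau> by (simp add: ordered_simplices_def distinct_card)
  have "bij_betw (\<lambda>t. set \<tau> \<union> t) {t \<in> top_simplices (lk \<tau>). s \<subseteq> t} {t \<in> top_simplices X. set \<tau> \<union> s \<subseteq> t}"
  proof (rule bij_betwI[where g = "\<lambda>t. t - set \<tau>"])
    show "(\<lambda>t. set \<tau> \<union> t) \<in> {t \<in> top_simplices (lk \<tau>). s \<subseteq> t} \<rightarrow> {t \<in> top_simplices X. set \<tau> \<union> s \<subseteq> t}"
    proof (rule Pi_I)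
      fix t assume "t \<in> {t \<in> top_simplices (lk \<tau>). s \<subseteq> t}"
      then have t: "t \<in> X" "t \<inter> set \<tau> = {}" "set \<tau> \<union> t \<in> X" "card t = n - j" "s \<subseteq> t"
        unfolding link_top[OF \<tau> j] by (auto simp: link_def)
      have "card (set \<tau> \<union> t) = Suc n"
        using t c\<tau> finite_simplex[OF t(1)] j by (subst card_Un_disjoint) auto
      then show "set \<tau> \<union> t \<in> {t \<in> top_simplices X. set \<tau> \<union> s \<subseteq> t}" using t by (auto simp: top_eq)
    qed
    show "(\<lambda>t. t - set \<tau>) \<in> {t \<in> top_simplices X. set \<tau> \<union> s \<subseteq> t} \<rightarrow> {t \<in> top_simplices (lk \<tau>). s \<subseteq> t}"
    proof (rule Pi_I)
      fix t assume "t \<in> {t \<in> top_simplices X. set \<tau> \<union> s \<subseteq> t}"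
      then have t: "t \<in> X" "card t = Suc n" "set \<tau> \<subseteq> t" "s \<subseteq> t" by (auto simp: top_eq)
      have card: "card (t - set \<tau>) = n - j" using t c\<tau> by (subst card_Diff_subset) auto
      have "t - set \<tau> \<noteq> {}"
      proof
        assume "t - set \<tau> = {}"
        then have "card (t - set \<tau>) = 0" by (simp only: card.empty)
        then show False using card j by linarith
      qed
      then have "t - set \<tau> \<in> X" using t by (intro face_in[OF t(1)]) auto
      then show "t - set \<tau> \<in> {t \<in> top_simplices (lk \<tau>). s \<subseteq> t}"
        unfolding link_top[OF \<tau> j] using t s card by (auto simp: link_def Un_absorb1)
    qed
  next
    fix t assume "t \<in> {t \<in> top_simplices (lk \<tau>). s \<subseteq> t}"
    then have "t \<in> lk \<tau>" unfolding link_top[OF \<tau> j] by blast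
    then show "set \<tau> \<union> t - set \<tau> = t" by (auto simp: link_def)
  qed auto
  then show ?thesis unfolding mult_def by (rule bij_betw_same_card)
qed

lemma link_mult_vertex:
  "\<tau> \<in> \<Sigma> j \<Longrightarrow> j < n \<Longrightarrow> u \<in> ext \<tau> \<Longrightarrow> real (mult (lk \<tau>) {u}) = m (\<tau> @ [u])"
  by (simp add: link_mult m_def mem_ext_set)

lemma link_mult_edge:
  assumes \<tau>: "\<tau> \<in> \<Sigma> j" "j < n" and u: "u \<in> ext \<tau>" and v: "v \<in> ext (\<tau> @ [u])"
  shows "real (mult (lk \<tau>) {u, v}) = m (\<tau> @ [u, v])"
proof -
  have "\<tau> @ [u] \<in> \<Sigma> (Suc j)" using u mem_ext[OF \<tau>(1)] by blast
  then have "{u, v} \<inter> set \<tau> = {}" using u v \<tau> by (auto simp: mem_ext_set)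
  then show ?thesis using link_mult[OF \<tau>] by (simp add: m_def)
qed

lemma link_sum_edges:
  assumes \<tau>: "\<tau> \<in> \<Sigma> j" "j < n"
  shows "(\<Sum>(u, v)\<in>edges (lk \<tau>). real (mult (lk \<tau>) {u, v}) * f u v)
     = (\<Sum>u\<in>ext \<tau>. \<Sum>v\<in>ext (\<tau> @ [u]). m (\<tau> @ [u, v]) * f u v)"
proof -
  have "finite (vertices (lk \<tau>))" using finite_ext[OF \<tau>(1)] by (simp add: link_vertices[OF \<tau>(1)])
  then show ?thesis
    by (simp add: sum_edges link_vertices[OF \<tau>(1)] link_edges[OF \<tau>(1)] link_mult_edge[OF \<tau>])
qed

lemma link_degree:
  assumes \<tau>: "\<tau> \<in> \<Sigma> j" "j < n" and u: "u \<in> vertices (lk \<tau>)"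
  shows "(\<Sum>v\<in>{v. (u, v) \<in> edges (lk \<tau>)}. real (mult (lk \<tau>) {u, v}))
     = real (n - Suc j) * real (mult (lk \<tau>) {u})"
proof -
  have u': "u \<in> ext \<tau>" using u by (simp add: link_vertices[OF \<tau>(1)])
  then have "\<tau> @ [u] \<in> \<Sigma> (Suc j)" using mem_ext[OF \<tau>(1)] by blast
  from sum_m_ext[OF this] show ?thesis
    using \<tau>(2) by (simp add: link_edges[OF \<tau>(1) u'] link_mult_edge[OF \<tau> u'] link_mult_vertex[OF \<tau> u'])
qed

end

context equivariant_cochains
begin

definition link_cosine :: "'v list \<Rightarrow> real" where
  "link_cosine \<tau> = cosine (lk \<tau>) (stab act \<tau>) act H \<rho>"

definition link_cochains :: "'v list \<Rightarrow> ('v \<Rightarrow> 'h) set" where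
  "link_cochains \<tau> = equivariant_0cochains (lk \<tau>) (stab act \<tau>) act H \<rho>"

lemma link_cochains_iff:
  "\<tau> \<in> \<Sigma> j \<Longrightarrow> f \<in> link_cochains \<tau> \<longleftrightarrow>
     (\<forall>v\<in>ext \<tau>. f v \<in> H \<and> (\<forall>g\<in>stab act \<tau>. f (act g v) = \<rho> g (f v)))"
  by (simp add: link_cochains_def equivariant_0cochains_def link_vertices)

lemma link_numerator:
  assumes \<tau>: "\<tau> \<in> \<Sigma> j" "j < n"
  shows "Re (cosine_numerator (lk \<tau>) f) =
     (\<Sum>u\<in>ext \<tau>. \<Sum>v\<in>ext (\<tau> @ [u]). m (\<tau> @ [u, v]) * inner (f u) (f v))
     - real (n - Suc j) / (real (n - j) * m \<tau>) * (norm (\<Sum>v\<in>ext \<tau>. m (\<tau> @ [v]) *\<^sub>R f v))\<^sup>2"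
proof -
  have fin: "finite (vertices (lk \<tau>))" using finite_ext[OF \<tau>(1)] by (simp add: link_vertices[OF \<tau>(1)])
  have "Re (cosine_numerator (lk \<tau>) f) =
     (\<Sum>(u, v)\<in>edges (lk \<tau>). real (mult (lk \<tau>) {u, v}) * inner (f u) (f v))
     - real (n - Suc j) / (\<Sum>w\<in>ext \<tau>. m (\<tau> @ [w])) * (norm (\<Sum>w\<in>ext \<tau>. m (\<tau> @ [w]) *\<^sub>R f w))\<^sup>2"
    by (subst cosine_numerator_eq[OF fin link_degree[OF \<tau>]])
       (simp_all add: link_vertices[OF \<tau>(1)] link_mult_vertex[OF \<tau>] cong: sum.cong)
  then show ?thesis
    using sum_m_ext[OF \<tau>(1)] \<tau>(2) by (simp only: link_sum_edges[OF \<tau>])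
qed

lemma link_denominator:
  assumes \<tau>: "\<tau> \<in> \<Sigma> j" "j < n"
  shows "cosine_denominator (lk \<tau>) f =
     (\<Sum>u\<in>ext \<tau>. \<Sum>v\<in>ext (\<tau> @ [u]). m (\<tau> @ [u, v]) * (norm (f u) * norm (f v)))"
  unfolding cosine_denominator_def mult.assoc by (rule link_sum_edges[OF \<tau>])

text \<open>
  An element \<open>g\<close> carries the link of \<open>\<tau>\<close> to the link of \<open>g \<tau>\<close>, and \<open>f \<mapsto> \<rho> g \<circ> f \<circ> g\<^sup>-\<^sup>1\<close> maps equivariant
  functions on the one to equivariant functions on the other; as \<open>\<rho> g\<close> is unitary, numerator and
  denominator are preserved. So the set of quotients for \<open>\<tau>\<close> is contained in the one for \<open>g \<tau>\<close>, and
  equality follows by applying this to \<open>- g\<close>.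
\<close>

lemma link_cosine_map_act:
  assumes \<tau>: "\<tau> \<in> \<Sigma> j" "j < n"
  shows "link_cosine (map (act g) \<tau>) = link_cosine \<tau>"
proof -
  define Q where "Q \<tau> = {Re (cosine_numerator (lk \<tau>) f) / cosine_denominator (lk \<tau>) f | f.
       f \<in> link_cochains \<tau> \<and> (\<exists>v\<in>ext \<tau>. f v \<noteq> 0) \<and> cosine_denominator (lk \<tau>) f \<noteq> 0}" for \<tau>
  have link_cosine: "link_cosine \<tau> = (if Q \<tau> = {} then 0 else Sup (Q \<tau>))" if "\<tau> \<in> \<Sigma> j" for \<tau>
    unfolding link_cosine_def cosine_def Q_def link_cochains_def Let_def link_vertices[OF that] ..
  have sub: "Q \<tau> \<subseteq> Q (map (act g) \<tau>)" if \<tau>j: "\<tau> \<in> \<Sigma> j" for \<tau> g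
  proof
    fix x assume "x \<in> Q \<tau>"
    then obtain f where x: "x = Re (cosine_numerator (lk \<tau>) f) / cosine_denominator (lk \<tau>) f"
      and f: "f \<in> link_cochains \<tau>" "\<exists>v\<in>ext \<tau>. f v \<noteq> 0" "cosine_denominator (lk \<tau>) f \<noteq> 0"
      by (auto simp: Q_def)
    define f' where "f' v = \<rho> g (f (act (- g) v))" for v
    note g\<tau> = map_act_in[OF \<tau>j, of g]
    have vert: "v \<in> vertices X" if "v \<in> ext \<sigma>" "\<sigma> \<in> \<Sigma> i" for v \<sigma> i
      using simplex_vertices[of "\<sigma> @ [v]" "Suc i"] that by (simp add: mem_ext)
    have fH: "f v \<in> H" if "v \<in> ext \<tau>" for v
      using f(1) that unfolding link_cochains_iff[OF \<tau>j] by blast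
    have f': "f' (act g v) = \<rho> g (f v)" if "v \<in> ext \<tau>" for v
      by (simp add: f'_def act_minus[OF vert[OF that \<tau>j]])
    have ext_u: "ext (\<tau> @ [u]) \<subseteq> ext \<tau>" if "u \<in> ext \<tau>" for u
    proof
      fix v assume v: "v \<in> ext (\<tau> @ [u])"
      have \<tau>u: "\<tau> @ [u] \<in> \<Sigma> (Suc j)" using that mem_ext[OF \<tau>j] by blast
      from v have "v \<notin> set \<tau>" "insert v (insert u (set \<tau>)) \<in> X"
        unfolding mem_ext_set[OF \<tau>u] by auto
      then show "v \<in> ext \<tau>" unfolding mem_ext_set[OF \<tau>j] by (auto intro: face_in)
    qed
    have double: "(\<Sum>u\<in>ext (map (act g) \<tau>). \<Sum>v\<in>ext (map (act g) \<tau> @ [u]). m (map (act g) \<tau> @ [u, v]) * F (f' u) (f' v))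
        = (\<Sum>u\<in>ext \<tau>. \<Sum>v\<in>ext (\<tau> @ [u]). m (\<tau> @ [u, v]) * F (f u) (f v))"
      if F: "\<And>x y. x \<in> H \<Longrightarrow> y \<in> H \<Longrightarrow> F (\<rho> g x) (\<rho> g y) = F x y" for F :: "'h \<Rightarrow> 'h \<Rightarrow> real"
    proof (subst sum.reindex_bij_betw[OF ext_act[OF \<tau>j], symmetric], rule sum.cong[OF refl])
      fix u assume u: "u \<in> ext \<tau>"
      then have \<tau>u: "\<tau> @ [u] \<in> \<Sigma> (Suc j)" using mem_ext[OF \<tau>j] by blast
      have bij: "bij_betw (act g) (ext (\<tau> @ [u])) (ext (map (act g) \<tau> @ [act g u]))"
        using ext_act[OF \<tau>u, of g] by simp
      show "(\<Sum>v\<in>ext (map (act g) \<tau> @ [act g u]). m (map (act g) \<tau> @ [act g u, v]) * F (f' (act g u)) (f' v))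
          = (\<Sum>v\<in>ext (\<tau> @ [u]). m (\<tau> @ [u, v]) * F (f u) (f v))"
      proof (subst sum.reindex_bij_betw[OF bij, symmetric], rule sum.cong[OF refl])
        fix v assume v: "v \<in> ext (\<tau> @ [u])"
        then have "\<tau> @ [u, v] \<in> \<Sigma> (Suc (Suc j))" using mem_ext[OF \<tau>u] by simp
        from m_map_act[OF this, of g]
        have "m (map (act g) \<tau> @ [act g u, act g v]) = m (\<tau> @ [u, v])" by simp
        moreover have "v \<in> ext \<tau>" using v ext_u[OF u] by blast
        ultimately show "m (map (act g) \<tau> @ [act g u, act g v]) * F (f' (act g u)) (f' (act g v))
            = m (\<tau> @ [u, v]) * F (f u) (f v)"
          using u F fH by (simp add: f')
      qed
    qed
    have "(\<Sum>v\<in>ext (map (act g) \<tau>). m (map (act g) \<tau> @ [v]) *\<^sub>R f' v)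
        = (\<Sum>v\<in>ext \<tau>. m (map (act g) \<tau> @ [act g v]) *\<^sub>R f' (act g v))"
      by (rule sum.reindex_bij_betw[OF ext_act[OF \<tau>j], symmetric])
    also have "\<dots> = (\<Sum>v\<in>ext \<tau>. \<rho> g (m (\<tau> @ [v]) *\<^sub>R f v))"
    proof (intro sum.cong refl)
      fix v assume v: "v \<in> ext \<tau>"
      then have "\<tau> @ [v] \<in> \<Sigma> (Suc j)" using mem_ext[OF \<tau>j] by blast
      from m_map_act[OF this, of g]
      show "m (map (act g) \<tau> @ [act g v]) *\<^sub>R f' (act g v) = \<rho> g (m (\<tau> @ [v]) *\<^sub>R f v)"
        using v by (simp add: f' rho_scaleR fH)
    qed
    also have "\<dots> = \<rho> g (\<Sum>v\<in>ext \<tau>. m (\<tau> @ [v]) *\<^sub>R f v)"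
      by (rule rho_sum[symmetric]) (intro H_scaleR fH)
    finally have S: "norm (\<Sum>v\<in>ext (map (act g) \<tau>). m (map (act g) \<tau> @ [v]) *\<^sub>R f' v)
        = norm (\<Sum>v\<in>ext \<tau>. m (\<tau> @ [v]) *\<^sub>R f v)"
      by (simp only:) (intro rho_norm H_sum H_scaleR fH)
    have num: "Re (cosine_numerator (lk (map (act g) \<tau>)) f') = Re (cosine_numerator (lk \<tau>) f)"
      unfolding link_numerator[OF g\<tau> \<tau>(2)] link_numerator[OF \<tau>j \<tau>(2)] S m_map_act[OF \<tau>j]
      by (subst double) (simp_all add: rho_inner)
    have den: "cosine_denominator (lk (map (act g) \<tau>)) f' = cosine_denominator (lk \<tau>) f"
      unfolding link_denominator[OF g\<tau> \<tau>(2)] link_denominator[OF \<tau>j \<tau>(2)]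
      by (subst double) (simp_all add: rho_norm)
    have pull: "act (- g) v \<in> ext \<tau> \<and> act g (act (- g) v) = v" if "v \<in> ext (map (act g) \<tau>)" for v
      using ext_act[OF g\<tau>, of "- g"] that act_minus[OF vert[OF that g\<tau>], of "- g"]
      unfolding map_act_minus[OF \<tau>j] by (auto simp: bij_betw_def)
    have "f' \<in> link_cochains (map (act g) \<tau>)"
      unfolding link_cochains_iff[OF g\<tau>]
    proof (intro ballI conjI)
      fix v assume v: "v \<in> ext (map (act g) \<tau>)"
      then show "f' v \<in> H" using pull[OF v] fH by (simp add: f'_def rho_in)
      fix h assume "h \<in> stab act (map (act g) \<tau>)"
      then obtain h' where h': "h' \<in> stab act \<tau>" "h = g + h' + - g"
        unfolding stab_map_act[OF \<tau>j] by blast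
      define w where "w = act (- g) v"
      have w: "w \<in> ext \<tau>" "act g w = v" using pull[OF v] by (simp_all add: w_def)
      have hw: "act h' w \<in> ext \<tau>"
      proof -
        have "map (act h') \<tau> = \<tau>" using h'(1) by (simp add: mem_stab)
        then show ?thesis using ext_act[OF \<tau>j, of h'] w(1) by (auto simp: bij_betw_def)
      qed
      have "act h v = act g (act h' w)"
        unfolding h'(2) w_def
        using vert[OF v g\<tau>] vert[OF w(1) \<tau>j] vert[OF hw \<tau>j]
        by (simp only: act_add w_def)
      then have "f' (act h v) = \<rho> g (f (act h' w))" using f'[OF hw] by simp
      also have "f (act h' w) = \<rho> h' (f w)"
        using f(1) h'(1) w(1) unfolding link_cochains_iff[OF \<tau>j] by blast
      also have "\<rho> g (\<rho> h' (f w)) = \<rho> (g + h') (f w)" by (rule rho_plus[symmetric, OF fH[OF w(1)]])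
      also have "g + h' = h + g" by (simp add: h'(2) add.assoc)
      also have "\<rho> (h + g) (f w) = \<rho> h (f' v)"
        using rho_plus[OF fH[OF w(1)]] by (simp add: f'_def w_def)
      finally show "f' (act h v) = \<rho> h (f' v)" .
    qed
    moreover have "\<exists>v\<in>ext (map (act g) \<tau>). f' v \<noteq> 0"
    proof -
      from f(2) obtain v where v: "v \<in> ext \<tau>" "f v \<noteq> 0" by blast
      then have "norm (f' (act g v)) \<noteq> 0" by (simp add: f' rho_norm fH)
      moreover have "act g v \<in> ext (map (act g) \<tau>)" using ext_act[OF \<tau>j, of g] v by (auto simp: bij_betw_def)
      ultimately show ?thesis by (metis norm_zero)
    qed
    ultimately show "x \<in> Q (map (act g) \<tau>)"
      using f(3) unfolding Q_def x num[symmetric] den[symmetric] by blast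
  qed
  have "Q (map (act g) \<tau>) = Q \<tau>"
    using sub[OF \<tau>(1), of g] sub[OF map_act_in[OF \<tau>(1), of g], of "- g"]
    unfolding map_act_minus[OF \<tau>(1)] by blast
  then show ?thesis using link_cosine[OF \<tau>(1)] link_cosine[OF map_act_in[OF \<tau>(1)]] by simp
qed

text \<open>
  The definition of the cosine, applied to \<open>v \<mapsto> \<phi> (\<tau> v)\<close>, whose mean is given by \<open>codiff j \<phi> \<tau>\<close>. The
  exact coefficient of the squared mean is smaller than the one contained in \<open>codiff\<close>.
\<close>

lemma link_inequality:
  assumes \<phi>: "\<phi> \<in> C (Suc j)" and \<tau>: "\<tau> \<in> \<Sigma> j" "j < n"
  shows "(\<Sum>u\<in>ext \<tau>. \<Sum>v\<in>ext (\<tau> @ [u]). m (\<tau> @ [u, v]) *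
            (inner (\<phi> (\<tau> @ [u])) (\<phi> (\<tau> @ [v])) - link_cosine \<tau> * (norm (\<phi> (\<tau> @ [u])) * norm (\<phi> (\<tau> @ [v])))))
         \<le> energy (codiff j \<phi>) \<tau>"
proof -
  let ?f = "\<lambda>v. \<phi> (\<tau> @ [v])"
  have fin: "finite (vertices (lk \<tau>))" using finite_ext[OF \<tau>(1)] by (simp add: link_vertices[OF \<tau>(1)])
  have "?f \<in> link_cochains \<tau>"
    unfolding link_cochains_iff[OF \<tau>(1)]
  proof (intro ballI conjI)
    fix v g assume "v \<in> ext \<tau>" and g: "g \<in> stab act \<tau>"
    then have "\<tau> @ [v] \<in> \<Sigma> (Suc j)" using mem_ext[OF \<tau>(1)] by blast
    from C_act[OF \<phi> this, of g] show "\<phi> (\<tau> @ [act g v]) = \<rho> g (\<phi> (\<tau> @ [v]))"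
      using g by (simp add: mem_stab)
  qed (rule C_in[OF \<phi>])
  then have "Re (cosine_numerator (lk \<tau>) ?f) \<le> link_cosine \<tau> * cosine_denominator (lk \<tau>) ?f"
    unfolding link_cosine_def link_cochains_def by (intro cosine_bound[OF fin _ link_degree[OF \<tau>]]) auto
  then have "(\<Sum>u\<in>ext \<tau>. \<Sum>v\<in>ext (\<tau> @ [u]). m (\<tau> @ [u, v]) *
            (inner (?f u) (?f v) - link_cosine \<tau> * (norm (?f u) * norm (?f v))))
      \<le> real (n - Suc j) / (real (n - j) * m \<tau>) * (norm (link_sum \<phi> \<tau>))\<^sup>2"
    unfolding link_numerator[OF \<tau>] link_denominator[OF \<tau>] link_sum_def
    by (simp add: right_diff_distrib sum_subtractf sum_distrib_left mult.left_commute)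
  also have "\<dots> \<le> (real (j + 2))\<^sup>2 / m \<tau> * (norm (link_sum \<phi> \<tau>))\<^sup>2"
  proof (rule mult_right_mono)
    have "real (n - Suc j) \<le> (real (j + 2))\<^sup>2 * real (n - j)"
      using mult_mono[of 1 "(real (j + 2))\<^sup>2" "real (n - Suc j)" "real (n - j)"] by (simp add: one_le_power)
    then show "real (n - Suc j) / (real (n - j) * m \<tau>) \<le> (real (j + 2))\<^sup>2 / m \<tau>"
      using m_pos[OF \<tau>(1)] \<tau>(2) by (simp add: divide_simps mult_ac)
  qed simp
  also have "\<dots> = energy (codiff j \<phi>) \<tau>"
    using m_pos[OF \<tau>(1)] \<tau>(1)
    by (simp add: codiff_def power_mult_distrib power_divide power2_eq_square)
  finally show ?thesis .
qed

end

section \<open>The spectral gap\<close>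

text \<open>
  Evaluate the form at the sum and at the difference of the unit vectors of \<open>a\<close> and \<open>b\<close>.
\<close>

lemma positive_definite_off_diagonal:
  assumes pd: "positive_definite_on I A" and fin: "finite I"
    and I: "a \<in> I" "b \<in> I" "a \<noteq> b" and diag: "A a a = 1" "A b b = 1"
  shows "\<bar>A a b\<bar> < 1"
proof -
  have sym: "A b a = A a b" using pd I by (simp add: positive_definite_on_def)
  have "0 < 1 + t\<^sup>2 + 2 * t * A a b" for t
  proof -
    define x where "x = (\<lambda>\<alpha>. if \<alpha> = a then 1 else if \<alpha> = b then t else 0)"
    have "\<exists>\<alpha>\<in>I. x \<alpha> \<noteq> 0" using I(1) by (auto simp: x_def)
    then have "0 < (\<Sum>\<alpha>\<in>I. \<Sum>\<beta>\<in>I. x \<alpha> * A \<alpha> \<beta> * x \<beta>)"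
      using pd unfolding positive_definite_on_def by blast
    also have "\<dots> = (\<Sum>\<alpha>\<in>{a, b}. \<Sum>\<beta>\<in>{a, b}. x \<alpha> * A \<alpha> \<beta> * x \<beta>)"
    proof -
      have "(\<Sum>\<beta>\<in>I. x \<alpha> * A \<alpha> \<beta> * x \<beta>) = (\<Sum>\<beta>\<in>{a, b}. x \<alpha> * A \<alpha> \<beta> * x \<beta>)" for \<alpha>
        using I by (intro sum.mono_neutral_right fin) (auto simp: x_def)
      moreover have "(\<Sum>\<alpha>\<in>I. \<Sum>\<beta>\<in>{a, b}. x \<alpha> * A \<alpha> \<beta> * x \<beta>) = (\<Sum>\<alpha>\<in>{a, b}. \<Sum>\<beta>\<in>{a, b}. x \<alpha> * A \<alpha> \<beta> * x \<beta>)"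
        using I by (intro sum.mono_neutral_right fin) (auto simp: x_def)
      ultimately show ?thesis by simp
    qed
    also have "\<dots> = 1 + t\<^sup>2 + 2 * t * A a b"
      using I(3) by (simp add: x_def diag sym power2_eq_square)
    finally show ?thesis .
  qed
  from this[of 1] this[of "-1"] show ?thesis by simp
qed

context equivariant_cochains
begin

abbreviation A :: "'v list \<Rightarrow> 'v list \<Rightarrow> real" where "A \<equiv> cosine_matrix X act H \<rho>"

lemma
  assumes \<gamma>: "\<gamma> \<in> \<Sigma> (Suc k)"
  shows faces_eq: "faces X k \<gamma> = (\<lambda>i. delete_nth i \<gamma>) ` {..Suc k}"
    and inj_faces: "inj_on (\<lambda>i. delete_nth i \<gamma>) {..Suc k}"
proof -
  have len: "length \<gamma> = Suc (Suc k)" and dist: "distinct \<gamma>"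
    using \<gamma> by (simp_all add: ordered_simplices_def)
  show "faces X k \<gamma> = (\<lambda>i. delete_nth i \<gamma>) ` {..Suc k}"
  proof (intro set_eqI iffI)
    fix \<sigma> assume \<sigma>: "\<sigma> \<in> faces X k \<gamma>"
    then have "subseq \<sigma> \<gamma>" "length \<sigma> = Suc k" by (auto simp: faces_def ordered_simplices_def)
    then obtain i where "i < length \<gamma>" "\<sigma> = delete_nth i \<gamma>"
      using subseq_imp_delete_nth[of \<sigma> \<gamma>] len by auto
    then show "\<sigma> \<in> (\<lambda>i. delete_nth i \<gamma>) ` {..Suc k}" using len by auto
  next
    fix \<sigma> assume "\<sigma> \<in> (\<lambda>i. delete_nth i \<gamma>) ` {..Suc k}"
    then show "\<sigma> \<in> faces X k \<gamma>"
      using delete_nth_in[OF \<gamma>] subseq_delete_nth[of _ \<gamma>] by (auto simp: faces_def)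
  qed
  show "inj_on (\<lambda>i. delete_nth i \<gamma>) {..Suc k}"
  proof (rule inj_onI)
    fix i l assume il: "i \<in> {..Suc k}" "l \<in> {..Suc k}" "delete_nth i \<gamma> = delete_nth l \<gamma>"
    then have "set \<gamma> - {\<gamma> ! i} = set \<gamma> - {\<gamma> ! l}"
      using set_delete_nth[OF dist, of i] set_delete_nth[OF dist, of l] len by auto
    moreover have "\<gamma> ! i \<in> set \<gamma>" "\<gamma> ! l \<in> set \<gamma>" using il len by auto
    ultimately have "\<gamma> ! i = \<gamma> ! l" by blast
    then show "i = l" using il len nth_eq_iff_index_eq[OF dist, of i l] by simp
  qed
qed

lemma meet_faces:
  assumes \<gamma>: "\<gamma> \<in> \<Sigma> (Suc k)" and i: "i \<le> Suc k" and l: "l \<le> k"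
  shows "meet (delete_nth i \<gamma>) (delete_nth (skip i l) \<gamma>) = delete_nth l (delete_nth i \<gamma>)"
proof -
  have len: "length \<gamma> = Suc (Suc k)" and dist: "distinct \<gamma>"
    using \<gamma> by (simp_all add: ordered_simplices_def)
  have "set (delete_nth (skip i l) \<gamma>) = set \<gamma> - {\<gamma> ! skip i l}"
    using set_delete_nth[OF dist] skip_bounds(1)[OF i l] len by simp
  moreover have "set (delete_nth i \<gamma>) \<subseteq> set \<gamma>" using set_delete_nth[OF dist, of i] i len by auto
  ultimately have "meet (delete_nth i \<gamma>) (delete_nth (skip i l) \<gamma>) = filter (\<lambda>v. v \<noteq> \<gamma> ! skip i l) (delete_nth i \<gamma>)"
    unfolding meet_def by (intro filter_cong) auto
  also have "\<gamma> ! skip i l = delete_nth i \<gamma> ! l" using i l len by (simp add: nth_delete_nth)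
  also have "filter (\<lambda>v. v \<noteq> delete_nth i \<gamma> ! l) (delete_nth i \<gamma>) = delete_nth l (delete_nth i \<gamma>)"
    using dist i l len by (intro delete_nth_eq_filter[symmetric] distinct_delete_nth) auto
  finally show ?thesis .
qed

lemma cosine_matrix_entry:
  assumes \<gamma>: "\<gamma> \<in> \<Sigma> (Suc k)" and i: "i \<le> Suc k" and l: "l \<le> k"
  shows "A (delete_nth i \<gamma>) (delete_nth (skip i l) \<gamma>) = - link_cosine (delete_nth l (delete_nth i \<gamma>))"
proof -
  have "delete_nth i \<gamma> \<noteq> delete_nth (skip i l) \<gamma>"
    using inj_onD[OF inj_faces[OF \<gamma>], of i "skip i l"] i skip_bounds[OF i l] by auto
  then show ?thesis by (simp add: cosine_matrix_def link_cosine_def meet_faces[OF assms])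
qed

lemma cosine_matrix_form:
  assumes \<gamma>: "\<gamma> \<in> \<Sigma> (Suc k)"
  shows "(\<Sum>\<alpha>\<in>faces X k \<gamma>. \<Sum>\<beta>\<in>faces X k \<gamma>. x \<alpha> * A \<alpha> \<beta> * x \<beta>) =
    (\<Sum>i\<le>Suc k. (x (delete_nth i \<gamma>))\<^sup>2 - (\<Sum>l\<le>k. link_cosine (delete_nth l (delete_nth i \<gamma>)) *
        (x (delete_nth i \<gamma>) * x (delete_nth (skip i l) \<gamma>))))"
proof -
  let ?D = "\<lambda>i. delete_nth i \<gamma>"
  have "(\<Sum>\<alpha>\<in>faces X k \<gamma>. \<Sum>\<beta>\<in>faces X k \<gamma>. x \<alpha> * A \<alpha> \<beta> * x \<beta>)
      = (\<Sum>i\<le>Suc k. \<Sum>s\<le>Suc k. x (?D i) * A (?D i) (?D s) * x (?D s))"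
    unfolding faces_eq[OF \<gamma>] by (simp only: sum.reindex[OF inj_faces[OF \<gamma>]] o_def)
  also have "\<dots> = (\<Sum>i\<le>Suc k. (x (?D i))\<^sup>2 - (\<Sum>l\<le>k. link_cosine (delete_nth l (?D i)) * (x (?D i) * x (?D (skip i l)))))"
  proof (rule sum.cong[OF refl])
    fix i assume "i \<in> {..Suc k}"
    then have i: "i \<le> Suc k" by simp
    have "(\<Sum>s\<le>Suc k. x (?D i) * A (?D i) (?D s) * x (?D s))
        = x (?D i) * A (?D i) (?D i) * x (?D i) + (\<Sum>l\<le>k. x (?D i) * A (?D i) (?D (skip i l)) * x (?D (skip i l)))"
      by (rule sum_split_skip[OF i])
    also have "(\<Sum>l\<le>k. x (?D i) * A (?D i) (?D (skip i l)) * x (?D (skip i l)))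
        = (\<Sum>l\<le>k. - (link_cosine (delete_nth l (?D i)) * (x (?D i) * x (?D (skip i l)))))"
      by (rule sum.cong[OF refl]) (simp add: cosine_matrix_entry[OF \<gamma> i])
    finally show "(\<Sum>s\<le>Suc k. x (?D i) * A (?D i) (?D s) * x (?D s))
        = (x (?D i))\<^sup>2 - (\<Sum>l\<le>k. link_cosine (delete_nth l (?D i)) * (x (?D i) * x (?D (skip i l))))"
      by (simp add: sum_negf cosine_matrix_def[of _ _ _ _ "?D i" "?D i"] power2_eq_square)
  qed
  finally show ?thesis .
qed

text \<open>
  For \<open>\<gamma> = \<tau> u v\<close> this is the edge term of \<open>link_inequality\<close>: the difference of the inner product of
  \<open>\<phi> (\<tau> u)\<close> and \<open>\<phi> (\<tau> v)\<close> and its bound by means of the cosine of the link of \<open>\<tau>\<close>.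
\<close>

definition gap_density :: "nat \<Rightarrow> ('v list \<Rightarrow> 'h) \<Rightarrow> 'v list \<Rightarrow> real" where
  "gap_density k \<phi> \<gamma> = m \<gamma> * (inner (\<phi> (butlast \<gamma>)) (\<phi> (delete_nth k \<gamma>))
     - link_cosine (butlast (butlast \<gamma>)) * (norm (\<phi> (butlast \<gamma>)) * norm (\<phi> (delete_nth k \<gamma>))))"

text \<open>
  Two faces of \<open>\<gamma>\<close> meet in the simplex \<open>\<tau>\<close> obtained by deleting two vertices. Once these are moved to the
  end, the faces become \<open>\<tau> u\<close> and \<open>\<tau> v\<close>; by \<open>skip_sign\<close> the signs that arise cancel against the signs in
  the cross terms of \<open>|d \<phi>|\<^sup>2\<close>.
\<close>

lemma gap_density_move_last:
  assumes \<phi>: "\<phi> \<in> C k" and \<gamma>: "\<gamma> \<in> \<Sigma> (Suc k)" and i: "i \<le> Suc k" and l: "l \<le> k"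
  shows "gap_density k \<phi> (move_last l (move_last i \<gamma>)) =
     m \<gamma> * (- ((-1) ^ (i + skip i l) * inner (\<phi> (delete_nth i \<gamma>)) (\<phi> (delete_nth (skip i l) \<gamma>)))
       - link_cosine (delete_nth l (delete_nth i \<gamma>)) * (norm (\<phi> (delete_nth i \<gamma>)) * norm (\<phi> (delete_nth (skip i l) \<gamma>))))"
proof -
  let ?s = "skip i l" and ?i = "coskip i l"
  have len: "length \<gamma> = Suc (Suc k)" by (rule length_simplex[OF \<gamma>])
  note s = skip_bounds[OF i l]
  have faces: "delete_nth i \<gamma> \<in> \<Sigma> k" "delete_nth ?s \<gamma> \<in> \<Sigma> k"
    using delete_nth_in[OF \<gamma>] i s by auto
  have e: "move_last l (move_last i \<gamma>) = delete_nth l (delete_nth i \<gamma>) @ [\<gamma> ! i, delete_nth i \<gamma> ! l]"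
    using i l len by (simp add: move_last_def delete_nth_append nth_append)
  have len2: "length (delete_nth l (delete_nth i \<gamma>)) = k" using i l len by simp
  have del: "delete_nth k (move_last l (move_last i \<gamma>)) = move_last l (delete_nth i \<gamma>)"
    unfolding e using delete_nth_length[of "delete_nth l (delete_nth i \<gamma>)" "\<gamma> ! i" "[delete_nth i \<gamma> ! l]"] len2
    by (simp add: move_last_def)
  have but: "butlast (move_last l (move_last i \<gamma>)) = move_last ?i (delete_nth ?s \<gamma>)"
  proof -
    have "delete_nth ?s \<gamma> ! ?i = \<gamma> ! i"
      using s len by (simp add: nth_delete_nth skip_involution)
    then show ?thesis
      unfolding e by (simp add: butlast_append move_last_def delete_nth_delete_nth[OF len i l])
  qed
  have butbut: "butlast (butlast (move_last l (move_last i \<gamma>))) = delete_nth l (delete_nth i \<gamma>)"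
    unfolding e by (simp add: butlast_append)
  have m: "m (move_last l (move_last i \<gamma>)) = m \<gamma>"
    using i l len by (intro m_cong) (simp add: set_move_last)
  have sgn: "(-1::real) ^ (k - ?i) * (-1) ^ (k - l) = - ((-1) ^ (i + ?s))"
  proof -
    have "(-1::real) ^ (k - ?i) * (-1) ^ (k - l) = (-1) ^ (?i + l)"
      using s(2) l by (simp flip: power_add) (simp add: minus_one_power_iff)
    moreover have "(-1::real) ^ (?i + l) = - ((-1) ^ (i + ?s))"
      using skip_sign[of i l] by (auto simp: minus_one_power_iff split: if_splits)
    ultimately show ?thesis by simp
  qed
  have "inner (\<phi> (move_last ?i (delete_nth ?s \<gamma>))) (\<phi> (move_last l (delete_nth i \<gamma>)))
      = ((-1) ^ (k - ?i) * (-1) ^ (k - l)) * inner (\<phi> (delete_nth i \<gamma>)) (\<phi> (delete_nth ?s \<gamma>))"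
    using C_move_last[OF \<phi> faces(1) l] C_move_last[OF \<phi> faces(2) s(2)] by (simp add: inner_commute)
  moreover have "norm (\<phi> (move_last ?i (delete_nth ?s \<gamma>))) = norm (\<phi> (delete_nth ?s \<gamma>))"
      "norm (\<phi> (move_last l (delete_nth i \<gamma>))) = norm (\<phi> (delete_nth i \<gamma>))"
    using C_move_last[OF \<phi> faces(1) l] C_move_last[OF \<phi> faces(2) s(2)] by (simp_all add: power_abs)
  ultimately show ?thesis
    unfolding gap_density_def del but butbut[unfolded but] m sgn by (simp add: mult.commute)
qed

text \<open>
  Expand \<open>|d \<phi> \<gamma>|\<^sup>2 = 0\<close>.
\<close>

lemma cocycle_cross_terms:
  assumes \<gamma>: "\<gamma> \<in> \<Sigma> (Suc k)" and z: "d k \<phi> \<gamma> = 0"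
  shows "(\<Sum>i\<le>Suc k. (norm (\<phi> (delete_nth i \<gamma>)))\<^sup>2)
    = (\<Sum>i\<le>Suc k. \<Sum>l\<le>k. - ((-1) ^ (i + skip i l) * inner (\<phi> (delete_nth i \<gamma>)) (\<phi> (delete_nth (skip i l) \<gamma>))))"
proof -
  let ?t = "\<lambda>i s. (-1) ^ (i + s) * inner (\<phi> (delete_nth i \<gamma>)) (\<phi> (delete_nth s \<gamma>))"
  have "0 = inner (d k \<phi> \<gamma>) (d k \<phi> \<gamma>)" using z by simp
  also have "\<dots> = (\<Sum>i\<le>Suc k. \<Sum>s\<le>Suc k. ?t i s)"
    unfolding d_apply[OF \<gamma>] inner_sum_left inner_sum_right
    by (intro sum.cong refl) (simp add: power_add inner_commute)
  also have "\<dots> = (\<Sum>i\<le>Suc k. ?t i i + (\<Sum>l\<le>k. ?t i (skip i l)))"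
    by (intro sum.cong refl sum_split_skip) simp
  also have "\<dots> = (\<Sum>i\<le>Suc k. (norm (\<phi> (delete_nth i \<gamma>)))\<^sup>2) + (\<Sum>i\<le>Suc k. \<Sum>l\<le>k. ?t i (skip i l))"
    by (simp add: sum.distrib power2_norm_eq_inner del: sum.atMost_Suc)
  finally show ?thesis by (simp add: sum_negf del: sum.atMost_Suc)
qed

lemma invariant_sum_ext:
  assumes f: "invariant (Suc j) f"
  shows "invariant j (\<lambda>\<tau>. \<Sum>v\<in>ext \<tau>. f (\<tau> @ [v]))"
  unfolding invariant_def
proof (intro allI ballI)
  fix g \<tau> assume \<tau>: "\<tau> \<in> \<Sigma> j"
  have "(\<Sum>v\<in>ext (map (act g) \<tau>). f (map (act g) \<tau> @ [v])) = (\<Sum>v\<in>ext \<tau>. f (map (act g) \<tau> @ [act g v]))"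
    by (rule sum.reindex_bij_betw[OF ext_act[OF \<tau>], symmetric])
  also have "\<dots> = (\<Sum>v\<in>ext \<tau>. f (\<tau> @ [v]))"
  proof (rule sum.cong[OF refl])
    fix v assume "v \<in> ext \<tau>"
    then have "\<tau> @ [v] \<in> \<Sigma> (Suc j)" using mem_ext[OF \<tau>] by blast
    then show "f (map (act g) \<tau> @ [act g v]) = f (\<tau> @ [v])"
      using f unfolding invariant_def by fastforce
  qed
  finally show "(\<Sum>v\<in>ext (map (act g) \<tau>). f (map (act g) \<tau> @ [v])) = (\<Sum>v\<in>ext \<tau>. f (\<tau> @ [v]))" .
qed

lemma invariant_gap_density:
  assumes \<phi>: "\<phi> \<in> C (Suc j)" and j: "j < n"
  shows "invariant (Suc (Suc j)) (gap_density (Suc j) \<phi>)"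
  unfolding invariant_def
proof (intro allI ballI)
  fix g \<gamma> assume \<gamma>: "\<gamma> \<in> \<Sigma> (Suc (Suc j))"
  have b: "butlast \<gamma> \<in> \<Sigma> (Suc j)" "delete_nth (Suc j) \<gamma> \<in> \<Sigma> (Suc j)" "butlast (butlast \<gamma>) \<in> \<Sigma> j"
    using butlast_in[OF \<gamma>] delete_nth_in[OF \<gamma>] butlast_in by auto
  show "gap_density (Suc j) \<phi> (map (act g) \<gamma>) = gap_density (Suc j) \<phi> \<gamma>"
    unfolding gap_density_def map_butlast[symmetric] delete_nth_map[of _ "act g"] m_map_act[OF \<gamma>]
    using j by (simp add: C_act[OF \<phi>] b rho_inner rho_norm C_in[OF \<phi>] link_cosine_map_act[OF b(3)])
qed

text \<open>
  Absolute convergence of the sums below needs a bound of the cosines from both sides, uniform in the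
  link. It comes from the positive definiteness of the matrices in which the cosines occur.
\<close>

lemma abs_link_cosine_le_1:
  assumes \<gamma>: "\<gamma> \<in> \<Sigma> (Suc (Suc j))"
    and pd: "positive_definite_on (faces X (Suc j) \<gamma>) (A)"
  shows "\<bar>link_cosine (butlast (butlast \<gamma>))\<bar> \<le> 1"
proof -
  let ?k = "Suc j"
  \<comment> \<open>The simplex without its last two vertices is the meet of the last two faces.\<close>
  have "delete_nth (Suc ?k) \<gamma> = butlast \<gamma>"
    by (rule delete_nth_last[OF length_simplex[OF \<gamma>]])
  moreover have "delete_nth ?k (butlast \<gamma>) = butlast (butlast \<gamma>)"
    using length_simplex[OF \<gamma>] by (intro delete_nth_last) simp
  moreover have "skip (Suc ?k) ?k = ?k" by (simp add: skip_def)
  ultimately have entry: "A (delete_nth (Suc ?k) \<gamma>) (delete_nth ?k \<gamma>)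
      = - link_cosine (butlast (butlast \<gamma>))"
    using cosine_matrix_entry[OF \<gamma>, of "Suc ?k" ?k] by simp
  have "\<bar>A (delete_nth (Suc ?k) \<gamma>) (delete_nth ?k \<gamma>)\<bar> < 1"
  proof (rule positive_definite_off_diagonal[OF pd])
    show "finite (faces X ?k \<gamma>)" unfolding faces_eq[OF \<gamma>] by simp
    show "delete_nth (Suc ?k) \<gamma> \<in> faces X ?k \<gamma>" "delete_nth ?k \<gamma> \<in> faces X ?k \<gamma>"
      unfolding faces_eq[OF \<gamma>] by auto
    show "delete_nth (Suc ?k) \<gamma> \<noteq> delete_nth ?k \<gamma>"
      using inj_onD[OF inj_faces[OF \<gamma>], of "Suc ?k" ?k] by auto
  qed (simp_all add: cosine_matrix_def)
  then show ?thesis using entry by simp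
qed

lemma orbit_summable_gap_density:
  assumes \<phi>: "\<phi> \<in> L (Suc j)" and j: "Suc j \<le> n"
    and bound: "\<And>\<gamma>. \<gamma> \<in> R (Suc (Suc j)) \<Longrightarrow> \<bar>link_cosine (butlast (butlast \<gamma>))\<bar> \<le> 1"
  shows "orbit_summable (Suc (Suc j)) (gap_density (Suc j) \<phi>)"
proof (rule orbit_summable_comparison)
  show "orbit_summable (Suc (Suc j)) (\<lambda>\<gamma>. 2 * (m \<gamma> * (norm (\<phi> (butlast \<gamma>)))\<^sup>2 + m \<gamma> * (norm (\<phi> (delete_nth (Suc j) \<gamma>)))\<^sup>2))"
    using j by (intro orbit_summable_cmult orbit_summable_add butlast_energy(2)[OF \<phi>] face_energy(1)[OF \<phi>]) auto
  fix \<gamma> assume \<gamma>: "\<gamma> \<in> R (Suc (Suc j))"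
  let ?x = "\<phi> (butlast \<gamma>)" and ?y = "\<phi> (delete_nth (Suc j) \<gamma>)" and ?c = "link_cosine (butlast (butlast \<gamma>))"
  have "2 * (norm ?x * norm ?y) \<le> (norm ?x)\<^sup>2 + (norm ?y)\<^sup>2"
    using sum_squares_bound[of "norm ?x" "norm ?y"] by simp
  moreover have "0 \<le> norm ?x * norm ?y" by simp
  ultimately have xy: "norm ?x * norm ?y \<le> (norm ?x)\<^sup>2 + (norm ?y)\<^sup>2" by linarith
  have "\<bar>?c * (norm ?x * norm ?y)\<bar> \<le> 1 * (norm ?x * norm ?y)"
    unfolding abs_mult[of ?c] using bound[OF \<gamma>] by (intro mult_mono) auto
  then have "\<bar>inner ?x ?y - ?c * (norm ?x * norm ?y)\<bar> \<le> 2 * ((norm ?x)\<^sup>2 + (norm ?y)\<^sup>2)"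
    using abs_inner_le[of ?x ?y] xy abs_triangle_ineq4[of "inner ?x ?y" "?c * (norm ?x * norm ?y)"]
    by argo
  then have "m \<gamma> * \<bar>inner ?x ?y - ?c * (norm ?x * norm ?y)\<bar> \<le> m \<gamma> * (2 * ((norm ?x)\<^sup>2 + (norm ?y)\<^sup>2))"
    by (rule mult_left_mono) (rule m_nonneg)
  also have "\<dots> = 2 * (m \<gamma> * (norm ?x)\<^sup>2 + m \<gamma> * (norm ?y)\<^sup>2)" by (simp add: algebra_simps)
  finally show "\<bar>gap_density (Suc j) \<phi> \<gamma>\<bar> \<le> 2 * (m \<gamma> * (norm ?x)\<^sup>2 + m \<gamma> * (norm ?y)\<^sup>2)"
    unfolding gap_density_def abs_mult[of "m \<gamma>"] abs_of_nonneg[OF m_nonneg] .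
qed

text \<open>
  Unfolding along the last two vertices leaves for each \<open>\<tau>\<close> the edge sum over its link, which
  \<open>link_inequality\<close> estimates.
\<close>

lemma orbit_sum_gap_density_le:
  assumes \<phi>: "\<phi> \<in> L (Suc j)" and j: "Suc j < n"
    and sG: "orbit_summable (Suc (Suc j)) (gap_density (Suc j) \<phi>)"
  shows "orbit_sum (Suc (Suc j)) (gap_density (Suc j) \<phi>) \<le> norm_sq j (codiff j \<phi>)"
proof -
  let ?k = "Suc j"
  let ?G = "gap_density ?k \<phi>"
  note \<phi>C = L_C[OF \<phi>]
  have invG: "invariant (Suc ?k) ?G" using j by (intro invariant_gap_density[OF \<phi>C]) simp
  note u1 = unfold_last[OF invG sG]
  note u2 = unfold_last[OF invariant_sum_ext[OF invG] u1(1)]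
  have "orbit_sum (Suc ?k) ?G = orbit_sum j (\<lambda>\<tau>. \<Sum>u\<in>ext \<tau>. \<Sum>v\<in>ext (\<tau> @ [u]). ?G ((\<tau> @ [u]) @ [v]))"
    unfolding u2(2) u1(2) ..
  also have "\<dots> \<le> norm_sq j (codiff j \<phi>)"
    unfolding norm_sq_def
  proof (rule orbit_sum_mono[OF u2(1)])
    show "orbit_summable j (\<lambda>\<sigma>. energy (codiff j \<phi>) \<sigma>)"
      using j by (intro L_summable codiff_bounded(1)[OF \<phi>]) simp
    fix \<tau> assume "\<tau> \<in> R j"
    then have \<tau>: "\<tau> \<in> \<Sigma> j" by (rule R_in)
    have G: "?G ((\<tau> @ [u]) @ [v]) = m (\<tau> @ [u, v]) * (inner (\<phi> (\<tau> @ [u])) (\<phi> (\<tau> @ [v]))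
        - link_cosine \<tau> * (norm (\<phi> (\<tau> @ [u])) * norm (\<phi> (\<tau> @ [v]))))" for u v
      using delete_nth_length[of \<tau> u "[v]"] length_simplex[OF \<tau>]
      by (simp add: gap_density_def butlast_append)
    show "(\<Sum>u\<in>ext \<tau>. \<Sum>v\<in>ext (\<tau> @ [u]). ?G ((\<tau> @ [u]) @ [v])) \<le> energy (codiff j \<phi>) \<tau>"
      unfolding G using link_inequality[OF \<phi>C \<tau>] j by simp
  qed
  finally show ?thesis .
qed

text \<open>
  The quadratic form of the cosine matrix at the vector of the norms of \<open>\<phi>\<close> on the faces of \<open>\<gamma>\<close>
  involves \<open>\<Sum>\<^sub>i |\<phi> \<gamma>\<^sub>i|\<^sup>2\<close> and products of norms. For a cocycle the former equals the sum of the cross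
  terms, and the difference is then a sum of values of \<open>gap_density\<close>.
\<close>

lemma cocycle_le_gap_density:
  assumes \<gamma>: "\<gamma> \<in> \<Sigma> (Suc k)"
    and pd: "positive_definite_on (faces X k \<gamma>) (A)"
    and ev: "\<And>c. eigenvalue_on (faces X k \<gamma>) (A) c \<Longrightarrow> \<epsilon> \<le> c"
    and \<phi>: "\<phi> \<in> C k" and cocycle: "d k \<phi> \<gamma> = 0"
  shows "\<epsilon> * (\<Sum>i\<le>Suc k. m \<gamma> * (norm (\<phi> (delete_nth i \<gamma>)))\<^sup>2)
    \<le> (\<Sum>i\<le>Suc k. \<Sum>l\<le>k. gap_density k \<phi> (move_last l (move_last i \<gamma>)))"
proof -
  let ?D = "\<lambda>i. delete_nth i \<gamma>"
  let ?x = "\<lambda>\<sigma>. norm (\<phi> \<sigma>)"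
  have "\<epsilon> * (\<Sum>i\<le>Suc k. (?x (?D i))\<^sup>2) = \<epsilon> * (\<Sum>\<alpha>\<in>faces X k \<gamma>. (?x \<alpha>)\<^sup>2)"
    unfolding faces_eq[OF \<gamma>] by (simp only: sum.reindex[OF inj_faces[OF \<gamma>]] o_def)
  also have "\<dots> \<le> (\<Sum>\<alpha>\<in>faces X k \<gamma>. \<Sum>\<beta>\<in>faces X k \<gamma>. ?x \<alpha> * A \<alpha> \<beta> * ?x \<beta>)"
  proof (rule eigenvalues_bound_quadratic_form)
    show "finite (faces X k \<gamma>)" unfolding faces_eq[OF \<gamma>] by simp
  qed (use pd ev in \<open>auto simp: positive_definite_on_def\<close>)
  also have "\<dots> = (\<Sum>i\<le>Suc k. (?x (?D i))\<^sup>2) - (\<Sum>i\<le>Suc k. \<Sum>l\<le>k. link_cosine (delete_nth l (?D i)) * (?x (?D i) * ?x (?D (skip i l))))"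
    unfolding cosine_matrix_form[OF \<gamma>] by (rule sum_subtractf)
  also have "\<dots> = (\<Sum>i\<le>Suc k. \<Sum>l\<le>k. - ((-1) ^ (i + skip i l) * inner (\<phi> (?D i)) (\<phi> (?D (skip i l))))
      - link_cosine (delete_nth l (?D i)) * (?x (?D i) * ?x (?D (skip i l))))"
    unfolding cocycle_cross_terms[OF \<gamma> cocycle] by (simp only: sum_subtractf)
  finally have "m \<gamma> * (\<epsilon> * (\<Sum>i\<le>Suc k. (?x (?D i))\<^sup>2)) \<le> m \<gamma> * \<dots>"
    by (rule mult_left_mono) (rule m_nonneg)
  also have "\<dots> = (\<Sum>i\<le>Suc k. \<Sum>l\<le>k. gap_density k \<phi> (move_last l (move_last i \<gamma>)))"
    unfolding sum_distrib_left
    by (intro sum.cong refl gap_density_move_last[OF \<phi> \<gamma>, symmetric]) auto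
  also have "m \<gamma> * (\<epsilon> * (\<Sum>i\<le>Suc k. (?x (?D i))\<^sup>2)) = \<epsilon> * (\<Sum>i\<le>Suc k. m \<gamma> * (?x (?D i))\<^sup>2)"
    by (simp add: sum_distrib_left mult_ac del: sum.atMost_Suc)
  finally show ?thesis .
qed

text \<open>
  Sum \<open>cocycle_le_gap_density\<close> over all \<open>\<gamma>\<close>. Since moving vertices does not change sums over orbits, all
  pairs of vertices contribute the same amount, which \<open>orbit_sum_gap_density_le\<close> estimates.
\<close>

lemma spectral_gap:
  assumes j: "Suc j < n"
    and pd: "\<And>\<gamma>. \<gamma> \<in> R (Suc (Suc j)) \<Longrightarrow> positive_definite_on (faces X (Suc j) \<gamma>) (A)"
    and ev: "\<And>\<gamma> c. \<gamma> \<in> R (Suc (Suc j)) \<Longrightarrow> eigenvalue_on (faces X (Suc j) \<gamma>) (A) c \<Longrightarrow> \<epsilon> \<le> c"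
    and \<phi>: "\<phi> \<in> L (Suc j)" and cocycle: "d (Suc j) \<phi> = (\<lambda>_. 0)"
  shows "\<epsilon> * real (n - Suc j) * norm_sq (Suc j) \<phi> \<le> real (j + 2) * norm_sq j (codiff j \<phi>)"
proof -
  let ?k = "Suc j"
  let ?G = "gap_density ?k \<phi>"
  let ?S = "\<lambda>\<gamma>. \<Sum>i\<le>Suc ?k. m \<gamma> * (norm (\<phi> (delete_nth i \<gamma>)))\<^sup>2"
  note \<phi>C = L_C[OF \<phi>]
  have pd_bound: "\<bar>link_cosine (butlast (butlast \<gamma>))\<bar> \<le> 1" if "\<gamma> \<in> R (Suc ?k)" for \<gamma>
    using abs_link_cosine_le_1[OF R_in[OF that] pd[OF that]] .
  have invG: "invariant (Suc ?k) ?G" using j by (intro invariant_gap_density[OF \<phi>C]) simp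
  have sG: "orbit_summable (Suc ?k) ?G" using j by (intro orbit_summable_gap_density[OF \<phi> _ pd_bound]) auto
  have moved: "invariant (Suc ?k) (\<lambda>\<gamma>. ?G (move_last l \<gamma>))" "orbit_summable (Suc ?k) (\<lambda>\<gamma>. ?G (move_last l \<gamma>))"
    "orbit_sum (Suc ?k) (\<lambda>\<gamma>. ?G (move_last l \<gamma>)) = orbit_sum (Suc ?k) ?G" if "l \<le> ?k" for l
    using invariant_move_last[OF invG] orbit_sum_move_last[OF invG sG] that by auto
  let ?T = "\<lambda>\<gamma>. \<Sum>i\<le>Suc ?k. \<Sum>l\<le>?k. ?G (move_last l (move_last i \<gamma>))"
  have sT1: "orbit_summable (Suc ?k) (\<lambda>\<gamma>. ?G (move_last l (move_last i \<gamma>)))"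
    and osT1: "orbit_sum (Suc ?k) (\<lambda>\<gamma>. ?G (move_last l (move_last i \<gamma>))) = orbit_sum (Suc ?k) ?G"
    if "i \<le> Suc ?k" "l \<le> ?k" for i l
    using orbit_sum_move_last[OF moved(1,2) that(1)] moved(3) that(2) by auto
  have row: "orbit_summable (Suc ?k) (\<lambda>\<gamma>. \<Sum>l\<le>?k. ?G (move_last l (move_last i \<gamma>)))"
      "orbit_sum (Suc ?k) (\<lambda>\<gamma>. \<Sum>l\<le>?k. ?G (move_last l (move_last i \<gamma>)))
        = (\<Sum>l\<le>?k. orbit_sum (Suc ?k) (\<lambda>\<gamma>. ?G (move_last l (move_last i \<gamma>))))"
    if "i \<le> Suc ?k" for i
    using sT1[OF that] by (auto intro!: orbit_summable_sum orbit_sum_sum simp del: sum.atMost_Suc)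
  have sT: "orbit_summable (Suc ?k) ?T"
    by (rule orbit_summable_sum) (simp_all only: finite_atMost row(1) atMost_iff)
  have osT: "orbit_sum (Suc ?k) ?T = real (j + 3) * real (j + 2) * orbit_sum (Suc ?k) ?G"
  proof -
    have "orbit_sum (Suc ?k) ?T = (\<Sum>i\<le>Suc ?k. orbit_sum (Suc ?k) (\<lambda>\<gamma>. \<Sum>l\<le>?k. ?G (move_last l (move_last i \<gamma>))))"
      by (rule orbit_sum_sum) (simp_all only: finite_atMost row(1) atMost_iff)
    also have "\<dots> = (\<Sum>i\<le>Suc ?k. \<Sum>l\<le>?k. orbit_sum (Suc ?k) (\<lambda>\<gamma>. ?G (move_last l (move_last i \<gamma>))))"
      by (rule sum.cong[OF refl]) (simp only: row(2) atMost_iff)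
    also have "\<dots> = (\<Sum>i\<le>Suc ?k. \<Sum>l\<le>?k. orbit_sum (Suc ?k) ?G)"
      by (intro sum.cong refl osT1) auto
    finally show ?thesis by (simp add: algebra_simps del: sum.atMost_Suc)
  qed
  have sS: "orbit_summable (Suc ?k) ?S"
    using j by (intro orbit_summable_sum face_energy(1)[OF \<phi>]) auto
  have osS: "orbit_sum (Suc ?k) ?S = real (j + 3) * (real (n - ?k) * norm_sq ?k \<phi>)"
    using j by (subst orbit_sum_sum) (simp_all add: face_energy[OF \<phi>] del: sum.atMost_Suc)
  have pointwise: "\<epsilon> * ?S \<gamma> \<le> ?T \<gamma>" if "\<gamma> \<in> R (Suc ?k)" for \<gamma>
    by (rule cocycle_le_gap_density[OF R_in[OF that] pd[OF that] ev[OF that] \<phi>C fun_cong[OF cocycle]])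
  have G_le: "orbit_sum (Suc ?k) ?G \<le> norm_sq j (codiff j \<phi>)" by (rule orbit_sum_gap_density_le[OF \<phi> j sG])
  have "real (j + 3) * (\<epsilon> * real (n - ?k) * norm_sq ?k \<phi>) = orbit_sum (Suc ?k) (\<lambda>\<gamma>. \<epsilon> * ?S \<gamma>)"
    unfolding orbit_sum_cmult osS by simp
  also have "\<dots> \<le> orbit_sum (Suc ?k) ?T"
    by (rule orbit_sum_mono[OF orbit_summable_cmult[OF sS] sT pointwise])
  also have "\<dots> \<le> real (j + 3) * (real (j + 2) * norm_sq j (codiff j \<phi>))"
    unfolding osT mult.assoc by (intro mult_left_mono G_le) auto
  finally show ?thesis by (rule mult_left_le_imp_le) simp
qed

end

section \<open>From the spectral gap to exactness\<close>

subclass (in complex_hilbert) banach ..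

lemma L2_set_sum_le:
  "L2_set (\<lambda>i. \<Sum>s<N. f s i) F \<le> (\<Sum>s<N::nat. L2_set (f s) F)"
proof (induction N)
  case (Suc N)
  have "L2_set (\<lambda>i. \<Sum>s<Suc N. f s i) F \<le> L2_set (\<lambda>i. \<Sum>s<N. f s i) F + L2_set (f N) F"
    using L2_set_triangle_ineq[of "\<lambda>i. \<Sum>s<N. f s i" "f N" F] by simp
  then show ?case using Suc by simp
qed (simp add: L2_set_def)

context equivariant_cochains
begin

text \<open>
  A single term of the sum defining the norm; since the norm of \<open>\<phi>\<close> is constant on orbits, the estimate
  holds at every simplex. It gives pointwise convergence from convergence in norm.
\<close>

lemma norm_le_norm_sq:
  assumes \<phi>: "\<phi> \<in> L j" and \<tau>: "\<tau> \<in> \<Sigma> j"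
  shows "norm (\<phi> \<tau>) \<le> sqrt (vol \<tau> / m \<tau>) * sqrt (norm_sq j \<phi>)"
proof -
  obtain r g where r: "r \<in> R j" "\<tau> = map (act g) r" using R_ex[OF \<tau>] by blast
  have r\<Sigma>: "r \<in> \<Sigma> j" by (rule R_in[OF r(1)])
  have inv: "norm (\<phi> \<tau>) = norm (\<phi> r)" "m \<tau> = m r" "vol \<tau> = vol r"
    using C_norm_act[OF L_C[OF \<phi>] r\<Sigma>] m_map_act[OF r\<Sigma>] vol_map_act[OF r\<Sigma>] by (simp_all add: r(2))
  have "(\<Sum>\<sigma>\<in>{r}. energy \<phi> \<sigma> / vol \<sigma>) \<le> norm_sq j \<phi>"
    unfolding norm_sq_def using r(1) by (intro orbit_sum_term_le[OF L_summable[OF \<phi>]]) (auto simp: m_nonneg)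
  then have "(norm (\<phi> r))\<^sup>2 \<le> vol r / m r * norm_sq j \<phi>"
    using m_pos[OF r\<Sigma>] vol_pos[OF r\<Sigma>] by (simp add: field_simps)
  then have "sqrt ((norm (\<phi> r))\<^sup>2) \<le> sqrt (vol r / m r * norm_sq j \<phi>)" by (rule real_sqrt_le_mono)
  then show ?thesis unfolding inv real_sqrt_mult by simp
qed

lemma L2_set_le_norm_sq:
  assumes \<phi>: "\<phi> \<in> L j" and F: "finite F" "F \<subseteq> R j"
  shows "L2_set (\<lambda>\<tau>. sqrt (m \<tau> / vol \<tau>) * norm (\<phi> \<tau>)) F \<le> sqrt (norm_sq j \<phi>)"
proof -
  have "(\<Sum>\<tau>\<in>F. (sqrt (m \<tau> / vol \<tau>) * norm (\<phi> \<tau>))\<^sup>2) = (\<Sum>\<tau>\<in>F. energy \<phi> \<tau> / vol \<tau>)"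
    by (intro sum.cong refl) (simp add: power_mult_distrib m_nonneg)
  also have "\<dots> \<le> norm_sq j \<phi>"
    unfolding norm_sq_def by (intro orbit_sum_term_le[OF L_summable[OF \<phi>] F]) (simp add: m_nonneg)
  finally show ?thesis unfolding L2_set_def by (rule real_sqrt_le_mono)
qed

lemma rho_tendsto:
  assumes "f \<longlonglongrightarrow> x" "\<And>N. f N \<in> H" "x \<in> H"
  shows "(\<lambda>N. \<rho> g (f N)) \<longlonglongrightarrow> \<rho> g x"
proof -
  have "norm (\<rho> g (f N) - \<rho> g x) = norm (f N - x)" for N
  proof -
    have "\<rho> g (f N + (-1) *\<^sub>R x) = \<rho> g (f N) + (-1) *\<^sub>R \<rho> g x"
      by (simp only: rho_add[OF assms(2) H_scaleR[OF assms(3)]] rho_scaleR[OF assms(3)])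
    then show ?thesis
      using rho_norm[OF H_add[OF assms(2)[of N] H_scaleR[OF assms(3), of "-1"]], of g] by simp
  qed
  then show ?thesis
    using assms(1) by (simp add: tendsto_iff dist_norm)
qed

lemma C_limit:
  assumes f: "\<And>N. f N \<in> C j" and lim: "\<And>\<sigma>. (\<lambda>N. f N \<sigma>) \<longlonglongrightarrow> \<psi> \<sigma>"
  shows "\<psi> \<in> C j"
proof -
  have \<psi>H: "\<psi> \<sigma> \<in> H" for \<sigma>
    using closed_sequentially[OF H_closed _ lim[of \<sigma>]] C_in[OF f] by blast
  show ?thesis
    unfolding C_iff alternating_on_def
  proof (intro conjI allI impI ballI)
    fix \<sigma> assume "\<sigma> \<notin> \<Sigma> j"
    then have "(\<lambda>N. f N \<sigma>) = (\<lambda>_. 0)" using C_supp[OF f] by blast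
    then show "\<psi> \<sigma> = 0" using lim[of \<sigma>] by (simp add: LIMSEQ_const_iff)
  next
    fix xs a b ys assume "xs @ a # b # ys \<in> \<Sigma> j"
    then have "f N (xs @ b # a # ys) = - f N (xs @ a # b # ys)" for N
      using C_alt[OF f] unfolding alternating_on_def by blast
    then have "(\<lambda>N. f N (xs @ b # a # ys)) \<longlonglongrightarrow> - \<psi> (xs @ a # b # ys)"
      using tendsto_minus[OF lim[of "xs @ a # b # ys"]] by simp
    then show "\<psi> (xs @ b # a # ys) = - \<psi> (xs @ a # b # ys)"
      using lim LIMSEQ_unique by blast
  next
    fix g \<sigma> assume \<sigma>: "\<sigma> \<in> \<Sigma> j"
    have "(\<lambda>N. f N (map (act g) \<sigma>)) \<longlonglongrightarrow> \<rho> g (\<psi> \<sigma>)"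
      unfolding C_act[OF f \<sigma>] by (rule rho_tendsto[OF lim C_in[OF f] \<psi>H])
    then show "\<psi> (map (act g) \<sigma>) = \<rho> g (\<psi> \<sigma>)"
      using lim LIMSEQ_unique by blast
  qed (rule \<psi>H)
qed

text \<open>
  Fatou's lemma, applied to finite sets of representatives.
\<close>

lemma L_limit:
  assumes f: "\<And>N. f N \<in> L j" and lim: "\<And>\<sigma>. (\<lambda>N. f N \<sigma>) \<longlonglongrightarrow> \<psi> \<sigma>"
    and bound: "\<And>N F. finite F \<Longrightarrow> F \<subseteq> R j \<Longrightarrow> L2_set (\<lambda>\<tau>. sqrt (m \<tau> / vol \<tau>) * norm (f N \<tau>)) F \<le> B"
  shows "\<psi> \<in> L j"
proof -
  have "(\<Sum>\<tau>\<in>F. energy \<psi> \<tau> / vol \<tau>) \<le> B\<^sup>2" if F: "finite F" "F \<subseteq> R j" for F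
  proof (rule LIMSEQ_le_const2)
    show "(\<lambda>N. \<Sum>\<tau>\<in>F. m \<tau> * (norm (f N \<tau>))\<^sup>2 / vol \<tau>) \<longlonglongrightarrow> (\<Sum>\<tau>\<in>F. energy \<psi> \<tau> / vol \<tau>)"
      using F(2) vol_pos[OF R_in] by (intro tendsto_intros lim) (metis less_irrefl subsetD)
    have "(\<Sum>\<tau>\<in>F. m \<tau> * (norm (f N \<tau>))\<^sup>2 / vol \<tau>) \<le> B\<^sup>2" for N
    proof -
      have "(\<Sum>\<tau>\<in>F. m \<tau> * (norm (f N \<tau>))\<^sup>2 / vol \<tau>) = (\<Sum>\<tau>\<in>F. (sqrt (m \<tau> / vol \<tau>) * norm (f N \<tau>))\<^sup>2)"
        by (intro sum.cong refl) (simp add: power_mult_distrib m_nonneg)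
      also have "\<dots> = (L2_set (\<lambda>\<tau>. sqrt (m \<tau> / vol \<tau>) * norm (f N \<tau>)) F)\<^sup>2"
        by (simp add: L2_set_def sum_nonneg)
      also have "\<dots> \<le> B\<^sup>2" by (intro power_mono bound F L2_set_nonneg)
      finally show ?thesis .
    qed
    then show "\<exists>N. \<forall>M\<ge>N. (\<Sum>\<tau>\<in>F. m \<tau> * (norm (f M \<tau>))\<^sup>2 / vol \<tau>) \<le> B\<^sup>2" by blast
  qed
  then have "(\<lambda>\<tau>. energy \<psi> \<tau> / vol \<tau>) summable_on R j"
    by (intro nonneg_bdd_above_summable_on bdd_aboveI[of _ "B\<^sup>2"]) (auto simp: m_nonneg)
  then show ?thesis
    using C_limit[OF L_C[OF f] lim] by (simp add: L_iff orbit_summable_def)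
qed

lemma L_zero: "(\<lambda>_. 0) \<in> L j"
  by (simp add: L_iff C_iff alternating_on_def H_zero rho_0 orbit_summable_def)

lemma d_diff_scale: "d j (\<lambda>\<sigma>. \<phi> \<sigma> - t *\<^sub>R \<psi> \<sigma>) \<sigma> = d j \<phi> \<sigma> - t *\<^sub>R d j \<psi> \<sigma>"
  by (simp add: coboundary_def scaleR_sum_right sum_subtractf scaleR_diff_right mult.commute del: sum.atMost_Suc)

lemma d_add: "d j (\<lambda>\<sigma>. \<phi> \<sigma> + \<psi> \<sigma>) \<sigma> = d j \<phi> \<sigma> + d j \<psi> \<sigma>"
  by (simp add: coboundary_def sum.distrib scaleR_add_right del: sum.atMost_Suc)

lemma L_diff_scale: "\<phi> \<in> L j \<Longrightarrow> \<psi> \<in> L j \<Longrightarrow> (\<lambda>\<sigma>. \<phi> \<sigma> - t *\<^sub>R \<psi> \<sigma>) \<in> L j"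
  using L_add[of \<phi> j "\<lambda>\<sigma>. (-t) *\<^sub>R \<psi> \<sigma>"] L_scale[of \<psi> j "-t"] by simp

text \<open>
  Let \<open>\<delta>\<close> denote \<open>codiff j\<close>. On cocycles the operator \<open>\<phi> \<mapsto> \<phi> - t d \<delta> \<phi>\<close> is a strict contraction for small
  \<open>t\<close>, because \<open>|\<phi> - t d \<delta> \<phi>|\<^sup>2 = |\<phi>|\<^sup>2 - 2 t |\<delta> \<phi>|\<^sup>2 + t\<^sup>2 |d \<delta> \<phi>|\<^sup>2\<close> and \<open>|\<delta> \<phi>|\<^sup>2\<close> is at least \<open>c |\<phi>|\<^sup>2\<close>. Its
  iterates \<open>\<phi>\<^sub>s\<close> decay geometrically, so \<open>\<psi> = \<Sum>\<^sub>s t \<delta> \<phi>\<^sub>s\<close> converges, and \<open>d \<psi> = \<Sum>\<^sub>s (\<phi>\<^sub>s - \<phi>\<^sub>s\<^sub>+\<^sub>1) = \<phi>\<close>.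
\<close>

lemma cocycle_is_coboundary:
  assumes j: "j \<le> n" and c: "0 < c"
    and gap: "\<And>\<phi>. \<phi> \<in> L (Suc j) \<Longrightarrow> d (Suc j) \<phi> = (\<lambda>_. 0) \<Longrightarrow> c * norm_sq (Suc j) \<phi> \<le> norm_sq j (codiff j \<phi>)"
    and \<phi>: "\<phi> \<in> L (Suc j)" and cocycle: "d (Suc j) \<phi> = (\<lambda>_. 0)"
  shows "\<exists>\<psi>\<in>L j. d j \<psi> = \<phi>"
proof -
  define D where "D = max 1 ((real (j + 2))\<^sup>2 * real (n - j))"
  define t where "t = 1 / D"
  \<comment> \<open>The maximum keeps the rate positive when \<open>t * c\<close> is 1 or more.\<close>
  define r where "r = max (1 - t * c) (1 / 2)"
  have D: "1 \<le> D" by (simp add: D_def)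
  then have t: "0 < t" "t \<le> 1" "t * D = 1" by (simp_all add: t_def)
  have r: "0 < r" "r < 1" using t c by (auto simp: r_def)
  have d_le: "norm_sq (Suc j) (d j \<psi>) \<le> D * norm_sq j \<psi>" if "\<psi> \<in> L j" for \<psi>
  proof -
    have "norm_sq (Suc j) (d j \<psi>) \<le> (real (j + 2))\<^sup>2 * real (n - j) * norm_sq j \<psi>"
      by (rule d_bounded(2)[OF that j])
    also have "\<dots> \<le> D * norm_sq j \<psi>" by (intro mult_right_mono norm_sq_nonneg) (simp add: D_def)
    finally show ?thesis .
  qed
  define T where "T \<xi> = (\<lambda>\<sigma>. \<xi> \<sigma> - t *\<^sub>R d j (codiff j \<xi>) \<sigma>)" for \<xi>
  define \<Phi> where "\<Phi> s = (T ^^ s) \<phi>" for s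
  have \<Phi>0: "\<Phi> 0 = \<phi>" and \<Phi>Suc: "\<Phi> (Suc s) = T (\<Phi> s)" for s by (simp_all add: \<Phi>_def)
  have \<Phi>: "\<Phi> s \<in> L (Suc j) \<and> d (Suc j) (\<Phi> s) = (\<lambda>_. 0)" for s
  proof (induction s)
    case 0
    then show ?case using \<phi> cocycle by (simp add: \<Phi>0)
  next
    case (Suc s)
    have "d j (codiff j (\<Phi> s)) \<in> L (Suc j)"
      using Suc j by (intro d_bounded(1) codiff_bounded(1)) auto
    then have "T (\<Phi> s) \<in> L (Suc j)" using Suc unfolding T_def by (intro L_diff_scale) auto
    moreover have "d (Suc j) (T (\<Phi> s)) = (\<lambda>_. 0)"
      unfolding T_def using Suc by (intro ext) (simp add: d_diff_scale d_d)
    ultimately show ?case by (simp add: \<Phi>Suc)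
  qed
  note \<Phi>L = \<Phi>[THEN conjunct1] and \<Phi>d = \<Phi>[THEN conjunct2]
  have \<delta>L: "codiff j (\<Phi> s) \<in> L j" for s by (rule codiff_bounded(1)[OF \<Phi>L j])
  have step: "norm_sq (Suc j) (\<Phi> (Suc s)) \<le> norm_sq (Suc j) (\<Phi> s) - t * norm_sq j (codiff j (\<Phi> s))" for s
  proof -
    let ?\<delta> = "codiff j (\<Phi> s)"
    have "norm_sq (Suc j) (\<Phi> (Suc s)) = norm_sq (Suc j) (\<Phi> s) - 2 * t * norm_sq j ?\<delta> + t\<^sup>2 * norm_sq (Suc j) (d j ?\<delta>)"
      unfolding \<Phi>Suc T_def norm_sq_diff_scale[OF \<Phi>L d_bounded(1)[OF \<delta>L j]]
        d_codiff_adjoint[OF \<Phi>L \<delta>L j] norm_sq_ip[of j] ..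
    also have "t\<^sup>2 * norm_sq (Suc j) (d j ?\<delta>) \<le> t\<^sup>2 * (D * norm_sq j ?\<delta>)"
      by (intro mult_left_mono d_le \<delta>L) simp
    also have "t\<^sup>2 * (D * norm_sq j ?\<delta>) = (t * D) * (t * norm_sq j ?\<delta>)" by (simp add: power2_eq_square mult_ac)
    also have "\<dots> = t * norm_sq j ?\<delta>" by (simp add: t(3))
    finally show ?thesis by simp
  qed
  have decay: "norm_sq (Suc j) (\<Phi> s) \<le> r ^ s * norm_sq (Suc j) \<phi>" for s
  proof (induction s)
    case (Suc s)
    have "norm_sq (Suc j) (\<Phi> (Suc s)) \<le> norm_sq (Suc j) (\<Phi> s) - t * (c * norm_sq (Suc j) (\<Phi> s))"
      using step[of s] mult_left_mono[OF gap[OF \<Phi>L \<Phi>d, of s], of t] t by linarith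
    also have "\<dots> = (1 - t * c) * norm_sq (Suc j) (\<Phi> s)" by (simp add: algebra_simps)
    also have "\<dots> \<le> r * norm_sq (Suc j) (\<Phi> s)" by (intro mult_right_mono norm_sq_nonneg) (simp add: r_def)
    also have "\<dots> \<le> r * (r ^ s * norm_sq (Suc j) \<phi>)" using Suc r by (intro mult_left_mono) auto
    finally show ?case by (simp add: mult.assoc)
  qed (simp add: \<Phi>0)
  define q where "q = sqrt r"
  define E where "E = sqrt (norm_sq (Suc j) \<phi>)"
  have q: "0 < q" "q < 1" "0 \<le> E" using r by (auto simp: q_def E_def norm_sq_nonneg)
  have sqrt_decay: "sqrt (r ^ s * norm_sq (Suc j) \<phi>) = q ^ s * E" for s
    by (simp add: q_def E_def real_sqrt_mult real_sqrt_power)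
  have \<Phi>_le: "sqrt (norm_sq (Suc j) (\<Phi> s)) \<le> q ^ s * E" for s
    using real_sqrt_le_mono[OF decay] by (simp only: sqrt_decay)
  define a where "a s = (\<lambda>\<tau>. t *\<^sub>R codiff j (\<Phi> s) \<tau>)" for s
  have aL: "a s \<in> L j" for s unfolding a_def by (rule L_scale[OF \<delta>L])
  have a_le: "sqrt (norm_sq j (a s)) \<le> q ^ s * E" for s
  proof -
    have "norm_sq j (a s) = t\<^sup>2 * norm_sq j (codiff j (\<Phi> s))"
      unfolding norm_sq_def a_def orbit_sum_cmult[symmetric] by (intro orbit_sum_cong) (simp add: power_mult_distrib mult_ac)
    also have "\<dots> = t * (t * norm_sq j (codiff j (\<Phi> s)))" by (simp add: power2_eq_square)
    also have "\<dots> \<le> 1 * (t * norm_sq j (codiff j (\<Phi> s)))"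
      using t norm_sq_nonneg by (intro mult_right_mono) auto
    also have "\<dots> \<le> norm_sq (Suc j) (\<Phi> s)"
      using step[of s] norm_sq_nonneg[of "Suc j" "\<Phi> (Suc s)"] by simp
    also have "\<dots> \<le> r ^ s * norm_sq (Suc j) \<phi>" by (rule decay)
    finally show ?thesis using real_sqrt_le_mono sqrt_decay by metis
  qed
  have geo: "summable (\<lambda>s. q ^ s * E)" using q by (intro summable_mult2 summable_geometric) auto
  have a_summable: "summable (\<lambda>s. a s \<tau>)" for \<tau>
  proof (cases "\<tau> \<in> \<Sigma> j")
    case True
    have "norm (a s \<tau>) \<le> sqrt (vol \<tau> / m \<tau>) * (q ^ s * E)" for s
      using norm_le_norm_sq[OF aL True, of s] mult_left_mono[OF a_le, of "sqrt (vol \<tau> / m \<tau>)" s]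
      by (simp add: m_nonneg)
    then show ?thesis by (intro summable_comparison_test'[OF summable_mult[OF geo]]) auto
  next
    case False
    then show ?thesis using C_supp[OF L_C[OF aL]] by simp
  qed
  define \<psi>N where "\<psi>N N = (\<lambda>\<tau>. \<Sum>s<N. a s \<tau>)" for N
  define \<psi> where "\<psi> \<tau> = (\<Sum>s. a s \<tau>)" for \<tau>
  have \<psi>N_L: "\<psi>N N \<in> L j" for N
  proof (induction N)
    case 0
    then show ?case using L_zero by (simp add: \<psi>N_def)
  next
    case (Suc N)
    then show ?case using L_add[OF Suc aL[of N]] by (simp add: \<psi>N_def)
  qed
  have lim: "(\<lambda>N. \<psi>N N \<tau>) \<longlonglongrightarrow> \<psi> \<tau>" for \<tau>
    unfolding \<psi>N_def \<psi>_def by (rule summable_LIMSEQ[OF a_summable])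
  have "\<psi> \<in> L j"
  proof (rule L_limit[OF \<psi>N_L lim])
    fix N F assume F: "finite F" "F \<subseteq> R j"
    let ?w = "\<lambda>\<tau>. sqrt (m \<tau> / vol \<tau>)"
    have "L2_set (\<lambda>\<tau>. ?w \<tau> * norm (\<psi>N N \<tau>)) F \<le> L2_set (\<lambda>\<tau>. \<Sum>s<N. ?w \<tau> * norm (a s \<tau>)) F"
    proof (rule L2_set_mono)
      fix \<tau>
      have "?w \<tau> * norm (\<psi>N N \<tau>) \<le> ?w \<tau> * (\<Sum>s<N. norm (a s \<tau>))"
        unfolding \<psi>N_def by (intro mult_left_mono norm_sum) (simp add: m_nonneg)
      then show "?w \<tau> * norm (\<psi>N N \<tau>) \<le> (\<Sum>s<N. ?w \<tau> * norm (a s \<tau>))" by (simp add: sum_distrib_left)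
    qed (simp add: m_nonneg)
    also have "\<dots> \<le> (\<Sum>s<N. L2_set (\<lambda>\<tau>. ?w \<tau> * norm (a s \<tau>)) F)" by (rule L2_set_sum_le)
    also have "\<dots> \<le> (\<Sum>s<N. q ^ s * E)"
      by (intro sum_mono order_trans[OF L2_set_le_norm_sq[OF aL F] a_le])
    also have "\<dots> \<le> (\<Sum>s. q ^ s * E)" using q by (intro sum_le_suminf[OF geo]) auto
    finally show "L2_set (\<lambda>\<tau>. ?w \<tau> * norm (\<psi>N N \<tau>)) F \<le> (\<Sum>s. q ^ s * E)" .
  qed
  moreover have "d j \<psi> = \<phi>"
  proof
    fix \<sigma>
    have d\<psi>N: "d j (\<psi>N N) \<sigma> = \<phi> \<sigma> - \<Phi> N \<sigma>" for N
    proof (induction N)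
      case 0
      then show ?case by (simp add: \<psi>N_def \<Phi>0 coboundary_def)
    next
      case (Suc N)
      have "d j (\<psi>N (Suc N)) \<sigma> = d j (\<psi>N N) \<sigma> + d j (a N) \<sigma>"
        using d_add[of j "\<psi>N N" "a N" \<sigma>] by (simp add: \<psi>N_def)
      also have "d j (a N) \<sigma> = \<Phi> N \<sigma> - \<Phi> (Suc N) \<sigma>"
        using d_diff_scale[of j "\<lambda>_. 0" "-t" "codiff j (\<Phi> N)" \<sigma>]
        by (simp add: a_def \<Phi>Suc T_def coboundary_def)
      finally show ?case by (simp add: Suc)
    qed
    have "(\<lambda>N. \<Phi> N \<sigma>) \<longlonglongrightarrow> 0"
    proof (cases "\<sigma> \<in> \<Sigma> (Suc j)")
      case True
      have le: "norm (\<Phi> s \<sigma>) \<le> sqrt (vol \<sigma> / m \<sigma>) * (q ^ s * E)" for s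
        using norm_le_norm_sq[OF \<Phi>L True, of s] mult_left_mono[OF \<Phi>_le, of "sqrt (vol \<sigma> / m \<sigma>)" s]
        by (simp add: m_nonneg)
      have "(\<lambda>s. sqrt (vol \<sigma> / m \<sigma>) * (q ^ s * E)) \<longlonglongrightarrow> 0"
        by (rule summable_LIMSEQ_zero[OF summable_mult[OF geo]])
      then show ?thesis by (rule Lim_null_comparison[OF always_eventually[OF allI[OF le]]])
    next
      case False
      then show ?thesis using C_supp[OF L_C[OF \<Phi>L]] by simp
    qed
    then have "(\<lambda>N. d j (\<psi>N N) \<sigma>) \<longlonglongrightarrow> \<phi> \<sigma> - 0"
      unfolding d\<psi>N by (intro tendsto_intros)
    moreover have "(\<lambda>N. d j (\<psi>N N) \<sigma>) \<longlonglongrightarrow> d j \<psi> \<sigma>"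
    proof (cases "\<sigma> \<in> \<Sigma> (Suc j)")
      case True
      then show ?thesis unfolding d_apply[OF True] by (intro tendsto_intros lim)
    next
      case False
      then show ?thesis by (simp add: coboundary_def)
    qed
    ultimately show "d j \<psi> \<sigma> = \<phi> \<sigma>" using LIMSEQ_unique by fastforce
  qed
  ultimately show ?thesis by blast
qed

lemma cohomology_trivial:
  assumes exact: "\<And>\<phi>. \<phi> \<in> L (Suc j) \<Longrightarrow> d (Suc j) \<phi> = (\<lambda>_. 0) \<Longrightarrow> \<exists>\<psi>\<in>L j. d j \<psi> = \<phi>"
  shows "L2_cohomology X act \<mu> R H \<rho> (Suc j) = {L2_coboundaries X act \<mu> R H \<rho> (Suc j)}"
proof -
  let ?B = "L2_coboundaries X act \<mu> R H \<rho> (Suc j)" and ?Z = "L2_cocycles X act \<mu> R H \<rho> (Suc j)"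
  have B: "?B = d j ` L j" by (simp add: L2_coboundaries_def)
  have coset: "{\<lambda>\<sigma>. \<phi> \<sigma> + \<psi> \<sigma> | \<psi>. \<psi> \<in> ?B} = ?B" if \<phi>: "\<phi> \<in> ?Z" for \<phi>
  proof -
    from \<phi> obtain \<xi> where \<xi>: "\<xi> \<in> L j" "d j \<xi> = \<phi>"
      using exact by (auto simp: L2_cocycles_def)
    show ?thesis
    proof (intro set_eqI iffI)
      fix \<omega> assume "\<omega> \<in> {\<lambda>\<sigma>. \<phi> \<sigma> + \<psi> \<sigma> | \<psi>. \<psi> \<in> ?B}"
      then obtain \<psi> where \<psi>: "\<psi> \<in> L j" "\<omega> = (\<lambda>\<sigma>. \<phi> \<sigma> + d j \<psi> \<sigma>)" unfolding B by blast
      then have "\<omega> = d j (\<lambda>\<sigma>. \<xi> \<sigma> + \<psi> \<sigma>)" using \<xi>(2) by (auto simp: d_add)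
      then show "\<omega> \<in> ?B" unfolding B using L_add[OF \<xi>(1) \<psi>(1)] by blast
    next
      fix \<omega> assume "\<omega> \<in> ?B"
      then obtain \<psi> where \<psi>: "\<psi> \<in> L j" "\<omega> = d j \<psi>" unfolding B by blast
      let ?\<psi> = "\<lambda>\<sigma>. \<psi> \<sigma> - 1 *\<^sub>R \<xi> \<sigma>"
      have "\<omega> = (\<lambda>\<sigma>. \<phi> \<sigma> + d j ?\<psi> \<sigma>)"
        unfolding d_diff_scale \<psi>(2) \<xi>(2) by simp
      moreover have "d j ?\<psi> \<in> ?B" unfolding B using L_diff_scale[OF \<psi>(1) \<xi>(1)] by blast
      ultimately show "\<omega> \<in> {\<lambda>\<sigma>. \<phi> \<sigma> + \<psi> \<sigma> | \<psi>. \<psi> \<in> ?B}" by blast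
    qed
  qed
  have "(\<lambda>_. 0) \<in> ?Z"
    by (simp add: L2_cocycles_def L_zero) (simp add: coboundary_def fun_eq_iff)
  then have "?Z \<noteq> {}" by blast
  then show ?thesis unfolding L2_cohomology_def using coset by auto
qed

end

theorem theorem4p4:
  fixes X :: "'v set set"
    and act :: "'g::{topological_group_add, t2_space} \<Rightarrow> 'v \<Rightarrow> 'v"
    and \<mu> :: "'g measure"
    and R :: "nat \<Rightarrow> 'v list set"
    and n k :: nat
  assumes "abstract_complex X"
    and "locally_finite X"
    and "has_dimension X n"
    and "\<forall>s\<in>X. \<exists>t\<in>X. s \<subseteq> t \<and> card t = Suc n"
    and "links_connected X n"
    and "locally_compact_space (euclidean :: 'g topology)"
    and "unimodular TYPE('g)"
    and "left_haar_measure \<mu>"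
    and "properly_discontinuous X act"
    and "orbit_representatives X act R"
    and "1 \<le> k" and "k < n"
    and "\<forall>(H :: 'h::complex_hilbert set) \<rho>. unitary_rep H \<rho> \<longrightarrow>
           (\<exists>\<epsilon>>0. \<forall>\<gamma>\<in>R (k + 1).
              positive_definite_on (faces X k \<gamma>) (cosine_matrix X act H \<rho>) \<and>
              (\<forall>c. eigenvalue_on (faces X k \<gamma>) (cosine_matrix X act H \<rho>) c \<longrightarrow> \<epsilon> \<le> c))"
  shows "\<forall>(H :: 'h set) \<rho>. unitary_rep H \<rho> \<longrightarrow>
           L2_cohomology X act \<mu> R H \<rho> k = {L2_coboundaries X act \<mu> R H \<rho> k}"
proof (intro allI impI)
  fix H :: "'h set" and \<rho> :: "'g \<Rightarrow> 'h \<Rightarrow> 'h"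
  assume rep: "unitary_rep H \<rho>"
  interpret equivariant_cochains X act \<mu> R n H \<rho>
    by unfold_locales fact+
  obtain j where k: "k = Suc j" using \<open>1 \<le> k\<close> by (cases k) auto
  have j: "Suc j < n" using \<open>k < n\<close> k by simp
  obtain \<epsilon> where \<epsilon>: "0 < \<epsilon>"
    and pd: "\<And>\<gamma>. \<gamma> \<in> R (Suc (Suc j)) \<Longrightarrow> positive_definite_on (faces X (Suc j) \<gamma>) (cosine_matrix X act H \<rho>)"
    and ev: "\<And>\<gamma> c. \<gamma> \<in> R (Suc (Suc j)) \<Longrightarrow>
      eigenvalue_on (faces X (Suc j) \<gamma>) (cosine_matrix X act H \<rho>) c \<Longrightarrow> \<epsilon> \<le> c"
    using assms(13)[rule_format, OF rep] unfolding k Suc_eq_plus1[symmetric] by blast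
  define c where "c = \<epsilon> * real (n - Suc j) / real (j + 2)"
  have "0 < c" using \<epsilon> j by (simp add: c_def)
  have gap: "c * norm_sq (Suc j) \<phi> \<le> norm_sq j (codiff j \<phi>)"
    if "\<phi> \<in> L (Suc j)" "d (Suc j) \<phi> = (\<lambda>_. 0)" for \<phi>
    using spectral_gap[OF j pd ev that] by (simp add: c_def field_simps)
  show "L2_cohomology X act \<mu> R H \<rho> k = {L2_coboundaries X act \<mu> R H \<rho> k}"
    unfolding k
    by (rule cohomology_trivial[OF cocycle_is_coboundary[OF _ \<open>0 < c\<close> gap]])
       (use j in auto)
qed

end
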